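(* Let $\mathcal{L}$ be a finite relational language and $T_\forall$ a universal $\mathcal{L}$-theory such that the class of finite models of $T_\forall$ is a Fraïssé class with the Strong Amalgamation Property. Let $T$ be the model completion of $T_\forall$ and let $T^*$ be the theory of the Fraïssé limit of the class of finite models of $T^*_\forall$ (as defined in the context). Let $M\models T^*$, let $B$ be a branch (maximal chain) of $M$, and let $q_T(x)$ be the unique complete type over $M$ determined by $\{x>b : b\in B\}$. Then the dp-rank of $q_T$ is at least $\mathrm{dpr}(T)$, the dp-rank of the partial type $x=x$ ($x$ a single variable) in $T$. In particular, if $T$ has IP, so does $q_T$.
   Context: A Fraïssé class is a class of finitely generated structures with the hereditary property (HP), joint embedding property (JEP) and amalgamation property (AP). It has the Strong Amalgamation Property (SAP) if in AP, for embeddings $f_1:A\to B$, $f_2:A\to C$ the amalgamating embeddings $g_1:B\to D$, $g_2:C\to D$ ($g_1f_1=g_2f_2$) can be chosen with $\mathrm{Im}(g_1)\cap\mathrm{Im}(g_2)=\mathrm{Im}(g_2 f_2)$, and in JEP the images of the two structures can be chosen disjoint. Trees: $\mathcal{L}_{Tr}=\{\leq,\wedge\}$, and $Tr$ is the theory of meet-trees: $\leq$ is a partial order such that $\{y : y\leq x\}$ is linearly ordered for every $x$, and $x\wedge y$ is the greatest element of $\{z : z\leq x,y\}$. The theory $T^*_\forall$: for each $n$-place relation symbol $R\in\mathcal{L}$ let $R^*$ be an $(n+1)$-place relation symbol, and let $\mathcal{L}^*=\mathcal{L}_{Tr}\cup\{R^* : R\in\mathcal{L}\}$. Let $=^*(x,y,y')$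 stand for $x<y\wedge y'$. For a quantifier-free $\mathcal{L}$-formula $\psi(y)$ ($y$ a tuple), $\psi^*(x,y)$ is obtained from $\psi$ by replacing each atomic formula $R(\dots)$ (including equality) by $R^*(x,\dots)$. $T^*_\forall$ consists of the axioms of $Tr$; for each $n$-place $R\in\mathcal{L}$ the axioms (WD) $\forall x,y_0,\dots,y_{n-1},y'_0,\dots,y'_{n-1}\,\big(R^*(x,y_0,\dots,y_{n-1})\ \&\ x<y_i\wedge y'_i \text{ for all } i<n\big)\to R^*(x,y'_0,\dots,y'_{n-1})$, and (OC) $\forall x,y_0,\dots,y_{n-1}\, R^*(x,y_0,\dots,y_{n-1})\to x<y_i$ for all $i<n$; and for each axiom $\forall y\,\psi(y)$ of $T_\forall$ the axiom $\forall x,y\,(x<y\to\psi^*(x,y))$, where $x<y$ means that $x$ is smaller than every variable in $y$. The finite models of $T^*_\forall$ form a uniformly locally finite Fraïssé class, and $T^*$ is the theory of its Fraïssé limit (equivalently, the model completion of $T^*_\forall$; it has quantifier elimination). Likewise $T$ is the theory of the Fraïssé limit of the class of finite models of $T_\forall$. The partial type $\{x>b : b\in B\}$ determines a unique complete type over $M$. dp-rank: for a partial type $\Sigma(x)$ over $A$ and a cardinal $\kappa$, $\mathrm{dpr}(\Sigma)<\kappa$ if for every family $(I_\alpha)_{\alpha<\kappa}$ of $A$-mutually indiscernible infinite sequences and every $b\models\Sigma$ there is $\beta<\kappa$ such that $I_\beta$ is indiscernible over $bA$; otherwise $\mathrm{dpr}(\Sigma)\ge\kappa$. "$\mathrm{dpr}(\Sigma)$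 is at least $\mathrm{dpr}(\Sigma')$" means that for every cardinal $\kappa$, $\mathrm{dpr}(\Sigma)<\kappa$ implies $\mathrm{dpr}(\Sigma')<\kappa$. A partial type $\pi(x)$ has IP if there are a formula $\varphi(x,y)$ without parameters and realizations $(a_i)_{i<\omega}$ of $\pi$ such that for every $s\subseteq\omega$ the set $\{\varphi(a_i,y): i\in s\}\cup\{\neg\varphi(a_i,y): i\notin s\}$ is consistent. *)

theory Defs
  imports Main
begin

section \<open>First-order logic\<close>

record ('f, 'r) language =
  fun_syms :: "'f set"
  rel_syms :: "'r set"
  fun_ar :: "'f \<Rightarrow> nat"
  rel_ar :: "'r \<Rightarrow> nat"

datatype 'f tm = Var nat | Fun 'f "'f tm list"

datatype ('f, 'r) fm =
    Eq "'f tm" "'f tm"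
  | Rel 'r "'f tm list"
  | Neg "('f, 'r) fm"
  | And "('f, 'r) fm" "('f, 'r) fm"
  | Ex nat "('f, 'r) fm"

definition Imp :: "('f, 'r) fm \<Rightarrow> ('f, 'r) fm \<Rightarrow> ('f, 'r) fm" where
  "Imp \<phi> \<psi> = Neg (And \<phi> (Neg \<psi>))"

definition Imps :: "('f, 'r) fm list \<Rightarrow> ('f, 'r) fm \<Rightarrow> ('f, 'r) fm" where
  "Imps \<phi>s \<psi> = foldr Imp \<phi>s \<psi>"

definition Or :: "('f, 'r) fm \<Rightarrow> ('f, 'r) fm \<Rightarrow> ('f, 'r) fm" where
  "Or \<phi> \<psi> = Neg (And (Neg \<phi>) (Neg \<psi>))"

primrec tm_vars :: "'f tm \<Rightarrow> nat set" where
  "tm_vars (Var i) = {i}"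
| "tm_vars (Fun f ts) = \<Union> (set (map tm_vars ts))"

primrec fv :: "('f, 'r) fm \<Rightarrow> nat set" where
  "fv (Eq s t) = tm_vars s \<union> tm_vars t"
| "fv (Rel R ts) = (\<Union>t\<in>set ts. tm_vars t)"
| "fv (Neg \<phi>) = fv \<phi>"
| "fv (And \<phi> \<psi>) = fv \<phi> \<union> fv \<psi>"
| "fv (Ex i \<phi>) = fv \<phi> - {i}"

primrec wf_tm :: "('f, 'r) language \<Rightarrow> 'f tm \<Rightarrow> bool" where
  "wf_tm L (Var i) = True"
| "wf_tm L (Fun f ts) =
    (f \<in> fun_syms L \<and> length ts = fun_ar L f \<and> list_all id (map (wf_tm L) ts))"

primrec wf_fm :: "('f, 'r) language \<Rightarrow> ('f, 'r) fm \<Rightarrow> bool" where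
  "wf_fm L (Eq s t) = (wf_tm L s \<and> wf_tm L t)"
| "wf_fm L (Rel R ts) =
    (R \<in> rel_syms L \<and> length ts = rel_ar L R \<and> (\<forall>t\<in>set ts. wf_tm L t))"
| "wf_fm L (Neg \<phi>) = wf_fm L \<phi>"
| "wf_fm L (And \<phi> \<psi>) = (wf_fm L \<phi> \<and> wf_fm L \<psi>)"
| "wf_fm L (Ex i \<phi>) = wf_fm L \<phi>"

primrec quantifier_free :: "('f, 'r) fm \<Rightarrow> bool" where
  "quantifier_free (Eq s t) = True"
| "quantifier_free (Rel R ts) = True"
| "quantifier_free (Neg \<phi>) = quantifier_free \<phi>"
| "quantifier_free (And \<phi> \<psi>) = (quantifier_free \<phi> \<and> quantifier_free \<psi>)"
| "quantifier_free (Ex i \<phi>) = False"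

record ('a, 'f, 'r) struc =
  carrier :: "'a set"
  fun_int :: "'f \<Rightarrow> 'a list \<Rightarrow> 'a"
  rel_int :: "'r \<Rightarrow> 'a list \<Rightarrow> bool"

definition tuple :: "('a, 'f, 'r) struc \<Rightarrow> nat \<Rightarrow> 'a list \<Rightarrow> bool" where
  "tuple M n as \<longleftrightarrow> length as = n \<and> set as \<subseteq> carrier M"

definition closed_under :: "('f, 'r) language \<Rightarrow> ('a, 'f, 'r) struc \<Rightarrow> 'a set \<Rightarrow> bool" where
  "closed_under L M X \<longleftrightarrow>
    (\<forall>f\<in>fun_syms L. \<forall>as. length as = fun_ar L f \<and> set as \<subseteq> X \<longrightarrow> fun_int M f as \<in> X)"

definition is_structure :: "('f, 'r) language \<Rightarrow> ('a, 'f, 'r) struc \<Rightarrow> bool" where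
  "is_structure L M \<longleftrightarrow> carrier M \<noteq> {} \<and> closed_under L M (carrier M)"

primrec tm_val :: "('a, 'f, 'r) struc \<Rightarrow> (nat \<Rightarrow> 'a) \<Rightarrow> 'f tm \<Rightarrow> 'a" where
  "tm_val M v (Var i) = v i"
| "tm_val M v (Fun f ts) = fun_int M f (map (tm_val M v) ts)"

primrec sat :: "('a, 'f, 'r) struc \<Rightarrow> (nat \<Rightarrow> 'a) \<Rightarrow> ('f, 'r) fm \<Rightarrow> bool" where
  "sat M v (Eq s t) = (tm_val M v s = tm_val M v t)"
| "sat M v (Rel R ts) = rel_int M R (map (tm_val M v) ts)"
| "sat M v (Neg \<phi>) = (\<not> sat M v \<phi>)"
| "sat M v (And \<phi> \<psi>) = (sat M v \<phi> \<and> sat M v \<psi>)"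
| "sat M v (Ex i \<phi>) = (\<exists>a\<in>carrier M. sat M (v(i := a)) \<phi>)"

text \<open>Only used for \<open>fv \<phi> \<subseteq> {..<length as}\<close>, so the values of \<open>(!)\<close> out of range do not matter.\<close>

definition sat_at :: "('a, 'f, 'r) struc \<Rightarrow> 'a list \<Rightarrow> ('f, 'r) fm \<Rightarrow> bool" where
  "sat_at M as \<phi> \<longleftrightarrow> sat M (\<lambda>i. as ! i) \<phi>"

text \<open>A formula with free variables, as a member of a theory, stands for its universal closure.\<close>

definition holds :: "('a, 'f, 'r) struc \<Rightarrow> ('f, 'r) fm \<Rightarrow> bool" where
  "holds M \<phi> \<longleftrightarrow> (\<forall>v. range v \<subseteq> carrier M \<longrightarrow> sat M v \<phi>)"

definition models :: "('f, 'r) language \<Rightarrow> ('a, 'f, 'r) struc \<Rightarrow> ('f, 'r) fm set \<Rightarrow> bool" where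
  "models L M T \<longleftrightarrow> is_structure L M \<and> (\<forall>\<phi>\<in>T. holds M \<phi>)"

definition Th :: "('f, 'r) language \<Rightarrow> ('a, 'f, 'r) struc \<Rightarrow> ('f, 'r) fm set" where
  "Th L M = {\<phi>. wf_fm L \<phi> \<and> fv \<phi> = {} \<and> holds M \<phi>}"

definition embedding ::
  "('f, 'r) language \<Rightarrow> ('a, 'f, 'r) struc \<Rightarrow> ('b, 'f, 'r) struc \<Rightarrow> ('a \<Rightarrow> 'b) \<Rightarrow> bool" where
  "embedding L A B h \<longleftrightarrow>
    h ` carrier A \<subseteq> carrier B \<and> inj_on h (carrier A) \<and>
    (\<forall>f\<in>fun_syms L. \<forall>as. tuple A (fun_ar L f) as \<longrightarrow>
      h (fun_int A f as) = fun_int B f (map h as)) \<and>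
    (\<forall>R\<in>rel_syms L. \<forall>as. tuple A (rel_ar L R) as \<longrightarrow>
      (rel_int A R as \<longleftrightarrow> rel_int B R (map h as)))"

definition elementary_embedding ::
  "('f, 'r) language \<Rightarrow> ('a, 'f, 'r) struc \<Rightarrow> ('b, 'f, 'r) struc \<Rightarrow> ('a \<Rightarrow> 'b) \<Rightarrow> bool" where
  "elementary_embedding L M N e \<longleftrightarrow>
    e ` carrier M \<subseteq> carrier N \<and>
    (\<forall>\<phi> v. wf_fm L \<phi> \<and> range v \<subseteq> carrier M \<longrightarrow> (sat M v \<phi> \<longleftrightarrow> sat N (e \<circ> v) \<phi>))"

text \<open>Relation symbols have positive arity, as usual.\<close>

definition finite_relational :: "('f, 'r) language \<Rightarrow> bool" where
  "finite_relational L \<longleftrightarrow>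
    fun_syms L = {} \<and> finite (rel_syms L) \<and> (\<forall>R\<in>rel_syms L. rel_ar L R > 0)"

text \<open>The axioms \<open>\<forall>y. \<psi>(y)\<close> are given by their matrices \<open>\<psi>\<close>, see \<^const>\<open>holds\<close>.\<close>

definition universal_theory :: "('f, 'r) language \<Rightarrow> ('f, 'r) fm set \<Rightarrow> bool" where
  "universal_theory L T \<longleftrightarrow> (\<forall>\<psi>\<in>T. wf_fm L \<psi> \<and> quantifier_free \<psi>)"


section \<open>Fraisse classes and limits\<close>

definition fin_gen :: "('f, 'r) language \<Rightarrow> ('a, 'f, 'r) struc \<Rightarrow> bool" where
  "fin_gen L A \<longleftrightarrow> is_structure L A \<and>
    (\<exists>S. finite S \<and> S \<subseteq> carrier A \<and>
      (\<forall>X. S \<subseteq> X \<and> X \<subseteq> carrier A \<and> closed_under L A X \<longrightarrow> X = carrier A))"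

text \<open>
  A class of at most countable structures is represented by the set of its members with carrier
  in \<^typ>\<open>nat\<close>; every member is isomorphic to one of these.
\<close>

definition HP :: "('f, 'r) language \<Rightarrow> (nat, 'f, 'r) struc set \<Rightarrow> bool" where
  "HP L K \<longleftrightarrow> (\<forall>A\<in>K. \<forall>B h. fin_gen L B \<and> embedding L B A h \<longrightarrow> B \<in> K)"

definition JEP :: "('f, 'r) language \<Rightarrow> (nat, 'f, 'r) struc set \<Rightarrow> bool" where
  "JEP L K \<longleftrightarrow> (\<forall>A\<in>K. \<forall>B\<in>K. \<exists>C\<in>K. \<exists>g1 g2. embedding L A C g1 \<and> embedding L B C g2)"

definition AP :: "('f, 'r) language \<Rightarrow> (nat, 'f, 'r) struc set \<Rightarrow> bool" where
  "AP L K \<longleftrightarrow> (\<forall>A\<in>K. \<forall>B\<in>K. \<forall>C\<in>K. \<forall>f1 f2. embedding L A B f1 \<and> embedding L A C f2 \<longrightarrow>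
    (\<exists>D\<in>K. \<exists>g1 g2. embedding L B D g1 \<and> embedding L C D g2 \<and>
      (\<forall>a\<in>carrier A. g1 (f1 a) = g2 (f2 a))))"

definition fraisse_class :: "('f, 'r) language \<Rightarrow> (nat, 'f, 'r) struc set \<Rightarrow> bool" where
  "fraisse_class L K \<longleftrightarrow> (\<forall>A\<in>K. fin_gen L A) \<and> HP L K \<and> JEP L K \<and> AP L K"

definition SAP :: "('f, 'r) language \<Rightarrow> (nat, 'f, 'r) struc set \<Rightarrow> bool" where
  "SAP L K \<longleftrightarrow>
    (\<forall>A\<in>K. \<forall>B\<in>K. \<forall>C\<in>K. \<forall>f1 f2. embedding L A B f1 \<and> embedding L A C f2 \<longrightarrow>
      (\<exists>D\<in>K. \<exists>g1 g2. embedding L B D g1 \<and> embedding L C D g2 \<and>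
        (\<forall>a\<in>carrier A. g1 (f1 a) = g2 (f2 a)) \<and>
        g1 ` carrier B \<inter> g2 ` carrier C = (g2 \<circ> f2) ` carrier A)) \<and>
    (\<forall>A\<in>K. \<forall>B\<in>K. \<exists>C\<in>K. \<exists>g1 g2. embedding L A C g1 \<and> embedding L B C g2 \<and>
      g1 ` carrier A \<inter> g2 ` carrier B = {})"

definition finite_models ::
  "('f, 'r) language \<Rightarrow> ('f, 'r) fm set \<Rightarrow> (nat, 'f, 'r) struc set" where
  "finite_models L T = {A. finite (carrier A) \<and> models L A T}"

text \<open>
  An isomorphism between finitely generated substructures of \<open>F\<close> is the same as an embedding
  into \<open>F\<close> of a finitely generated substructure.
\<close>

definition ultrahomogeneous :: "('f, 'r) language \<Rightarrow> ('a, 'f, 'r) struc \<Rightarrow> bool" where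
  "ultrahomogeneous L F \<longleftrightarrow>
    (\<forall>X h. X \<subseteq> carrier F \<and> fin_gen L (F\<lparr>carrier := X\<rparr>) \<and>
        embedding L (F\<lparr>carrier := X\<rparr>) F h \<longrightarrow>
      (\<exists>g. embedding L F F g \<and> g ` carrier F = carrier F \<and> (\<forall>x\<in>X. g x = h x)))"

definition age :: "('f, 'r) language \<Rightarrow> ('a, 'f, 'r) struc \<Rightarrow> (nat, 'f, 'r) struc set" where
  "age L F = {A. fin_gen L A \<and> (\<exists>h. embedding L A F h)}"

definition fraisse_limit ::
  "('f, 'r) language \<Rightarrow> (nat, 'f, 'r) struc set \<Rightarrow> ('a, 'f, 'r) struc \<Rightarrow> bool" where
  "fraisse_limit L K F \<longleftrightarrow>
    is_structure L F \<and> (\<exists>enum :: 'a \<Rightarrow> nat. inj_on enum (carrier F)) \<and>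
    age L F = K \<and> ultrahomogeneous L F"


section \<open>The theory of trees of models\<close>

datatype tree_fun = Meet

datatype 'r tree_rel = Le | Star 'r

definition star_lang :: "('f, 'r) language \<Rightarrow> (tree_fun, 'r tree_rel) language" where
  "star_lang L =
    \<lparr>fun_syms = {Meet},
     rel_syms = insert Le (Star ` rel_syms L),
     fun_ar = (\<lambda>_. 2),
     rel_ar = (\<lambda>S. case S of Le \<Rightarrow> 2 | Star R \<Rightarrow> Suc (rel_ar L R))\<rparr>"

definition meet :: "tree_fun tm \<Rightarrow> tree_fun tm \<Rightarrow> tree_fun tm" where
  "meet s t = Fun Meet [s, t]"

definition le :: "tree_fun tm \<Rightarrow> tree_fun tm \<Rightarrow> (tree_fun, 'r tree_rel) fm" where
  "le s t = Rel Le [s, t]"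

definition lt :: "tree_fun tm \<Rightarrow> tree_fun tm \<Rightarrow> (tree_fun, 'r tree_rel) fm" where
  "lt s t = And (le s t) (Neg (Eq s t))"

definition Tr :: "(tree_fun, 'r tree_rel) fm set" where
  "Tr = (let x = Var 0; y = Var 1; z = Var 2 in
    {le x x,
     Imps [le x y, le y x] (Eq x y),
     Imps [le x y, le y z] (le x z),
     Imps [le y x, le z x] (Or (le y z) (le z y)),
     le (meet x y) x,
     le (meet x y) y,
     Imps [le z x, le z y] (le z (meet x y))})"

text \<open>
  In \<open>\<psi>\<^sup>*(x, y)\<close> the new variable \<open>x\<close> is \<open>Var 0\<close> and the variables of \<open>\<psi>\<close> are shifted by one.
  The equations for \<^const>\<open>Fun\<close> and \<^const>\<open>Ex\<close> are irrelevant: the translation is only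
  applied to quantifier-free formulas of a relational language.
\<close>

primrec star_tm :: "'f tm \<Rightarrow> tree_fun tm" where
  "star_tm (Var i) = Var (Suc i)"
| "star_tm (Fun f ts) = Var 0"

primrec star_fm :: "('f, 'r) fm \<Rightarrow> (tree_fun, 'r tree_rel) fm" where
  "star_fm (Eq s t) = lt (Var 0) (meet (star_tm s) (star_tm t))"
| "star_fm (Rel R ts) = Rel (Star R) (Var 0 # map star_tm ts)"
| "star_fm (Neg \<phi>) = Neg (star_fm \<phi>)"
| "star_fm (And \<phi> \<psi>) = And (star_fm \<phi>) (star_fm \<psi>)"
| "star_fm (Ex i \<phi>) = Ex (Suc i) (star_fm \<phi>)"

text \<open>
  In \<open>WD\<close> and \<open>OC\<close> the variables \<open>x\<close>, \<open>y\<^sub>i\<close>, \<open>y'\<^sub>i\<close> are \<open>Var 0\<close>, \<open>Var (1 + i)\<close>, \<open>Var (1 + n + i)\<close>.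
\<close>

definition WD :: "nat \<Rightarrow> 'r \<Rightarrow> (tree_fun, 'r tree_rel) fm" where
  "WD n R =
    Imps (Rel (Star R) (Var 0 # map (\<lambda>i. Var (1 + i)) [0..<n]) #
          map (\<lambda>i. lt (Var 0) (meet (Var (1 + i)) (Var (1 + n + i)))) [0..<n])
      (Rel (Star R) (Var 0 # map (\<lambda>i. Var (1 + n + i)) [0..<n]))"

definition OC :: "nat \<Rightarrow> 'r \<Rightarrow> nat \<Rightarrow> (tree_fun, 'r tree_rel) fm" where
  "OC n R i =
    Imp (Rel (Star R) (Var 0 # map (\<lambda>i. Var (1 + i)) [0..<n])) (lt (Var 0) (Var (1 + i)))"

definition star_axiom :: "('f, 'r) fm \<Rightarrow> (tree_fun, 'r tree_rel) fm" where
  "star_axiom \<psi> =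
    Imps (map (\<lambda>i. lt (Var 0) (Var (Suc i))) (sorted_list_of_set (fv \<psi>))) (star_fm \<psi>)"

definition star_theory ::
  "('f, 'r) language \<Rightarrow> ('f, 'r) fm set \<Rightarrow> (tree_fun, 'r tree_rel) fm set" where
  "star_theory L T =
    Tr \<union> {WD (rel_ar L R) R | R. R \<in> rel_syms L}
       \<union> {OC (rel_ar L R) R i | R i. R \<in> rel_syms L \<and> i < rel_ar L R}
       \<union> star_axiom ` T"

definition branch :: "('a, tree_fun, 'r tree_rel) struc \<Rightarrow> 'a set \<Rightarrow> bool" where
  "branch M B \<longleftrightarrow> pred_on.maxchain (carrier M) (\<lambda>a b. rel_int M Le [a, b]) B"


section \<open>Types\<close>

text \<open>
  A formula \<open>\<phi>(x, p)\<close> in variables \<open>x = (x\<^sub>0, \<dots>, x\<^bsub>n-1\<^esub>)\<close> with parameters \<open>p\<close> from \<open>A\<close> is a pair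
  \<open>(\<phi>, p)\<close>, where \<open>Var i\<close> stands for \<open>x\<^sub>i\<close> if \<open>i < n\<close> and \<open>Var (n + j)\<close> stands for \<open>p ! j\<close>.
\<close>

definition forms_over ::
  "('f, 'r) language \<Rightarrow> nat \<Rightarrow> 'a set \<Rightarrow> (('f, 'r) fm \<times> 'a list) set" where
  "forms_over L n A = {(\<phi>, p). wf_fm L \<phi> \<and> fv \<phi> \<subseteq> {..<n + length p} \<and> set p \<subseteq> A}"

definition realizes ::
  "('a, 'f, 'r) struc \<Rightarrow> nat \<Rightarrow> (('f, 'r) fm \<times> 'a list) set \<Rightarrow> 'a list \<Rightarrow> bool" where
  "realizes M n \<pi> a \<longleftrightarrow> tuple M n a \<and> (\<forall>(\<phi>, p)\<in>\<pi>. sat_at M (a @ p) \<phi>)"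

text \<open>Consistency, by compactness, of a set of formulas with parameters in \<open>M\<close> with the
  elementary diagram of \<open>M\<close>.\<close>

definition consistent ::
  "('a, 'f, 'r) struc \<Rightarrow> nat \<Rightarrow> (('f, 'r) fm \<times> 'a list) set \<Rightarrow> bool" where
  "consistent M n \<pi> \<longleftrightarrow> (\<forall>\<pi>0\<subseteq>\<pi>. finite \<pi>0 \<longrightarrow> (\<exists>a. realizes M n \<pi>0 a))"

definition complete_type ::
  "('f, 'r) language \<Rightarrow> ('a, 'f, 'r) struc \<Rightarrow> nat \<Rightarrow> 'a set
    \<Rightarrow> (('f, 'r) fm \<times> 'a list) set \<Rightarrow> bool" where
  "complete_type L M n A q \<longleftrightarrow>
    q \<subseteq> forms_over L n A \<and> consistent M n q \<and>
    (\<forall>(\<phi>, p)\<in>forms_over L n A. (\<phi>, p) \<in> q \<or> (Neg \<phi>, p) \<in> q)"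

definition above_branch :: "'a set \<Rightarrow> ((tree_fun, 'r tree_rel) fm \<times> 'a list) set" where
  "above_branch B = {(lt (Var 1) (Var 0), [b]) | b. b \<in> B}"

definition push ::
  "('a \<Rightarrow> 'b) \<Rightarrow> (('f, 'r) fm \<times> 'a list) set \<Rightarrow> (('f, 'r) fm \<times> 'b list) set" where
  "push e \<pi> = (\<lambda>(\<phi>, p). (\<phi>, map e p)) ` \<pi>"


section \<open>dp-rank and the independence property\<close>

text \<open>
  Sequences have index set \<^typ>\<open>nat\<close> and consist of finite tuples of a common length \<open>l\<close>.
\<close>

definition indiscernible ::
  "('f, 'r) language \<Rightarrow> ('a, 'f, 'r) struc \<Rightarrow> 'a set \<Rightarrow> (nat \<Rightarrow> 'a list) \<Rightarrow> bool" where
  "indiscernible L M A I \<longleftrightarrow>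
    (\<exists>l. (\<forall>i. tuple M l (I i)) \<and>
      (\<forall>is js \<phi> p. sorted_wrt (<) is \<and> sorted_wrt (<) js \<and> length is = length js \<and>
          (\<phi>, p) \<in> forms_over L (length is * l) A \<longrightarrow>
        (sat_at M (concat (map I is) @ p) \<phi> \<longleftrightarrow> sat_at M (concat (map I js) @ p) \<phi>)))"

definition mutually_indiscernible ::
  "('f, 'r) language \<Rightarrow> ('a, 'f, 'r) struc \<Rightarrow> 'a set \<Rightarrow> 'k set \<Rightarrow> ('k \<Rightarrow> nat \<Rightarrow> 'a list) \<Rightarrow> bool" where
  "mutually_indiscernible L M A K I \<longleftrightarrow>
    (\<forall>\<alpha>\<in>K. indiscernible L M (A \<union> (\<Union>\<beta>\<in>K - {\<alpha>}. \<Union>i. set (I \<beta> i))) (I \<alpha>))"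

definition dpr_less_in ::
  "('f, 'r) language \<Rightarrow> ('a, 'f, 'r) struc \<Rightarrow> 'a set \<Rightarrow> nat \<Rightarrow> (('f, 'r) fm \<times> 'a list) set
    \<Rightarrow> 'k rel \<Rightarrow> bool" where
  "dpr_less_in L N A n \<pi> \<kappa> \<longleftrightarrow>
    (\<forall>I b. mutually_indiscernible L N A (Field \<kappa>) I \<and> realizes N n \<pi> b \<longrightarrow>
      (\<exists>\<beta>\<in>Field \<kappa>. indiscernible L N (A \<union> set b) (I \<beta>)))"

text \<open>
  \<open>dpr(\<pi>) < \<kappa>\<close>, for a partial type \<open>\<pi>\<close> over \<open>A \<subseteq> M\<close>. Sequences and realizations are taken in
  arbitrary elementary extensions \<open>N\<close> of \<open>M\<close>, which replace a monster model. The type \<open>'u\<close>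
  provides the universes of these extensions. By the downward Loewenheim-Skolem theorem (all
  languages here are countable) every witness of \<open>dpr(\<pi>) \<ge> \<kappa>\<close> can be found in a universe of
  size at most \<open>|M| + \<kappa> + \<aleph>\<^sub>0\<close>, so that the notion does not depend on \<open>'u\<close> as long as \<open>'u\<close> has
  at least this size.
\<close>

definition dpr_less ::
  "'u itself \<Rightarrow> ('f, 'r) language \<Rightarrow> ('a, 'f, 'r) struc \<Rightarrow> 'a set \<Rightarrow> nat
    \<Rightarrow> (('f, 'r) fm \<times> 'a list) set \<Rightarrow> 'k rel \<Rightarrow> bool" where
  "dpr_less (_ :: 'u itself) L M A n \<pi> \<kappa> \<longleftrightarrow>
    (\<forall>(N :: ('u, 'f, 'r) struc) e. is_structure L N \<and> elementary_embedding L M N e \<longrightarrow>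
      dpr_less_in L N (e ` A) n (push e \<pi>) \<kappa>)"

text \<open>\<open>dpr(T) < \<kappa>\<close>, for the partial type \<open>x = x\<close> over the empty set in a complete theory \<open>T\<close>.\<close>

definition theory_dpr_less ::
  "'v itself \<Rightarrow> ('f, 'r) language \<Rightarrow> ('f, 'r) fm set \<Rightarrow> 'k rel \<Rightarrow> bool" where
  "theory_dpr_less (_ :: 'v itself) L T \<kappa> \<longleftrightarrow>
    (\<forall>N :: ('v, 'f, 'r) struc. models L N T \<longrightarrow>
      dpr_less_in L N {} 1 {(Eq (Var 0) (Var 0), [])} \<kappa>)"

text \<open>
  In \<open>\<phi>(x, y)\<close> the object variables \<open>y\<close> are \<open>Var 0, \<dots>, Var (m - 1)\<close>, and \<open>x\<close> comes after them,
  so that \<open>(\<phi>, a i)\<close> is the formula \<open>\<phi>(a\<^sub>i, y)\<close>.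
\<close>

definition has_IP_in ::
  "('f, 'r) language \<Rightarrow> ('a, 'f, 'r) struc \<Rightarrow> nat \<Rightarrow> (('f, 'r) fm \<times> 'a list) set \<Rightarrow> bool" where
  "has_IP_in L N n \<pi> \<longleftrightarrow>
    (\<exists>\<phi> m. \<exists>a :: nat \<Rightarrow> 'a list. wf_fm L \<phi> \<and> fv \<phi> \<subseteq> {..<m + n} \<and>
      (\<forall>i. realizes N n \<pi> (a i)) \<and>
      (\<forall>s. consistent N m ({(\<phi>, a i) | i. i \<in> s} \<union> {(Neg \<phi>, a i) | i. i \<notin> s})))"

definition has_IP ::
  "'u itself \<Rightarrow> ('f, 'r) language \<Rightarrow> ('a, 'f, 'r) struc \<Rightarrow> nat
    \<Rightarrow> (('f, 'r) fm \<times> 'a list) set \<Rightarrow> bool" where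
  "has_IP (_ :: 'u itself) L M n \<pi> \<longleftrightarrow>
    (\<exists>(N :: ('u, 'f, 'r) struc) e. is_structure L N \<and> elementary_embedding L M N e \<and>
      has_IP_in L N n (push e \<pi>))"

text \<open>A theory has IP if some formula \<open>\<phi>(x, y)\<close>, where \<open>x\<close> and \<open>y\<close> are finite tuples, has IP.\<close>

definition theory_has_IP ::
  "'v itself \<Rightarrow> ('f, 'r) language \<Rightarrow> ('f, 'r) fm set \<Rightarrow> bool" where
  "theory_has_IP (_ :: 'v itself) L T \<longleftrightarrow>
    (\<exists>(N :: ('v, 'f, 'r) struc) n. models L N T \<and> has_IP_in L N n {})"

text \<open>\<open>\<kappa> \<le> |'u|\<close>, resp. \<open>|X| \<le> |'u|\<close>, see \<^const>\<open>dpr_less\<close>.\<close>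

definition card_fits :: "'k rel \<Rightarrow> 'u itself \<Rightarrow> bool" where
  "card_fits \<kappa> (_ :: 'u itself) \<longleftrightarrow> (\<kappa>, card_of (UNIV :: 'u set)) \<in> ordLeq"

definition set_fits :: "'m set \<Rightarrow> 'u itself \<Rightarrow> bool" where
  "set_fits X (u :: 'u itself) \<longleftrightarrow> card_fits (card_of X) u"

end

theory Submission
  imports Defs "HOL-Library.Countable" "HOL-Library.FuncSet"
begin

text \<open>
  Let \<open>c\<close> be a point of a model of \<open>T\<^sup>*\<close>. On the points above \<open>c\<close>, identified if their meet is
  still above \<open>c\<close>, the relations \<open>R\<^sup>*(c, \<dots>)\<close> define a structure, and every finite model of
  \<open>T\<^sub>\<forall>\<close> occurs in it. Now let \<open>c\<close> lie above the branch \<open>B\<close>, in an elementary extension of \<open>M\<close>.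
  Then all points above \<open>c\<close> realize \<open>q\<^sub>T\<close>, and the cone above \<open>c\<close> is large enough to contain any
  configuration from a model of \<open>T\<close>. So a configuration which shows that the dp-rank of \<open>T\<close> is large, or
  that \<open>T\<close> has the independence property, is copied to the cone and shows the same for \<open>q\<^sub>T\<close>. The
  following facts carry the argument.

  \<^item> Quantifier elimination (\<open>rich_sat_iff\<close>): in models of \<open>T\<close> and of \<open>T\<^sup>*\<close>, partial
  isomorphisms preserve all formulas. Both theories are theories of Fraisse limits in finite
  languages, and the extension property of the limit is first-order, so the usual back-and-forth
  argument applies.

  \<^item> Realization (\<open>cone_realization\<close>): by compactness, \<open>c\<close> and the copy above it exist, because each finite
  part of the requirements is met in \<open>M\<close> above some point of \<open>B\<close>. There it amounts to an instance of the
  extension property, for the tree that consists of a root and finitely many leaves.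

  \<^item> Gluing (\<open>cone_embedding\<close>): a partial isomorphism of the cone above \<open>c\<close>, together with the identity
  outside the cone, is a partial isomorphism. For a point \<open>c\<close> in \<open>B\<close> this shows that points above \<open>B\<close>
  realize \<open>q\<^sub>T\<close> (\<open>realizes_above_branch\<close>). For \<open>c\<close> above \<open>B\<close> it shows that mutually
  indiscernible sequences of a model of \<open>T\<close> become mutually indiscernible over \<open>M\<close> in the cone
  (\<open>lift_mutually_indiscernible\<close>). Conversely, a formula that witnesses that one of them is not
  indiscernible over a point can be taken quantifier-free, and is then expressed in the tree with the
  help of \<open>c\<close>.

  \<^item> Reduction to one variable (\<open>IP_atom\<close>): \<open>q\<^sub>T\<close> is a type in one variable, while the independence
  property of \<open>T\<close> concerns tuples. By quantifier elimination, the type of an element over a finite set is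
  given by its traces for finitely many atomic formulas. If none of these has the independence property, the
  Sauer-Shelah lemma bounds the number of types of single elements, and by homogeneity also of tuples, by
  a polynomial in the size of the set; this contradicts the independence property of \<open>T\<close>.
\<close>

section \<open>Formulas and embeddings\<close>

lemma tm_val_cong:
  "(\<And>i. i \<in> tm_vars t \<Longrightarrow> v i = w i) \<Longrightarrow> tm_val M v t = tm_val M w t"
proof (induction t)
  case (Fun f ts)
  have "map (tm_val M v) ts = map (tm_val M w) ts"
    using Fun by (intro map_cong) auto
  then show ?case by (simp only: tm_val.simps)
qed simp

lemma sat_cong:
  "(\<And>i. i \<in> fv \<phi> \<Longrightarrow> v i = w i) \<Longrightarrow> sat M v \<phi> \<longleftrightarrow> sat M w \<phi>"
proof (induction \<phi> arbitrary: v w)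
  case (Eq s t)
  then show ?case using tm_val_cong[of s v w M] tm_val_cong[of t v w M] by auto
next
  case (Rel R ts)
  have "map (tm_val M v) ts = map (tm_val M w) ts"
    using Rel by (auto intro!: tm_val_cong)
  then show ?case by (simp only: sat.simps)
next
  case (Neg \<phi>)
  then show ?case by (metis fv.simps(3) sat.simps(3))
next
  case (And \<phi> \<psi>)
  then show ?case by (metis UnCI fv.simps(4) sat.simps(4))
next
  case (Ex i \<phi>)
  have "sat M (v(i := a)) \<phi> \<longleftrightarrow> sat M (w(i := a)) \<phi>" for a
    using Ex by (intro Ex.IH) auto
  then show ?case by simp
qed

lemma finite_tm_vars: "finite (tm_vars t)"
  by (induction t) auto

lemma finite_fv: "finite (fv \<phi>)"
  by (induction \<phi>) (auto simp: finite_tm_vars)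

lemma closed_under_tm_val:
  assumes "closed_under L M X"
  shows "wf_tm L t \<Longrightarrow> v ` tm_vars t \<subseteq> X \<Longrightarrow> tm_val M v t \<in> X"
proof (induction t)
  case (Fun f ts)
  have "tm_val M v t \<in> X" if "t \<in> set ts" for t
    using Fun that by (intro Fun.IH) (auto simp: list_all_iff)
  then have "set (map (tm_val M v) ts) \<subseteq> X" by auto
  then show ?case using assms Fun.prems unfolding closed_under_def by simp
qed auto

lemma
  assumes "embedding L A N h"
  shows embedding_into: "x \<in> carrier A \<Longrightarrow> h x \<in> carrier N"
    and embedding_inj: "inj_on h (carrier A)"
    and embedding_fun: "f \<in> fun_syms L \<Longrightarrow> tuple A (fun_ar L f) as \<Longrightarrow>
      fun_int N f (map h as) = h (fun_int A f as)"
    and embedding_rel: "R \<in> rel_syms L \<Longrightarrow> tuple A (rel_ar L R) as \<Longrightarrow>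
      rel_int N R (map h as) \<longleftrightarrow> rel_int A R as"
  using assms by (auto simp: embedding_def)

lemma embedding_tm_val:
  assumes "embedding L A N h" "is_structure L A"
  shows "wf_tm L t \<Longrightarrow> (\<And>i. i \<in> tm_vars t \<Longrightarrow> v i \<in> carrier A \<and> w i = h (v i)) \<Longrightarrow>
    tm_val N w t = h (tm_val A v t)"
proof (induction t)
  case (Fun f ts)
  have 1: "tm_val N w t = h (tm_val A v t)" if "t \<in> set ts" for t
    using Fun that by (intro Fun.IH) (auto simp: list_all_iff)
  have "tm_val A v t \<in> carrier A" if "t \<in> set ts" for t
    using assms(2) Fun.prems that unfolding is_structure_def
    by (intro closed_under_tm_val[of L]) (auto simp: list_all_iff)
  then have "tuple A (fun_ar L f) (map (tm_val A v) ts)"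
    using Fun.prems by (auto simp: tuple_def)
  moreover have "map (tm_val N w) ts = map h (map (tm_val A v) ts)" using 1 by simp
  ultimately show ?case
    using assms(1) Fun.prems unfolding embedding_def by (simp del: map_map map_eq_conv)
qed auto

lemma embedding_sat_qf:
  assumes "embedding L A N h" "is_structure L A"
  shows "wf_fm L \<phi> \<Longrightarrow> quantifier_free \<phi> \<Longrightarrow>
    (\<And>i. i \<in> fv \<phi> \<Longrightarrow> v i \<in> carrier A \<and> w i = h (v i)) \<Longrightarrow> sat N w \<phi> \<longleftrightarrow> sat A v \<phi>"
proof (induction \<phi>)
  case (Eq s t)
  have "tm_val A v s \<in> carrier A" "tm_val A v t \<in> carrier A"
    using assms(2) Eq unfolding is_structure_def
    by (intro closed_under_tm_val[of L]; auto)+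
  moreover have "tm_val N w s = h (tm_val A v s)" "tm_val N w t = h (tm_val A v t)"
    using Eq by (auto intro!: embedding_tm_val[OF assms])
  moreover have "inj_on h (carrier A)" using assms(1) by (simp add: embedding_def)
  ultimately show ?case by (auto dest: inj_onD)
next
  case (Rel R ts)
  have 1: "map (tm_val N w) ts = map h (map (tm_val A v) ts)"
    using Rel by (auto intro!: embedding_tm_val[OF assms])
  have "tm_val A v t \<in> carrier A" if "t \<in> set ts" for t
    using assms(2) Rel.prems that unfolding is_structure_def
    by (intro closed_under_tm_val[of L]) auto
  then have "tuple A (rel_ar L R) (map (tm_val A v) ts)"
    using Rel.prems by (auto simp: tuple_def)
  then show ?case
    using assms(1) Rel.prems 1 unfolding embedding_def by (simp del: map_map map_eq_conv)
qed auto

lemma embedding_comp: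
  assumes "embedding L A B f" "embedding L B C g"
  shows "embedding L A C (g \<circ> f)"
  unfolding embedding_def
proof (intro conjI ballI allI impI)
  show "(g \<circ> f) ` carrier A \<subseteq> carrier C"
    using assms by (force simp: embedding_def)
  show "inj_on (g \<circ> f) (carrier A)"
    using assms by (meson comp_inj_on embedding_def inj_on_subset)
  fix as
  {
    fix F assume F: "F \<in> fun_syms L" and as: "tuple A (fun_ar L F) as"
    then have "tuple B (fun_ar L F) (map f as)"
      using assms by (auto simp: tuple_def embedding_def)
    then show "(g \<circ> f) (fun_int A F as) = fun_int C F (map (g \<circ> f) as)"
      using F as assms by (simp add: embedding_def)
  }
  fix R assume R: "R \<in> rel_syms L" and as: "tuple A (rel_ar L R) as"
  then have "tuple B (rel_ar L R) (map f as)"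
    using assms by (auto simp: tuple_def embedding_def)
  then show "rel_int A R as \<longleftrightarrow> rel_int C R (map (g \<circ> f) as)"
    using R as assms by (simp add: embedding_def)
qed

abbreviation restr :: "('a, 'f, 'r) struc \<Rightarrow> 'a set \<Rightarrow> ('a, 'f, 'r) struc" where
  "restr M X \<equiv> M\<lparr>carrier := X\<rparr>"

lemma embedding_restr_id: "X \<subseteq> carrier M \<Longrightarrow> embedding L (restr M X) M id"
  by (auto simp: embedding_def)

lemma is_structure_restr: "is_structure L (restr M X) \<longleftrightarrow> X \<noteq> {} \<and> closed_under L M X"
  by (auto simp: is_structure_def closed_under_def)

lemma embedding_restr_subset:
  "embedding L (restr M X) N h \<Longrightarrow> Y \<subseteq> X \<Longrightarrow> embedding L (restr M Y) N h"
  by (auto simp: embedding_def tuple_def inj_on_subset)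

lemma closed_under_image:
  assumes "embedding L A N h" "is_structure L A"
  shows "closed_under L N (h ` carrier A)"
  unfolding closed_under_def
proof (intro ballI allI impI)
  fix f bs assume f: "f \<in> fun_syms L" and bs: "length bs = fun_ar L f \<and> set bs \<subseteq> h ` carrier A"
  define as where "as = map (inv_into (carrier A) h) bs"
  have "map h as = bs" unfolding as_def map_map using bs
    by (intro map_idI) (auto simp: f_inv_into_f)
  moreover have tu: "tuple A (fun_ar L f) as"
    using bs by (auto simp: tuple_def as_def intro!: inv_into_into)
  moreover have "fun_int A f as \<in> carrier A"
    using assms(2) f tu by (auto simp: is_structure_def closed_under_def tuple_def)
  ultimately show "fun_int N f bs \<in> h ` carrier A"
    using assms(1) f by (metis embedding_def imageI)
qed

lemma embedding_inverse:
  assumes "embedding L A N h" "is_structure L A" "\<And>x. x \<in> carrier A \<Longrightarrow> k (h x) = x"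
  shows "embedding L (restr N (h ` carrier A)) A k"
  unfolding embedding_def
proof (intro conjI ballI allI impI)
  show "k ` carrier (restr N (h ` carrier A)) \<subseteq> carrier A"
    "inj_on k (carrier (restr N (h ` carrier A)))"
    using assms(3) by (auto simp: inj_on_def)
next
  have m: "map h (map k bs) = bs \<and> tuple A n (map k bs)"
    if "tuple (restr N (h ` carrier A)) n bs" for n bs
    using that assms(3) by (auto simp: tuple_def intro!: map_idI)
  {
    fix f bs assume f: "f \<in> fun_syms L" "tuple (restr N (h ` carrier A)) (fun_ar L f) bs"
    have "fun_int A f (map k bs) \<in> carrier A"
      using assms(2) f m by (auto simp: is_structure_def closed_under_def tuple_def)
    then show "k (fun_int (restr N (h ` carrier A)) f bs) = fun_int A f (map k bs)"
      using assms(3) m[OF f(2)] embedding_fun[OF assms(1) f(1), of "map k bs"] by simp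
  }
  fix R bs assume R: "R \<in> rel_syms L" "tuple (restr N (h ` carrier A)) (rel_ar L R) bs"
  then show "rel_int (restr N (h ` carrier A)) R bs \<longleftrightarrow> rel_int A R (map k bs)"
    using m[OF R(2)] embedding_rel[OF assms(1) R(1), of "map k bs"] by simp
qed

definition copy :: "('a \<Rightarrow> 'b) \<Rightarrow> ('a, 'f, 'r) struc \<Rightarrow> ('b, 'f, 'r) struc" where
  "copy f A = \<lparr>carrier = f ` carrier A,
     fun_int = (\<lambda>F bs. f (fun_int A F (map (inv_into (carrier A) f) bs))),
     rel_int = (\<lambda>R bs. rel_int A R (map (inv_into (carrier A) f) bs))\<rparr>"

lemma carrier_copy [simp]: "carrier (copy f A) = f ` carrier A"
  by (simp add: copy_def)

lemma embedding_copy: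
  assumes "inj_on f (carrier A)"
  shows "embedding L A (copy f A) f"
proof -
  have "map (inv_into (carrier A) f \<circ> f) as = as" if "tuple A n as" for as n
    using that assms by (auto simp: tuple_def intro!: map_idI)
  then show ?thesis using assms by (auto simp: embedding_def copy_def)
qed

lemma is_structure_copy:
  assumes "inj_on f (carrier A)" "is_structure L A"
  shows "is_structure L (copy f A)"
  using closed_under_image[OF embedding_copy[OF assms(1)] assms(2)] assms(2)
  by (auto simp: is_structure_def)

lemma embedding_copy_inverse:
  assumes "inj_on f (carrier A)" "is_structure L A"
  shows "embedding L (copy f A) A (inv_into (carrier A) f)"
proof -
  have "embedding L (restr (copy f A) (f ` carrier A)) A (inv_into (carrier A) f)"
    by (rule embedding_inverse[OF embedding_copy[OF assms(1)] assms(2)]) (simp add: assms(1))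
  then show ?thesis by (simp add: copy_def)
qed

section \<open>Closures, conjunctions and diagrams\<close>

definition Forall :: "nat \<Rightarrow> ('f, 'r) fm \<Rightarrow> ('f, 'r) fm" where
  "Forall i \<phi> = Neg (Ex i (Neg \<phi>))"

definition Alls :: "nat list \<Rightarrow> ('f, 'r) fm \<Rightarrow> ('f, 'r) fm" where
  "Alls is \<phi> = foldr Forall is \<phi>"

definition Exs :: "nat list \<Rightarrow> ('f, 'r) fm \<Rightarrow> ('f, 'r) fm" where
  "Exs is \<phi> = foldr Ex is \<phi>"

lemma sat_Imp [simp]: "sat M v (Imp \<phi> \<psi>) \<longleftrightarrow> (sat M v \<phi> \<longrightarrow> sat M v \<psi>)"
  by (simp add: Imp_def)

lemma sat_Or [simp]: "sat M v (Or \<phi> \<psi>) \<longleftrightarrow> (sat M v \<phi> \<or> sat M v \<psi>)"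
  by (simp add: Or_def)

lemma sat_Imps [simp]: "sat M v (Imps \<phi>s \<psi>) \<longleftrightarrow> ((\<forall>\<phi>\<in>set \<phi>s. sat M v \<phi>) \<longrightarrow> sat M v \<psi>)"
  by (induction \<phi>s) (auto simp: Imps_def)

lemma wf_Imp [simp]: "wf_fm L (Imp \<phi> \<psi>) \<longleftrightarrow> wf_fm L \<phi> \<and> wf_fm L \<psi>"
  by (simp add: Imp_def)

lemma fv_Imp [simp]: "fv (Imp \<phi> \<psi>) = fv \<phi> \<union> fv \<psi>"
  by (simp add: Imp_def)

lemma qf_Imp [simp]: "quantifier_free (Imp \<phi> \<psi>) \<longleftrightarrow> quantifier_free \<phi> \<and> quantifier_free \<psi>"
  by (simp add: Imp_def)

lemma wf_Imps [simp]: "wf_fm L (Imps \<phi>s \<psi>) \<longleftrightarrow> (\<forall>\<phi>\<in>set \<phi>s. wf_fm L \<phi>) \<and> wf_fm L \<psi>"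
  by (induction \<phi>s) (auto simp: Imps_def)

lemma qf_Imps [simp]:
  "quantifier_free (Imps \<phi>s \<psi>) \<longleftrightarrow> (\<forall>\<phi>\<in>set \<phi>s. quantifier_free \<phi>) \<and> quantifier_free \<psi>"
  by (induction \<phi>s) (auto simp: Imps_def)

lemma wf_Exs [simp]: "wf_fm L (Exs is \<phi>) \<longleftrightarrow> wf_fm L \<phi>"
  by (induction "is") (auto simp: Exs_def)

lemma wf_Alls [simp]: "wf_fm L (Alls is \<phi>) \<longleftrightarrow> wf_fm L \<phi>"
  by (induction "is") (auto simp: Alls_def Forall_def)

lemma fv_Exs [simp]: "fv (Exs is \<phi>) = fv \<phi> - set is"
  by (induction "is") (auto simp: Exs_def)

lemma fv_Alls [simp]: "fv (Alls is \<phi>) = fv \<phi> - set is"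
  by (induction "is") (auto simp: Alls_def Forall_def)

lemma sat_Exs:
  "sat M v (Exs is \<phi>) \<longleftrightarrow>
    (\<exists>w. (\<forall>i\<in>set is. w i \<in> carrier M) \<and> (\<forall>i. i \<notin> set is \<longrightarrow> w i = v i) \<and> sat M w \<phi>)"
proof (induction "is" arbitrary: v)
  case Nil
  have "w = v" if "\<forall>i. w i = v i" for w using that by auto
  then show ?case by (auto simp: Exs_def)
next
  case (Cons i "is")
  have "sat M v (Exs (i # is) \<phi>) \<longleftrightarrow> (\<exists>a\<in>carrier M. sat M (v(i := a)) (Exs is \<phi>))"
    by (simp add: Exs_def)
  also have "\<dots> \<longleftrightarrow> (\<exists>a\<in>carrier M. \<exists>w. (\<forall>j\<in>set is. w j \<in> carrier M) \<and>
      (\<forall>j. j \<notin> set is \<longrightarrow> w j = (v(i := a)) j) \<and> sat M w \<phi>)"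
    by (simp only: Cons)
  also have "\<dots> \<longleftrightarrow> (\<exists>w. (\<forall>j\<in>set (i # is). w j \<in> carrier M) \<and>
      (\<forall>j. j \<notin> set (i # is) \<longrightarrow> w j = v j) \<and> sat M w \<phi>)"
  proof
    assume "\<exists>w. (\<forall>j\<in>set (i # is). w j \<in> carrier M) \<and>
      (\<forall>j. j \<notin> set (i # is) \<longrightarrow> w j = v j) \<and> sat M w \<phi>"
    then obtain w where "\<forall>j\<in>set (i # is). w j \<in> carrier M"
      "\<forall>j. j \<notin> set (i # is) \<longrightarrow> w j = v j" "sat M w \<phi>" by blast
    then show "\<exists>a\<in>carrier M. \<exists>w. (\<forall>j\<in>set is. w j \<in> carrier M) \<and>
      (\<forall>j. j \<notin> set is \<longrightarrow> w j = (v(i := a)) j) \<and> sat M w \<phi>"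
      by (intro bexI[of _ "w i"] exI[of _ w]) auto
  next
    assume "\<exists>a\<in>carrier M. \<exists>w. (\<forall>j\<in>set is. w j \<in> carrier M) \<and>
      (\<forall>j. j \<notin> set is \<longrightarrow> w j = (v(i := a)) j) \<and> sat M w \<phi>"
    then obtain a w where aw: "a \<in> carrier M" "\<forall>j\<in>set is. w j \<in> carrier M"
      "\<forall>j. j \<notin> set is \<longrightarrow> w j = (v(i := a)) j" "sat M w \<phi>" by blast
    then have "w i \<in> carrier M" by (cases "i \<in> set is") auto
    then show "\<exists>w. (\<forall>j\<in>set (i # is). w j \<in> carrier M) \<and>
      (\<forall>j. j \<notin> set (i # is) \<longrightarrow> w j = v j) \<and> sat M w \<phi>"
      using aw by (intro exI[of _ w]) auto
  qed
  finally show ?case .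
qed

lemma sat_Alls:
  "sat M v (Alls is \<phi>) \<longleftrightarrow>
    (\<forall>w. (\<forall>i\<in>set is. w i \<in> carrier M) \<and> (\<forall>i. i \<notin> set is \<longrightarrow> w i = v i) \<longrightarrow> sat M w \<phi>)"
proof -
  have "sat M v (Alls is \<phi>) \<longleftrightarrow> \<not> sat M v (Exs is (Neg \<phi>))"
    by (induction "is" arbitrary: v) (auto simp: Alls_def Exs_def Forall_def)
  then show ?thesis by (auto simp: sat_Exs)
qed

text \<open>
  Members of \<open>Th L F\<close> are sentences, whereas axioms are given by matrices; the universal
  closure goes from one to the other.
\<close>

lemma models_Th_holds:
  fixes N :: "('b, 'f, 'r) struc"
  assumes "is_structure L F" "models L N (Th L F)" "wf_fm L \<phi>" "holds F \<phi>"
  shows "holds N \<phi>"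
proof -
  obtain l where l: "set l = fv \<phi>" using finite_fv finite_list by blast
  have "holds F (Alls l \<phi>)"
    unfolding holds_def sat_Alls
  proof (intro allI impI)
    fix v w assume "range v \<subseteq> carrier F"
      "(\<forall>i\<in>set l. w i \<in> carrier F) \<and> (\<forall>i. i \<notin> set l \<longrightarrow> w i = v i)"
    then have "w i \<in> carrier F" for i by (cases "i \<in> set l") auto
    then have "range w \<subseteq> carrier F" by auto
    then show "sat F w \<phi>" using assms(4) by (auto simp: holds_def)
  qed
  then have "Alls l \<phi> \<in> Th L F" using assms(3) l by (auto simp: Th_def)
  then have 1: "holds N (Alls l \<phi>)" using assms(2) by (auto simp: models_def)
  show ?thesis
    unfolding holds_def
  proof (intro allI impI)
    fix v :: "nat \<Rightarrow> 'b" assume v: "range v \<subseteq> carrier N"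
    then have "sat N v (Alls l \<phi>)" using 1 by (simp add: holds_def)
    then show "sat N v \<phi>" using v unfolding sat_Alls by (simp add: image_subset_iff)
  qed
qed

definition Conj :: "('f, 'r) fm set \<Rightarrow> ('f, 'r) fm" where
  "Conj S = foldr And (SOME l. set l = S) (Eq (Var 0) (Var 0))"

lemma
  assumes "finite S"
  shows sat_Conj: "sat M v (Conj S) \<longleftrightarrow> (\<forall>\<phi>\<in>S. sat M v \<phi>)"
    and wf_Conj: "wf_fm L (Conj S) \<longleftrightarrow> (\<forall>\<phi>\<in>S. wf_fm L \<phi>)"
    and fv_Conj: "fv (Conj S) = insert 0 (\<Union>(fv ` S))"
proof -
  have *: "set (SOME l. set l = S) = S"
    using someI_ex[OF finite_list[OF assms]] .
  have "sat M v (foldr And l (Eq (Var 0) (Var 0))) \<longleftrightarrow> (\<forall>\<phi>\<in>set l. sat M v \<phi>)"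
    "wf_fm L (foldr And l (Eq (Var 0) (Var 0))) \<longleftrightarrow> (\<forall>\<phi>\<in>set l. wf_fm L \<phi>)"
    "fv (foldr And l (Eq (Var 0) (Var 0))) = insert 0 (\<Union>(fv ` set l))" for l
    by (induction l) auto
  note l = this
  show "sat M v (Conj S) \<longleftrightarrow> (\<forall>\<phi>\<in>S. sat M v \<phi>)" "wf_fm L (Conj S) \<longleftrightarrow> (\<forall>\<phi>\<in>S. wf_fm L \<phi>)"
    "fv (Conj S) = insert 0 (\<Union>(fv ` S))"
    unfolding Conj_def l * by auto
qed

text \<open>
  Only atomic formulas without nested terms. Over a finite language there are finitely many of them
  in \<open>n\<close> variables, and they determine the isomorphism type of a tuple that enumerates a
  substructure.
\<close>

definition atoms :: "('f, 'r) language \<Rightarrow> nat \<Rightarrow> ('f, 'r) fm set" where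
  "atoms L n =
    {Eq (Var i) (Var j) | i j. i < n \<and> j < n} \<union>
    {Rel R (map Var ks) | R ks. R \<in> rel_syms L \<and> length ks = rel_ar L R \<and> set ks \<subseteq> {..<n}} \<union>
    {Eq (Fun f (map Var ks)) (Var k) | f ks k.
      f \<in> fun_syms L \<and> length ks = fun_ar L f \<and> set ks \<subseteq> {..<n} \<and> k < n}"

lemma finite_atoms:
  assumes "finite (fun_syms L)" "finite (rel_syms L)"
  shows "finite (atoms L n)"
proof -
  have fin: "finite {ks. set ks \<subseteq> {..<n} \<and> length ks = m}" for m
    by (rule finite_lists_length_eq) simp
  have "atoms L n \<subseteq> (\<lambda>(i, j). Eq (Var i) (Var j)) ` ({..<n} \<times> {..<n}) \<union>
      (\<lambda>(R, ks). Rel R (map Var ks)) ` (SIGMA R:rel_syms L. {ks. set ks \<subseteq> {..<n} \<and> length ks = rel_ar L R}) \<union>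
      (\<lambda>((f, ks), k). Eq (Fun f (map Var ks)) (Var k)) `
        ((SIGMA f:fun_syms L. {ks. set ks \<subseteq> {..<n} \<and> length ks = fun_ar L f}) \<times> {..<n})"
    unfolding atoms_def by (force simp: image_iff)
  then show ?thesis
    by (rule finite_subset) (intro finite_UnI finite_imageI finite_SigmaI fin assms finite_lessThan)
qed

lemma atoms_props:
  assumes "\<phi> \<in> atoms L n"
  shows "wf_fm L \<phi>" "quantifier_free \<phi>" "fv \<phi> \<subseteq> {..<n}"
  using assms by (auto simp: atoms_def list_all_iff)

definition same_atoms ::
  "('f, 'r) language \<Rightarrow> ('a, 'f, 'r) struc \<Rightarrow> 'a list \<Rightarrow> ('b, 'f, 'r) struc \<Rightarrow> 'b list \<Rightarrow> bool" where
  "same_atoms L A as N bs \<longleftrightarrow> length as = length bs \<and>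
    (\<forall>\<phi>\<in>atoms L (length as). sat_at A as \<phi> \<longleftrightarrow> sat_at N bs \<phi>)"

lemma embedding_same_atoms:
  assumes "embedding L A N h" "is_structure L A" "set as \<subseteq> carrier A"
  shows "same_atoms L A as N (map h as)"
  unfolding same_atoms_def sat_at_def
proof (intro conjI ballI)
  fix \<phi> assume "\<phi> \<in> atoms L (length as)"
  note p = atoms_props[OF this]
  show "sat A ((!) as) \<phi> \<longleftrightarrow> sat N ((!) (map h as)) \<phi>"
    using assms(3) p(3)
    by (subst embedding_sat_qf[OF assms(1,2) p(1,2), of "(!) as" "(!) (map h as)"])
      (auto simp: subset_iff nth_mem)
qed simp

lemma same_atoms_embedding:
  assumes same: "same_atoms L A as N bs" and as: "set as = carrier A"
    and bs: "set bs \<subseteq> carrier N" and A: "is_structure L A"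
  obtains h where "embedding L A N h" "map h as = bs"
proof -
  have len: "length bs = length as" using same by (simp add: same_atoms_def)
  define h where "h x = bs ! (LEAST i. i < length as \<and> as ! i = x)" for x
  have hnth: "h (as ! i) = bs ! i" if "i < length as" for i
  proof -
    let ?j = "LEAST j. j < length as \<and> as ! j = as ! i"
    have j: "?j < length as \<and> as ! ?j = as ! i"
      by (rule LeastI[of "\<lambda>j. j < length as \<and> as ! j = as ! i" i]) (use that in auto)
    then have "Eq (Var ?j) (Var i) \<in> atoms L (length as)" using that by (auto simp: atoms_def)
    then have "sat_at A as (Eq (Var ?j) (Var i)) \<longleftrightarrow> sat_at N bs (Eq (Var ?j) (Var i))"
      using same unfolding same_atoms_def by blast
    then have "bs ! ?j = bs ! i" using j by (simp add: sat_at_def)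
    then show ?thesis by (simp add: h_def)
  qed
  have m: "map h as = bs" using len hnth by (auto intro: nth_equalityI)
  have idx: "\<exists>ks. length ks = n \<and> set ks \<subseteq> {..<length as} \<and> cs = map ((!) as) ks"
    if "tuple A n cs" for n cs
  proof -
    have "\<forall>c\<in>set cs. \<exists>k<length as. as ! k = c"
      using that as by (metis in_set_conv_nth subsetD tuple_def)
    then obtain g where "\<forall>c\<in>set cs. g c < length as \<and> as ! g c = c" by metis
    then show ?thesis using that
      by (intro exI[of _ "map g cs"]) (auto simp: tuple_def intro!: map_idI[symmetric])
  qed
  have mh: "map h (map ((!) as) ks) = map ((!) bs) ks" if "set ks \<subseteq> {..<length as}" for ks
    using that hnth by auto
  have "embedding L A N h"
    unfolding embedding_def
  proof (intro conjI ballI allI impI)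
    show "h ` carrier A \<subseteq> carrier N" using m as bs by (metis list.set_map)
    show "inj_on h (carrier A)"
    proof (rule inj_onI)
      fix x y assume xy: "x \<in> carrier A" "y \<in> carrier A" "h x = h y"
      then obtain i j where ij: "i < length as" "j < length as" "x = as ! i" "y = as ! j"
        using as by (metis in_set_conv_nth)
      then have "Eq (Var i) (Var j) \<in> atoms L (length as)" by (auto simp: atoms_def)
      then have "sat_at A as (Eq (Var i) (Var j)) \<longleftrightarrow> sat_at N bs (Eq (Var i) (Var j))"
        using same unfolding same_atoms_def by blast
      moreover have "bs ! i = bs ! j" using xy ij hnth by simp
      ultimately show "x = y" using ij by (simp add: sat_at_def)
    qed
  next
    fix f cs assume f: "f \<in> fun_syms L" and cs: "tuple A (fun_ar L f) cs"
    from idx[OF cs] obtain ks where ks: "length ks = fun_ar L f" "set ks \<subseteq> {..<length as}"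
      "cs = map ((!) as) ks" by auto
    have "fun_int A f cs \<in> carrier A" using A f cs
      by (auto simp: is_structure_def closed_under_def tuple_def)
    then obtain k where k: "k < length as" "as ! k = fun_int A f cs"
      using as by (metis in_set_conv_nth)
    have "Eq (Fun f (map Var ks)) (Var k) \<in> atoms L (length as)"
      using f ks k by (auto simp: atoms_def)
    moreover have "sat_at A as (Eq (Fun f (map Var ks)) (Var k))"
      using k ks by (simp add: sat_at_def comp_def)
    ultimately have "sat_at N bs (Eq (Fun f (map Var ks)) (Var k))"
      using same by (auto simp: same_atoms_def)
    then show "h (fun_int A f cs) = fun_int N f (map h cs)"
      using k hnth[of k] mh[OF ks(2)] ks(3) by (simp add: sat_at_def comp_def cong: map_cong)
  next
    fix R cs assume R: "R \<in> rel_syms L" and cs: "tuple A (rel_ar L R) cs"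
    from idx[OF cs] obtain ks where ks: "length ks = rel_ar L R" "set ks \<subseteq> {..<length as}"
      "cs = map ((!) as) ks" by auto
    have "Rel R (map Var ks) \<in> atoms L (length as)"
      using R ks by (auto simp: atoms_def)
    then have "sat_at A as (Rel R (map Var ks)) \<longleftrightarrow> sat_at N bs (Rel R (map Var ks))"
      using same by (auto simp: same_atoms_def)
    then show "rel_int A R cs \<longleftrightarrow> rel_int N R (map h cs)"
      using mh[OF ks(2)] ks(3) by (simp add: sat_at_def comp_def cong: map_cong)
  qed
  then show thesis using m that by blast
qed

text \<open>
  The quantifier-free type of a tuple in a finite language is a single formula. It is used for
  tuples that enumerate a finite structure.
\<close>

definition diag :: "('f, 'r) language \<Rightarrow> ('a, 'f, 'r) struc \<Rightarrow> 'a list \<Rightarrow> ('f, 'r) fm" where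
  "diag L A as = Conj ({\<phi> \<in> atoms L (length as). sat_at A as \<phi>} \<union>
     Neg ` {\<phi> \<in> atoms L (length as). \<not> sat_at A as \<phi>})"

lemma
  assumes fin: "finite (fun_syms L)" "finite (rel_syms L)"
  shows sat_diag: "length as = length bs \<Longrightarrow> sat_at N bs (diag L A as) \<longleftrightarrow> same_atoms L A as N bs"
    and wf_diag: "wf_fm L (diag L A as)"
    and fv_diag: "as \<noteq> [] \<Longrightarrow> fv (diag L A as) \<subseteq> {..<length as}"
proof -
  define P where "P = {\<phi> \<in> atoms L (length as). sat_at A as \<phi>}"
  define Q where "Q = {\<phi> \<in> atoms L (length as). \<not> sat_at A as \<phi>}"
  have PQ: "P \<union> Q = atoms L (length as)" by (auto simp: P_def Q_def)
  have "finite (P \<union> Q)" unfolding PQ by (rule finite_atoms[OF fin])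
  then have fin_S: "finite (P \<union> Neg ` Q)" by simp
  have d: "diag L A as = Conj (P \<union> Neg ` Q)"
    unfolding diag_def P_def Q_def by (rule arg_cong[of _ _ Conj]) auto
  note c = sat_Conj[OF fin_S] wf_Conj[OF fin_S] fv_Conj[OF fin_S]
  have "sat_at N bs (diag L A as) \<longleftrightarrow>
    (\<forall>\<phi>\<in>P. sat_at N bs \<phi>) \<and> (\<forall>\<phi>\<in>Q. \<not> sat_at N bs \<phi>)"
    unfolding d sat_at_def c(1) by (simp add: ball_Un)
  also have "\<dots> \<longleftrightarrow> (\<forall>\<phi>\<in>atoms L (length as). sat_at A as \<phi> \<longleftrightarrow> sat_at N bs \<phi>)"
    unfolding P_def Q_def by blast
  finally show "length as = length bs \<Longrightarrow>
      sat_at N bs (diag L A as) \<longleftrightarrow> same_atoms L A as N bs"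
    by (simp add: same_atoms_def)
  have "wf_fm L \<phi>" "fv \<phi> \<subseteq> {..<length as}" if "\<phi> \<in> P \<union> Q" for \<phi>
    using that unfolding PQ by (rule atoms_props)+
  note * = this
  show "wf_fm L (diag L A as)" unfolding d c using *(1) by auto
  show "fv (diag L A as) \<subseteq> {..<length as}" if "as \<noteq> []"
    using that *(2) unfolding d c by auto
qed

section \<open>The extension property and quantifier elimination\<close>

text \<open>
  This is the injectivity that characterizes Fraisse limits: an embedding of a finite substructure
  of \<open>N\<close> into a member of \<open>K\<close> can be undone by embedding that member into \<open>N\<close>.
\<close>

definition extension_property ::
  "('f, 'r) language \<Rightarrow> (nat, 'f, 'r) struc set \<Rightarrow> ('a, 'f, 'r) struc \<Rightarrow> bool" where
  "extension_property L K N \<longleftrightarrow>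
    (\<forall>X C f. finite X \<and> X \<subseteq> carrier N \<and> is_structure L (restr N X) \<and> C \<in> K \<and>
        embedding L (restr N X) C f \<longrightarrow>
      (\<exists>g. embedding L C N g \<and> (\<forall>x\<in>X. g (f x) = x)))"

lemma extension_propertyD:
  assumes "extension_property L K N" "finite X" "X \<subseteq> carrier N" "is_structure L (restr N X)"
    "C \<in> K" "embedding L (restr N X) C f"
  obtains g where "embedding L C N g" "\<And>x. x \<in> X \<Longrightarrow> g (f x) = x"
  using assms(1)[unfolded extension_property_def, rule_format, of X C f] assms(2-) that by auto

text \<open>
  Embed \<open>C\<close> into \<open>F\<close> somewhere; ultrahomogeneity moves the image of \<open>X\<close> back to \<open>X\<close>.
\<close>

lemma fraisse_limit_extension_property:
  assumes lim: "fraisse_limit L K F"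
  shows "extension_property L K F"
  unfolding extension_property_def
proof (intro allI impI, elim conjE)
  fix X C f
  assume X: "finite X" "X \<subseteq> carrier F" "is_structure L (restr F X)" and C: "C \<in> K"
    and f: "embedding L (restr F X) C f"
  have "C \<in> age L F" using lim C by (simp add: fraisse_limit_def)
  then obtain k where k: "embedding L C F k" by (auto simp: age_def)
  have "fin_gen L (restr F X)"
    unfolding fin_gen_def using X by (auto intro!: exI[of _ X])
  moreover have "embedding L (restr F X) F (k \<circ> f)" using embedding_comp[OF f k] .
  ultimately have "\<exists>g. embedding L F F g \<and> g ` carrier F = carrier F \<and> (\<forall>x\<in>X. g x = (k \<circ> f) x)"
    using lim X(2)
      ultrahomogeneous_def[of L F, THEN iffD1, rule_format, of X "k \<circ> f"]
    by (simp add: fraisse_limit_def)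
  then obtain g where g: "embedding L F F g" "g ` carrier F = carrier F"
    "\<And>x. x \<in> X \<Longrightarrow> g x = k (f x)" by auto
  define gi where "gi = inv_into (carrier F) g"
  have gi: "gi (g x) = x" if "x \<in> carrier F" for x
    using that embedding_inj[OF g(1)] by (simp add: gi_def)
  have "is_structure L F" using lim by (simp add: fraisse_limit_def)
  from embedding_inverse[OF g(1) this gi] have "embedding L F F gi" by (simp add: g(2))
  then have "embedding L C F (gi \<circ> k)" using embedding_comp[OF k] by blast
  moreover have "(gi \<circ> k) (f x) = x" if "x \<in> X" for x
    using that X(2) gi[of x] g(3)[of x] by auto
  ultimately show "\<exists>g. embedding L C F g \<and> (\<forall>x\<in>X. g (f x) = x)" by blast
qed

lemma closed_under_restr [simp]: "closed_under L (restr M X) Y \<longleftrightarrow> closed_under L M Y"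
  by (simp add: closed_under_def)

text \<open>
  A valuation only concerns the substructure generated by finitely many points, and this is
  isomorphic to a member of the age, that is, to a finite model of \<open>U\<close>.
\<close>

lemma fraisse_limit_holds:
  fixes F :: "('a, 'f, 'r) struc"
  assumes lim: "fraisse_limit L (finite_models L U) F"
    and \<psi>: "\<psi> \<in> U" "wf_fm L \<psi>" "quantifier_free \<psi>"
  shows "holds F \<psi>"
  unfolding holds_def
proof (intro allI impI)
  fix v :: "nat \<Rightarrow> 'a" assume v: "range v \<subseteq> carrier F"
  have F: "is_structure L F" using lim by (simp add: fraisse_limit_def)
  from lim obtain enum :: "'a \<Rightarrow> nat" where enum: "inj_on enum (carrier F)"
    by (auto simp: fraisse_limit_def)
  define X where "X = v ` insert 0 (fv \<psi>)"
  define G where "G = \<Inter>{Y. X \<subseteq> Y \<and> Y \<subseteq> carrier F \<and> closed_under L F Y}"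
  have X: "finite X" "X \<subseteq> carrier F" "X \<noteq> {}" using v by (auto simp: X_def finite_fv)
  have XG: "X \<subseteq> G" by (auto simp: G_def)
  have GF: "G \<subseteq> carrier F"
    using X F unfolding G_def is_structure_def by (intro Inter_lower) auto
  have "closed_under L F G"
    unfolding closed_under_def
  proof (intro ballI allI impI)
    fix f as assume *: "f \<in> fun_syms L" "length as = fun_ar L f \<and> set as \<subseteq> G"
    show "fun_int F f as \<in> G"
      unfolding G_def
    proof (rule InterI)
      fix Y assume "Y \<in> {Y. X \<subseteq> Y \<and> Y \<subseteq> carrier F \<and> closed_under L F Y}"
      moreover from this have "G \<subseteq> Y" unfolding G_def by (rule Inter_lower)
      ultimately show "fun_int F f as \<in> Y"
        using * unfolding closed_under_def by blast
    qed
  qed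
  then have G: "is_structure L (restr F G)" using X XG by (auto simp: is_structure_restr)
  define A where "A = copy enum (restr F G)"
  define k where "k = inv_into G enum"
  have inj: "inj_on enum (carrier (restr F G))" using enum GF by (auto intro: inj_on_subset)
  have A: "is_structure L A" unfolding A_def by (rule is_structure_copy[OF inj G])
  have cA: "carrier A = enum ` G" by (simp add: A_def)
  have "embedding L A (restr F G) k"
    using embedding_copy_inverse[OF inj G] by (simp add: A_def k_def)
  then have kA: "embedding L A F k"
    using embedding_comp[OF _ embedding_restr_id[OF GF]] by (metis id_comp)
  have ke: "k (enum x) = x" if "x \<in> G" for x using inj that by (simp add: k_def)
  have "fin_gen L A"
    unfolding fin_gen_def
  proof (intro conjI A exI[of _ "enum ` X"] allI impI)
    show "finite (enum ` X)" "enum ` X \<subseteq> carrier A" using X XG by (auto simp: cA)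
  next
    fix Y assume Y: "enum ` X \<subseteq> Y \<and> Y \<subseteq> carrier A \<and> closed_under L A Y"
    have "embedding L (restr A Y) F k"
      by (rule embedding_restr_subset[where X = "carrier A"]) (use kA Y in simp_all)
    moreover have "is_structure L (restr A Y)" using Y X by (auto simp: is_structure_restr)
    ultimately have "closed_under L F (k ` Y)" using closed_under_image by fastforce
    moreover have "X \<subseteq> k ` Y"
    proof
      fix x assume "x \<in> X"
      then have "k (enum x) = x" "enum x \<in> Y" using ke XG Y by auto
      then show "x \<in> k ` Y" by (metis image_eqI)
    qed
    moreover have "k ` Y \<subseteq> carrier F" using Y embedding_into[OF kA] by auto
    ultimately have "G \<subseteq> k ` Y" unfolding G_def by (intro Inter_lower) simp
    have "enum x \<in> Y" if x: "x \<in> G" for x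
    proof -
      obtain y where "y \<in> Y" "x = k y" using x \<open>G \<subseteq> k ` Y\<close> by auto
      moreover obtain x' where "x' \<in> G" "y = enum x'" using Y \<open>y \<in> Y\<close> cA by auto
      ultimately show ?thesis using ke by simp
    qed
    then show "Y = carrier A" using Y cA by auto
  qed
  then have "A \<in> age L F" using kA by (auto simp: age_def)
  then have "A \<in> finite_models L U" using lim by (simp add: fraisse_limit_def)
  then have "holds A \<psi>" using \<psi> by (auto simp: finite_models_def models_def)
  moreover define w where "w i = (if i \<in> fv \<psi> then enum (v i) else enum (v 0))" for i
  have "range w \<subseteq> carrier A" using XG by (auto simp: w_def cA X_def)
  ultimately have "sat A w \<psi>" by (simp add: holds_def)
  moreover have "w i \<in> carrier A \<and> v i = k (w i)" if "i \<in> fv \<psi>" for i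
    using that ke XG by (auto simp: w_def cA X_def)
  ultimately show "sat F v \<psi>" using embedding_sat_qf[OF kA A \<psi>(2,3)] by blast
qed

lemma finite_substructure_in_finite_models:
  assumes "is_structure L A" "finite (carrier A)" "embedding L A N h"
    "\<And>\<psi>. \<psi> \<in> U \<Longrightarrow> wf_fm L \<psi> \<and> quantifier_free \<psi> \<and> holds N \<psi>"
  shows "A \<in> finite_models L U"
proof -
  have "holds A \<psi>" if "\<psi> \<in> U" for \<psi>
    unfolding holds_def
  proof (intro allI impI)
    fix v :: "nat \<Rightarrow> nat" assume v: "range v \<subseteq> carrier A"
    then have "range (h \<circ> v) \<subseteq> carrier N" using embedding_into[OF assms(3)] by auto
    then have "sat N (h \<circ> v) \<psi>" using assms(4)[OF that] by (auto simp: holds_def)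
    then show "sat A v \<psi>"
      using embedding_sat_qf[OF assms(3,1), of \<psi> v "h \<circ> v"] assms(4)[OF that] v by auto
  qed
  then show ?thesis using assms by (auto simp: finite_models_def models_def)
qed

text \<open>
  Each instance of the extension property is expressed by a sentence, since diagrams of finite
  structures are formulas: for all \<open>x\<close> that satisfy the diagram of \<open>X\<close> there is \<open>y\<close>
  such that \<open>x, y\<close> satisfy the diagram of \<open>C\<close>.
\<close>

lemma extension_property_transfer:
  fixes F :: "('a, 'f, 'r) struc" and N :: "('b, 'f, 'r) struc"
  assumes fin: "finite (fun_syms L)" "finite (rel_syms L)"
    and ext: "extension_property L K F" and F: "is_structure L F"
    and N: "models L N (Th L F)"
    and K: "\<And>C. C \<in> K \<Longrightarrow> is_structure L C \<and> finite (carrier C)"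
  shows "extension_property L K N"
  unfolding extension_property_def
proof (intro allI impI, elim conjE)
  fix X :: "'b set" and C f
  assume X: "finite X" "X \<subseteq> carrier N" "is_structure L (restr N X)" and C: "C \<in> K"
    and f: "embedding L (restr N X) C f"
  obtain xs where xs: "set xs = X" using finite_list[OF X(1)] by blast
  obtain ys where ys: "set ys = carrier C" using finite_list K[OF C] by blast
  define cs where "cs = map f xs @ ys"
  define n where "n = length xs"
  define m where "m = length ys"
  have cs: "set cs = carrier C" "length cs = n + m"
    using ys xs embedding_into[OF f] by (auto simp: cs_def n_def m_def)
  have "xs \<noteq> []" using X xs by (auto simp: is_structure_def)
  then have n0: "n > 0" "cs \<noteq> []" by (auto simp: n_def cs_def)
  define \<delta> where "\<delta> = diag L (restr N X) xs"
  define \<epsilon> where "\<epsilon> = diag L C cs"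
  have fv: "fv \<delta> \<subseteq> {..<n}" "fv \<epsilon> \<subseteq> {..<n + m}"
    unfolding \<delta>_def \<epsilon>_def n_def using fv_diag[OF fin] \<open>xs \<noteq> []\<close> n0(2) cs(2) n_def by metis+
  define \<chi> where "\<chi> = Imp \<delta> (Exs [n..<n + m] \<epsilon>)"
  have "holds F \<chi>"
    unfolding holds_def \<chi>_def sat_Imp
  proof (intro allI impI)
    fix v :: "nat \<Rightarrow> 'a" assume v: "range v \<subseteq> carrier F" and sat: "sat F v \<delta>"
    define bs where "bs = map v [0..<n]"
    have "sat_at F bs \<delta>"
      unfolding sat_at_def using sat by (rule sat_cong[THEN iffD1, rotated]) (use fv in \<open>auto simp: bs_def\<close>)
    then have "same_atoms L (restr N X) xs F bs"
      unfolding \<delta>_def by (subst (asm) sat_diag[OF fin]) (auto simp: bs_def n_def)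
    from same_atoms_embedding[OF this] obtain h where h: "embedding L (restr N X) F h" "map h xs = bs"
      using xs X v by (force simp: bs_def)
    define k where "k = inv_into X h"
    have kh: "k (h x) = x" if "x \<in> X" for x using embedding_inj[OF h(1)] that by (simp add: k_def)
    have "embedding L (restr F (h ` X)) (restr N X) k"
      using embedding_inverse[OF h(1) X(3), of k] kh by simp
    then have "embedding L (restr F (h ` X)) C (f \<circ> k)" using embedding_comp f by blast
    moreover have "is_structure L (restr F (h ` X))"
      using closed_under_image[OF h(1) X(3)] X(3) by (auto simp: is_structure_def)
    moreover have "h ` X \<subseteq> carrier F" using embedding_into[OF h(1)] by auto
    ultimately obtain g where g: "embedding L C F g" "\<And>x. x \<in> h ` X \<Longrightarrow> g ((f \<circ> k) x) = x"
      using extension_propertyD[OF ext, of "h ` X" C "f \<circ> k"] C X(1) by (metis finite_imageI)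
    define w where "w i = (if i < n + m then g (cs ! i) else v i)" for i
    have wv: "w i = v i" if "i < n" for i
    proof -
      have "h (xs ! i) = v i" using that arg_cong[OF h(2), of "\<lambda>l. l ! i"] by (simp add: bs_def n_def)
      moreover have "xs ! i \<in> X" using that xs by (auto simp: n_def)
      moreover have "cs ! i = f (xs ! i)" using that by (simp add: cs_def n_def nth_append)
      moreover have "g (f (k (h (xs ! i)))) = h (xs ! i)"
        using g(2)[of "h (xs ! i)"] \<open>xs ! i \<in> X\<close> by simp
      ultimately show ?thesis using that kh[of "xs ! i"] by (simp add: w_def)
    qed
    have "same_atoms L C cs F (map g cs)"
      using embedding_same_atoms[OF g(1)] K[OF C] cs by simp
    then have "sat_at F (map g cs) \<epsilon>" unfolding \<epsilon>_def by (subst sat_diag[OF fin]) auto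
    then have "sat F w \<epsilon>"
      unfolding sat_at_def by (rule sat_cong[THEN iffD1, rotated]) (use fv cs in \<open>auto simp: w_def\<close>)
    moreover have "w i \<in> carrier F" if "i < n + m" for i
      using that embedding_into[OF g(1)] cs nth_mem[of i cs] by (auto simp: w_def)
    moreover have "w i = v i" if "\<not> (n \<le> i \<and> i < n + m)" for i
      using that wv by (cases "i < n") (auto simp: w_def)
    ultimately show "sat F v (Exs [n..<n + m] \<epsilon>)"
      unfolding sat_Exs by (intro exI[of _ w]) auto
  qed
  moreover have "wf_fm L \<chi>" unfolding \<chi>_def \<delta>_def \<epsilon>_def by (simp add: wf_diag[OF fin])
  ultimately have holds: "holds N \<chi>" using models_Th_holds[OF F N] by blast
  define v where "v i = (if i < n then xs ! i else xs ! 0)" for i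
  have "range v \<subseteq> carrier N" using xs X n0 by (auto simp: v_def n_def)
  then have "sat N v \<delta> \<longrightarrow> sat N v (Exs [n..<n + m] \<epsilon>)"
    using holds by (simp add: holds_def \<chi>_def)
  moreover have "sat N v \<delta>"
  proof -
    have "same_atoms L (restr N X) xs N (map id xs)"
      by (rule embedding_same_atoms[OF embedding_restr_id[OF X(2)] X(3)]) (simp add: xs)
    then have "sat_at N xs \<delta>" unfolding \<delta>_def by (subst sat_diag[OF fin]) auto
    then show ?thesis
      unfolding sat_at_def by (rule sat_cong[THEN iffD1, rotated]) (use fv in \<open>auto simp: v_def\<close>)
  qed
  ultimately have "sat N v (Exs [n..<n + m] \<epsilon>)" by simp
  then obtain w where w': "\<forall>i\<in>set [n..<n + m]. w i \<in> carrier N"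
    "\<forall>i. i \<notin> set [n..<n + m] \<longrightarrow> w i = v i" "sat N w \<epsilon>"
    unfolding sat_Exs by blast
  have w: "\<And>i. n \<le> i \<Longrightarrow> i < n + m \<Longrightarrow> w i \<in> carrier N"
    "\<And>i. \<not> (n \<le> i \<and> i < n + m) \<Longrightarrow> w i = v i" "sat N w \<epsilon>"
    using w' by auto
  define bs where "bs = map w [0..<n + m]"
  have wN: "w i \<in> carrier N" if "i < n + m" for i
    using w(1,2)[of i] that \<open>range v \<subseteq> carrier N\<close> by (cases "n \<le> i") auto
  have "sat_at N bs \<epsilon>"
    unfolding sat_at_def using w(3) by (rule sat_cong[THEN iffD1, rotated]) (use fv in \<open>auto simp: bs_def\<close>)
  then have "same_atoms L C cs N bs"
    unfolding \<epsilon>_def by (subst (asm) sat_diag[OF fin]) (auto simp: bs_def cs)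
  from same_atoms_embedding[OF this] obtain g where g: "embedding L C N g" "map g cs = bs"
    using cs wN K[OF C] by (force simp: bs_def)
  have "g (f x) = x" if x: "x \<in> X" for x
  proof -
    obtain i where i: "i < n" "xs ! i = x" using x xs by (metis in_set_conv_nth n_def)
    have "g (cs ! i) = w i" using i cs arg_cong[OF g(2), of "\<lambda>l. l ! i"] by (simp add: bs_def)
    then show ?thesis using i w(2)[of i] by (simp add: cs_def nth_append n_def v_def)
  qed
  then show "\<exists>g. embedding L C N g \<and> (\<forall>x\<in>X. g (f x) = x)" using g(1) by blast
qed

text \<open>
  Finite sets are asked to have finite closed supersets inside every closed set \<open>P\<close>, so that a
  partial isomorphism with infinite domain can be restricted to one with finite domain.
\<close>

definition locally_finite :: "('f, 'r) language \<Rightarrow> ('a, 'f, 'r) struc \<Rightarrow> bool" where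
  "locally_finite L N \<longleftrightarrow>
    (\<forall>P X. P \<subseteq> carrier N \<and> closed_under L N P \<and> finite X \<and> X \<subseteq> P \<longrightarrow>
      (\<exists>Y. finite Y \<and> X \<subseteq> Y \<and> Y \<subseteq> P \<and> closed_under L N Y))"

lemma locally_finiteD:
  assumes "locally_finite L N" "P \<subseteq> carrier N" "closed_under L N P" "finite X" "X \<subseteq> P"
  obtains Y where "finite Y" "X \<subseteq> Y" "Y \<subseteq> P" "closed_under L N Y"
  using assms(1)[unfolded locally_finite_def, rule_format, of P X] assms(2-) that by auto

text \<open>
  The properties of a Fraisse limit on which the back-and-forth argument rests.
\<close>

definition rich ::
  "('f, 'r) language \<Rightarrow> (nat, 'f, 'r) struc set \<Rightarrow> ('a, 'f, 'r) struc \<Rightarrow> bool" where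
  "rich L K N \<longleftrightarrow> is_structure L N \<and> locally_finite L N \<and> extension_property L K N \<and>
    (\<forall>A h. finite (carrier A) \<and> is_structure L A \<and> embedding L A N h \<longrightarrow> A \<in> K)"

definition part_iso ::
  "('f, 'r) language \<Rightarrow> ('a, 'f, 'r) struc \<Rightarrow> (nat \<Rightarrow> 'a) \<Rightarrow> (nat \<Rightarrow> 'a) \<Rightarrow> bool" where
  "part_iso L N v w \<longleftrightarrow>
    (\<exists>P h. finite P \<and> P \<subseteq> carrier N \<and> is_structure L (restr N P) \<and>
      embedding L (restr N P) N h \<and> range v \<subseteq> P \<and> w = h \<circ> v)"

lemma restr_inverse:
  assumes P: "P \<subseteq> carrier N" "is_structure L (restr N P)" and h: "embedding L (restr N P) N h"
  obtains k where "embedding L (restr N (h ` P)) (restr N P) k" "\<And>x. x \<in> P \<Longrightarrow> k (h x) = x"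
    "h ` P \<subseteq> carrier N" "is_structure L (restr N (h ` P))"
proof -
  define k where "k = inv_into P h"
  have kh: "k (h x) = x" if "x \<in> P" for x using embedding_inj[OF h] that by (simp add: k_def)
  have "embedding L (restr N (h ` P)) (restr N P) k"
    using embedding_inverse[OF h P(2), of k] kh by simp
  moreover have "is_structure L (restr N (h ` P))"
    using closed_under_image[OF h P(2)] P(2) by (auto simp: is_structure_def)
  moreover have "h ` P \<subseteq> carrier N" using embedding_into[OF h] by auto
  ultimately show thesis using that kh by blast
qed

lemma part_iso_sym:
  assumes "part_iso L N v w"
  shows "part_iso L N w v"
proof -
  from assms obtain P h where P: "finite P" "P \<subseteq> carrier N" "is_structure L (restr N P)"
    "embedding L (restr N P) N h" "range v \<subseteq> P" "w = h \<circ> v"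
    unfolding part_iso_def by blast
  from restr_inverse[OF P(2-4)] obtain k where k: "embedding L (restr N (h ` P)) (restr N P) k"
    "\<And>x. x \<in> P \<Longrightarrow> k (h x) = x" "h ` P \<subseteq> carrier N" "is_structure L (restr N (h ` P))" by blast
  have "embedding L (restr N (h ` P)) N k"
    using embedding_comp[OF k(1) embedding_restr_id[OF P(2)]] by simp
  moreover have "v = k \<circ> w" using k(2) P(5,6) by (auto simp: fun_eq_iff image_subset_iff)
  moreover have "range w \<subseteq> h ` P" using P by auto
  ultimately show ?thesis
    unfolding part_iso_def using k(3,4) P(1) by blast
qed

text \<open>
  The forth step: a finite \<open>Y\<close> that contains \<open>P\<close> and the new point is a member of \<open>K\<close>, and the
  extension property places it over \<open>h ` P\<close>.
\<close>

lemma rich_extend_embedding: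
  fixes N :: "('a, 'f, 'r) struc"
  assumes N: "rich L K N" and P: "finite P" "P \<subseteq> carrier N" "is_structure L (restr N P)"
    and h: "embedding L (restr N P) N h" and a: "a \<in> carrier N"
  obtains Y h' where "finite Y" "insert a P \<subseteq> Y" "Y \<subseteq> carrier N" "closed_under L N Y"
    "embedding L (restr N Y) N h'" "\<And>x. x \<in> P \<Longrightarrow> h' x = h x"
proof -
  from restr_inverse[OF P(2,3) h] obtain k where k: "embedding L (restr N (h ` P)) (restr N P) k"
    "\<And>x. x \<in> P \<Longrightarrow> k (h x) = x" "h ` P \<subseteq> carrier N" "is_structure L (restr N (h ` P))" by blast
  have "closed_under L N (carrier N)" using N by (simp add: rich_def is_structure_def)
  then obtain Y where Y: "finite Y" "insert a P \<subseteq> Y" "Y \<subseteq> carrier N" "closed_under L N Y"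
    using locally_finiteD[of L N "carrier N" "insert a P"] N P a by (auto simp: rich_def)
  then have sY: "is_structure L (restr N Y)" by (auto simp: is_structure_restr)
  obtain f :: "'a \<Rightarrow> nat" where f: "inj_on f Y" using Y(1) finite_imp_inj_to_nat_seg by metis
  then have f': "inj_on f (carrier (restr N Y))" by simp
  define C where "C = copy f (restr N Y)"
  have "embedding L C N (inv_into Y f)"
    using embedding_comp[OF embedding_copy_inverse[OF f' sY] embedding_restr_id[OF Y(3)]]
    by (simp add: C_def)
  moreover have "is_structure L C" unfolding C_def by (rule is_structure_copy[OF f' sY])
  moreover have "finite (carrier C)" using Y by (simp add: C_def)
  ultimately have C: "C \<in> K" using N by (auto simp: rich_def)
  have fC: "embedding L (restr N Y) C f" unfolding C_def by (rule embedding_copy[OF f'])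
  have "embedding L (restr N P) C f" by (rule embedding_restr_subset[OF fC]) (use Y in auto)
  from embedding_comp[OF k(1) this] have "embedding L (restr N (h ` P)) C (f \<circ> k)" .
  moreover have "extension_property L K N" using N by (simp add: rich_def)
  ultimately obtain g where g: "embedding L C N g" "\<And>x. x \<in> h ` P \<Longrightarrow> g ((f \<circ> k) x) = x"
    using extension_propertyD[of L K N "h ` P" C "f \<circ> k"] C k P(1) by (metis finite_imageI)
  have gf: "embedding L (restr N Y) N (g \<circ> f)" by (rule embedding_comp[OF fC g(1)])
  have "(g \<circ> f) x = h x" if "x \<in> P" for x
    using g(2)[of "h x"] k(2)[of x] that by simp
  then show thesis by (rule that[OF Y gf])
qed

lemma part_iso_forth:
  assumes N: "rich L K N" and iso: "part_iso L N v w" and a: "a \<in> carrier N"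
  obtains b where "b \<in> carrier N" "part_iso L N (v(i := a)) (w(i := b))"
proof -
  from iso obtain P h where P: "finite P" "P \<subseteq> carrier N" "is_structure L (restr N P)"
    "embedding L (restr N P) N h" "range v \<subseteq> P" "w = h \<circ> v"
    unfolding part_iso_def by blast
  obtain Y h' where Y: "finite Y" "insert a P \<subseteq> Y" "Y \<subseteq> carrier N" "closed_under L N Y"
    "embedding L (restr N Y) N h'" "\<And>x. x \<in> P \<Longrightarrow> h' x = h x"
    using rich_extend_embedding[OF N P(1-4) a] by metis
  have "w(i := h' a) = h' \<circ> (v(i := a))"
    using P(5,6) Y(6) by (auto simp: fun_eq_iff image_subset_iff)
  moreover have "range (v(i := a)) \<subseteq> Y" using Y(2) P(5) by (auto simp: subset_iff image_subset_iff)
  moreover have "is_structure L (restr N Y)" using Y by (auto simp: is_structure_restr)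
  ultimately have "part_iso L N (v(i := a)) (w(i := h' a))"
    unfolding part_iso_def using Y by (intro exI[of _ Y] exI[of _ h']) simp
  moreover have "h' a \<in> carrier N" using embedding_into[OF Y(5), of a] Y(2) by simp
  ultimately show thesis using that by blast
qed

lemma embedding_restr_sat_qf:
  assumes "P \<subseteq> carrier N" "is_structure L (restr N P)" "embedding L (restr N P) N h"
    "wf_fm L \<phi>" "quantifier_free \<phi>" "\<And>i. i \<in> fv \<phi> \<Longrightarrow> v i \<in> P \<and> w i = h (v i)"
  shows "sat N v \<phi> \<longleftrightarrow> sat N w \<phi>"
  using embedding_sat_qf[OF embedding_restr_id[OF assms(1)] assms(2,4,5), of v v]
    embedding_sat_qf[OF assms(3,2,4,5), of v w] assms(6) by auto

lemma part_iso_sat_qf: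
  assumes "part_iso L N v w" "wf_fm L \<phi>" "quantifier_free \<phi>"
  shows "sat N v \<phi> \<longleftrightarrow> sat N w \<phi>"
proof -
  from assms(1) obtain P h where P: "P \<subseteq> carrier N" "is_structure L (restr N P)"
    "embedding L (restr N P) N h" "range v \<subseteq> P" "w = h \<circ> v"
    unfolding part_iso_def by blast
  show ?thesis
    by (rule embedding_restr_sat_qf[OF P(1-3) assms(2,3)]) (use P in auto)
qed

lemma part_iso_sat:
  assumes N: "rich L K N"
  shows "part_iso L N v w \<Longrightarrow> wf_fm L \<phi> \<Longrightarrow> sat N v \<phi> \<longleftrightarrow> sat N w \<phi>"
proof (induction \<phi> arbitrary: v w)
  case (Eq s t)
  then show ?case using part_iso_sat_qf by (metis quantifier_free.simps(1))
next
  case (Rel R ts)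
  then show ?case using part_iso_sat_qf by (metis quantifier_free.simps(2))
next
  case (Neg \<phi>)
  then show ?case by simp
next
  case (And \<phi> \<psi>)
  then show ?case by simp
next
  case (Ex i \<phi>)
  have *: "sat N w (Ex i \<phi>)" if iso: "part_iso L N v w" and sat: "sat N v (Ex i \<phi>)" for v w
  proof -
    from sat obtain a where a: "a \<in> carrier N" "sat N (v(i := a)) \<phi>" by auto
    from part_iso_forth[OF N iso a(1)] obtain b
      where "b \<in> carrier N" "part_iso L N (v(i := a)) (w(i := b))" by blast
    then show ?thesis using Ex a by auto
  qed
  show ?case using *[of v w] *[of w v] part_iso_sym Ex.prems(1) by blast
qed

text \<open>
  Quantifier elimination, in the form in which it is used throughout: partial isomorphisms between
  substructures preserve all formulas, even when the domain is infinite, because a formula sees only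
  finitely many points.
\<close>

theorem rich_sat_iff:
  assumes N: "rich L K N" and P: "P \<subseteq> carrier N" "closed_under L N P"
    and h: "embedding L (restr N P) N h" and \<phi>: "wf_fm L \<phi>"
    and vw: "\<And>i. i \<in> fv \<phi> \<Longrightarrow> v i \<in> P \<and> w i = h (v i)" and ne: "P \<noteq> {}"
  shows "sat N v \<phi> \<longleftrightarrow> sat N w \<phi>"
proof -
  obtain a where a: "a \<in> P" using ne by auto
  have "locally_finite L N" using N by (simp add: rich_def)
  moreover have "finite (insert a (v ` fv \<phi>))" by (simp add: finite_fv)
  moreover have "insert a (v ` fv \<phi>) \<subseteq> P" using a vw by auto
  ultimately obtain Y where Y: "finite Y" "insert a (v ` fv \<phi>) \<subseteq> Y" "Y \<subseteq> P"
      "closed_under L N Y"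
    by (rule locally_finiteD[OF _ P])
  define v' where "v' i = (if i \<in> fv \<phi> then v i else a)" for i
  have "is_structure L (restr N Y)" using Y by (auto simp: is_structure_restr)
  moreover have "embedding L (restr N Y) N h" by (rule embedding_restr_subset[OF h Y(3)])
  moreover have "range v' \<subseteq> Y" using Y(2) by (auto simp: v'_def)
  ultimately have "part_iso L N v' (h \<circ> v')"
    unfolding part_iso_def using Y P(1) by (intro exI[of _ Y] exI[of _ h]) simp
  from part_iso_sat[OF N this \<phi>] have "sat N v' \<phi> \<longleftrightarrow> sat N (h \<circ> v') \<phi>" .
  moreover have "sat N v \<phi> \<longleftrightarrow> sat N v' \<phi>" by (rule sat_cong) (simp add: v'_def)
  moreover have "sat N w \<phi> \<longleftrightarrow> sat N (h \<circ> v') \<phi>" by (rule sat_cong) (simp add: v'_def vw)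
  ultimately show ?thesis by simp
qed

section \<open>Compactness relative to a structure\<close>

instance tm :: (countable) countable by countable_datatype
instance fm :: (countable, countable) countable by countable_datatype

lemma wf_tm_syms: "wf_tm L t \<Longrightarrow> set_tm t \<subseteq> fun_syms L"
  by (induction t) (auto simp: list_all_iff subset_iff)

lemma wf_fm_syms: "wf_fm L \<phi> \<Longrightarrow> set1_fm \<phi> \<subseteq> fun_syms L \<and> set2_fm \<phi> \<subseteq> rel_syms L"
  by (induction \<phi>) (use wf_tm_syms in \<open>auto simp: subset_iff\<close>)

lemma wf_fm_enumeration:
  fixes L :: "('f, 'r) language"
  assumes "finite (fun_syms L)" "finite (rel_syms L)"
  obtains dec :: "nat \<Rightarrow> ('f, 'r) fm" where "\<And>\<phi>. wf_fm L \<phi> \<Longrightarrow> \<exists>n. dec n = \<phi>"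
proof -
  obtain f :: "'f \<Rightarrow> nat" where f: "inj_on f (fun_syms L)"
    using finite_imp_inj_to_nat_seg[OF assms(1)] by blast
  obtain r :: "'r \<Rightarrow> nat" where r: "inj_on r (rel_syms L)"
    using finite_imp_inj_to_nat_seg[OF assms(2)] by blast
  have inj: "inj_on (map_fm f r) {\<phi>. wf_fm L \<phi>}"
  proof (rule inj_onI)
    fix \<phi> \<psi> :: "('f, 'r) fm"
    assume wf: "\<phi> \<in> {\<phi>. wf_fm L \<phi>}" "\<psi> \<in> {\<phi>. wf_fm L \<phi>}"
      and eq: "map_fm f r \<phi> = map_fm f r \<psi>"
    note syms = wf_fm_syms[of L \<phi>] wf_fm_syms[of L \<psi>]
    show "\<phi> = \<psi>"
    proof (rule fm.inj_map_strong[OF _ _ eq])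
      fix x y assume "x \<in> set1_fm \<phi>" "y \<in> set1_fm \<psi>" "f x = f y"
      then show "x = y" using wf syms f by (auto dest!: inj_onD)
    next
      fix x y assume "x \<in> set2_fm \<phi>" "y \<in> set2_fm \<psi>" "r x = r y"
      then show "x = y" using wf syms r by (auto dest!: inj_onD)
    qed
  qed
  define c where "c \<phi> = to_nat (map_fm f r \<phi>)" for \<phi>
  have c: "inj_on c {\<phi>. wf_fm L \<phi>}"
    using inj by (auto simp: c_def inj_on_def)
  show thesis
  proof
    fix \<phi> :: "('f, 'r) fm" assume "wf_fm L \<phi>"
    then show "\<exists>n. inv_into {\<phi>. wf_fm L \<phi>} c n = \<phi>"
      using c by (intro exI[of _ "c \<phi>"]) simp
  qed
qed

lemma infinite_pairing:
  assumes "infinite (UNIV :: 'u set)"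
  obtains p :: "'u \<times> 'u \<Rightarrow> 'u" where "inj p"
proof -
  have "(card_of ((UNIV :: 'u set) \<times> (UNIV :: 'u set)), card_of (UNIV :: 'u set)) \<in> ordLeq"
    using ordIso_imp_ordLeq[OF card_of_Times_same_infinite[OF assms]] .
  then obtain p :: "'u \<times> 'u \<Rightarrow> 'u" where "inj_on p (UNIV \<times> UNIV)"
    unfolding card_of_ordLeq[symmetric] by blast
  then show thesis using that by simp
qed

lemma infinite_nat_embedding:
  assumes "infinite (UNIV :: 'u set)"
  obtains z :: "nat \<Rightarrow> 'u" where "inj z"
  using infinite_countable_subset[OF assms] by blast

text \<open>
  Terms over the constants \<open>'b\<close> and Skolem functions, where \<open>Sk n\<close> is a Skolem function for the
  \<open>n\<close>-th formula of an enumeration. They name the elements of the structure that is built in the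
  compactness theorem. Being terms, they are few: \<open>'u\<close> has room for them as soon as it has room for
  the constants.
\<close>

datatype 'b sk = Base 'b | Sk nat "'b sk list"

lemma sk_injection:
  fixes ib :: "'b \<Rightarrow> 'u"
  assumes inf: "infinite (UNIV :: 'u set)" and ib: "inj ib"
  obtains E :: "'b sk \<Rightarrow> 'u" where "inj E"
proof -
  obtain p :: "'u \<times> 'u \<Rightarrow> 'u" where p: "inj p" by (rule infinite_pairing[OF inf])
  obtain z :: "nat \<Rightarrow> 'u" where z: "inj z" by (rule infinite_nat_embedding[OF inf])
  have p_eq: "p x = p y \<longleftrightarrow> x = y" for x y using p by (auto dest: injD)
  have z_eq: "z x = z y \<longleftrightarrow> x = y" for x y using z by (auto dest: injD)
  define lst where "lst us = foldr (\<lambda>x y. p (z 1, p (x, y))) us (p (z 0, z 0))" for us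
  have lst: "lst us = lst vs \<Longrightarrow> us = vs" for us vs
  proof (induction us arbitrary: vs)
    case Nil
    then show ?case by (cases vs) (auto simp: lst_def p_eq z_eq)
  next
    case (Cons u us)
    then show ?case by (cases vs) (auto simp: lst_def p_eq z_eq)
  qed
  define E where "E = rec_sk (\<lambda>b. p (z 0, ib b)) (\<lambda>n ts. p (z (Suc n), lst (map snd ts)))"
  have E: "E (Base b) = p (z 0, ib b)" "E (Sk n ts) = p (z (Suc n), lst (map E ts))" for b n ts
    by (simp_all add: E_def comp_def)
  have "E s = E t \<Longrightarrow> s = t" for s t
  proof (induction s arbitrary: t)
    case (Base b)
    then show ?case by (cases t) (use ib in \<open>auto simp: E p_eq z_eq dest: injD\<close>)
  next
    case (Sk n ss)
    show ?case
    proof (cases t)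
      case (Sk m ts)
      then have nm: "n = m" "map E ss = map E ts"
        using Sk.prems lst by (auto simp: E p_eq z_eq)
      have len: "length ss = length ts" using nm(2) by (metis length_map)
      have "ss = ts"
      proof (rule nth_equalityI[OF len])
        fix i assume i: "i < length ss"
        have "E (ss ! i) = E (ts ! i)" using arg_cong[OF nm(2), of "\<lambda>l. l ! i"] i len by simp
        then show "ss ! i = ts ! i" using Sk.IH[of "ss ! i"] i by simp
      qed
      then show ?thesis using Sk nm by simp
    qed (use Sk.prems in \<open>auto simp: E p_eq z_eq\<close>)
  qed
  then show thesis using that by (auto simp: inj_def)
qed

text \<open>
  A maximal family with the finite intersection property, found by Zorn's lemma, is an ultrafilter.
\<close>

lemma ultrafilter_extending:
  fixes S0 :: "'a set set"
  assumes fip: "\<And>T. finite T \<Longrightarrow> T \<subseteq> S0 \<Longrightarrow> \<Inter>T \<noteq> {}"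
  obtains U :: "'a filter" where "\<And>A. A \<in> S0 \<Longrightarrow> eventually (\<lambda>x. x \<in> A) U"
    "\<And>P. eventually (\<lambda>x. \<not> P x) U \<longleftrightarrow> \<not> eventually P U"
proof -
  define F where "F = {S. S0 \<subseteq> S \<and> (\<forall>T. finite T \<and> T \<subseteq> S \<longrightarrow> \<Inter>T \<noteq> {})}"
  have "\<exists>S\<in>F. \<forall>X\<in>F. S \<subseteq> X \<longrightarrow> X = S"
  proof (rule subset_Zorn_nonempty)
    show "F \<noteq> {}" using fip by (auto simp: F_def)
  next
    fix C assume C: "C \<noteq> {}" "subset.chain F C"
    have CF: "C \<subseteq> F" using C(2) by (simp add: subset_chain_def)
    have "\<Inter>T \<noteq> {}" if T: "finite T" "T \<subseteq> \<Union>C" for T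
    proof -
      from finite_subset_Union_chain[OF T C] obtain B where "B \<in> C" "T \<subseteq> B" by blast
      then show ?thesis using CF T(1) by (auto simp: F_def)
    qed
    moreover have "S0 \<subseteq> \<Union>C" using C(1) CF by (fastforce simp: F_def)
    ultimately show "\<Union>C \<in> F" by (simp add: F_def)
  qed
  then obtain S where S: "S \<in> F" and max: "\<And>X. X \<in> F \<Longrightarrow> S \<subseteq> X \<Longrightarrow> X = S" by blast
  have S_fip: "\<Inter>T \<noteq> {}" if "finite T" "T \<subseteq> S" for T using that S by (auto simp: F_def)
  have compl: "- A \<in> S \<longleftrightarrow> A \<notin> S" for A
  proof
    assume "- A \<in> S"
    then show "A \<notin> S" using S_fip[of "{A, - A}"] by auto
  next
    assume A: "A \<notin> S"
    have "insert A S \<notin> F" using max[of "insert A S"] A by blast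
    then obtain T where T: "finite T" "T \<subseteq> insert A S" "\<Inter>T = {}"
      using S by (auto simp: F_def)
    have "insert (- A) S \<in> F"
      unfolding F_def
    proof (intro CollectI conjI allI impI)
      show "S0 \<subseteq> insert (- A) S" using S by (auto simp: F_def)
      fix T' assume T': "finite T' \<and> T' \<subseteq> insert (- A) S"
      have "\<Inter>(T - {A} \<union> (T' - {- A})) \<noteq> {}" by (rule S_fip) (use T T' in auto)
      then obtain x where x: "\<And>B. B \<in> T \<Longrightarrow> B \<noteq> A \<Longrightarrow> x \<in> B" "\<And>B. B \<in> T' \<Longrightarrow> B \<noteq> - A \<Longrightarrow> x \<in> B"
        by auto
      have "x \<notin> A"
      proof
        assume "x \<in> A"
        then have "x \<in> \<Inter>T" using x(1) by blast
        then show False using T(3) by simp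
      qed
      then have "x \<in> \<Inter>T'" using x(2) by blast
      then show "\<Inter>T' \<noteq> {}" by blast
    qed
    then show "- A \<in> S" using max[of "insert (- A) S"] by blast
  qed
  have int: "A \<inter> B \<in> S" if "A \<in> S" "B \<in> S" for A B
  proof (rule ccontr)
    assume "A \<inter> B \<notin> S"
    then have "- (A \<inter> B) \<in> S" using compl by blast
    then show False using S_fip[of "{A, B, - (A \<inter> B)}"] that by auto
  qed
  have mono: "B \<in> S" if "A \<in> S" "A \<subseteq> B" for A B
  proof (rule ccontr)
    assume "B \<notin> S"
    then have "- B \<in> S" using compl by blast
    then show False using S_fip[of "{A, - B}"] that by auto
  qed
  have univ: "UNIV \<in> S"
    using compl[of "{}"] S_fip[of "{{}}"] by auto
  have "is_filter (\<lambda>P. {x. P x} \<in> S)"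
  proof
    show "{x. True} \<in> S" using univ by simp
  next
    fix P Q assume "{x. P x} \<in> S" "{x. Q x} \<in> S"
    then show "{x. P x \<and> Q x} \<in> S" using int[of "{x. P x}" "{x. Q x}"] by (simp add: Collect_conj_eq)
  next
    fix P Q assume "\<forall>x. P x \<longrightarrow> Q x" "{x. P x} \<in> S"
    then show "{x. Q x} \<in> S" using mono[of "{x. P x}" "{x. Q x}"] by auto
  qed
  then have ev: "eventually P (Abs_filter (\<lambda>P. {x. P x} \<in> S)) \<longleftrightarrow> {x. P x} \<in> S" for P
    by (rule eventually_Abs_filter)
  show thesis
  proof
    show "eventually (\<lambda>x. x \<in> A) (Abs_filter (\<lambda>P. {x. P x} \<in> S))" if "A \<in> S0" for A
      unfolding ev using that S by (auto simp: F_def)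
    show "eventually (\<lambda>x. \<not> P x) (Abs_filter (\<lambda>P. {x. P x} \<in> S)) \<longleftrightarrow>
        \<not> eventually P (Abs_filter (\<lambda>P. {x. P x} \<in> S))" for P
      unfolding ev using compl[of "{x. P x}"] by (simp add: Compl_eq)
  qed
qed

definition witness :: "('a, 'f, 'r) struc \<Rightarrow> ('f, 'r) fm \<Rightarrow> 'a list \<Rightarrow> 'a" where
  "witness M \<phi> as = (SOME a. a \<in> carrier M \<and>
    (\<forall>i \<psi>. \<phi> = Ex i \<psi> \<and> sat M ((!) as) \<phi> \<longrightarrow> sat M (((!) as)(i := a)) \<psi>))"

lemma
  assumes "carrier M \<noteq> {}"
  shows witness_in: "witness M \<phi> as \<in> carrier M"
    and witness_sat: "sat M ((!) as) (Ex i \<psi>) \<Longrightarrow> sat M (((!) as)(i := witness M (Ex i \<psi>) as)) \<psi>"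
proof -
  have "\<exists>a. a \<in> carrier M \<and>
    (\<forall>i \<psi>. \<phi> = Ex i \<psi> \<and> sat M ((!) as) \<phi> \<longrightarrow> sat M (((!) as)(i := a)) \<psi>)" for \<phi>
    using assms by (cases \<phi>) auto
  from someI_ex[OF this]
  have *: "witness M \<phi> as \<in> carrier M \<and>
    (\<forall>i \<psi>. \<phi> = Ex i \<psi> \<and> sat M ((!) as) \<phi> \<longrightarrow> sat M (((!) as)(i := witness M \<phi> as)) \<psi>)" for \<phi>
    unfolding witness_def .
  show "witness M \<phi> as \<in> carrier M" using * by blast
  show "sat M ((!) as) (Ex i \<psi>) \<Longrightarrow> sat M (((!) as)(i := witness M (Ex i \<psi>) as)) \<psi>"
    using *[of "Ex i \<psi>"] by blast
qed

primrec sk_val ::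
  "('a, 'f, 'r) struc \<Rightarrow> (nat \<Rightarrow> ('f, 'r) fm) \<Rightarrow> ('b \<Rightarrow> 'a) \<Rightarrow> 'b sk \<Rightarrow> 'a" where
  "sk_val M dec \<sigma> (Base b) = \<sigma> b"
| "sk_val M dec \<sigma> (Sk n ts) = witness M (dec n) (map (sk_val M dec \<sigma>) ts)"

lemma sk_val_in:
  assumes "carrier M \<noteq> {}" "range \<sigma> \<subseteq> carrier M"
  shows "sk_val M dec \<sigma> t \<in> carrier M"
  using assms by (cases t) (auto simp: witness_in)

text \<open>
  The structure is the Skolem hull of the constants in an ultrapower of \<open>M\<close>. The ultrafilter lives on
  the assignments of elements of \<open>M\<close> to the constants and contains the set of solutions of every
  member of \<open>\<Gamma>\<close>. Each Skolem term \<open>t\<close> yields the element \<open>\<lambda>\<sigma>. w \<sigma> t\<close> of the ultrapower.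
  Staying inside the hull keeps the carrier small enough for \<open>'u\<close>, so that this is compactness and the
  downward Loewenheim-Skolem theorem in one, and the Skolem functions give the witnesses in the proof
  of the theorem of Los.
\<close>

theorem compactness:
  fixes M :: "('a, 'f, 'r) struc" and \<Gamma> :: "(('f, 'r) fm \<times> (nat \<Rightarrow> 'b)) set" and ib :: "'b \<Rightarrow> 'u"
  assumes fin: "finite (fun_syms L)" "finite (rel_syms L)" and M: "is_structure L M"
    and inf: "infinite (UNIV :: 'u set)" and ib: "inj ib"
    and wf: "\<And>\<phi> v. (\<phi>, v) \<in> \<Gamma> \<Longrightarrow> wf_fm L \<phi>"
    and finsat: "\<And>\<Gamma>0. finite \<Gamma>0 \<Longrightarrow> \<Gamma>0 \<subseteq> \<Gamma> \<Longrightarrow>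
      \<exists>\<sigma>. range \<sigma> \<subseteq> carrier M \<and> (\<forall>(\<phi>, v)\<in>\<Gamma>0. sat M (\<sigma> \<circ> v) \<phi>)"
  obtains N :: "('u, 'f, 'r) struc" and \<tau> :: "'b \<Rightarrow> 'u" where "is_structure L N"
    "range \<tau> \<subseteq> carrier N" "\<And>\<phi> v. (\<phi>, v) \<in> \<Gamma> \<Longrightarrow> sat N (\<tau> \<circ> v) \<phi>"
proof -
  obtain dec :: "nat \<Rightarrow> ('f, 'r) fm" where dec: "\<And>\<phi>. wf_fm L \<phi> \<Longrightarrow> \<exists>n. dec n = \<phi>"
    using wf_fm_enumeration[OF fin] by blast
  obtain E :: "'b sk \<Rightarrow> 'u" where E: "inj E" by (rule sk_injection[OF inf ib])
  have M0: "carrier M \<noteq> {}" using M by (simp add: is_structure_def)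
  define G where "G = {\<sigma> :: 'b \<Rightarrow> 'a. range \<sigma> \<subseteq> carrier M}"
  define sol where "sol = (\<lambda>(\<phi>, v). {\<sigma> \<in> G. sat M (\<sigma> \<circ> v) \<phi>})"
  have "\<Inter>T \<noteq> {}" if T: "finite T" "T \<subseteq> insert G (sol ` \<Gamma>)" for T
  proof -
    from T have "finite (T - {G})" "T - {G} \<subseteq> sol ` \<Gamma>" by auto
    then obtain \<Gamma>0 where \<Gamma>0: "finite \<Gamma>0" "\<Gamma>0 \<subseteq> \<Gamma>" "T - {G} = sol ` \<Gamma>0"
      by (meson finite_subset_image)
    from finsat[OF \<Gamma>0(1,2)] obtain \<sigma>
      where \<sigma>: "range \<sigma> \<subseteq> carrier M" "\<forall>(\<phi>, v)\<in>\<Gamma>0. sat M (\<sigma> \<circ> v) \<phi>" by blast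
    then have "\<sigma> \<in> G" "\<forall>A\<in>sol ` \<Gamma>0. \<sigma> \<in> A" by (auto simp: G_def sol_def)
    then have "\<sigma> \<in> \<Inter>T" using \<Gamma>0(3) by (metis DiffI InterI singletonD)
    then show ?thesis by blast
  qed
  then obtain U where U: "\<And>A. A \<in> insert G (sol ` \<Gamma>) \<Longrightarrow> eventually (\<lambda>\<sigma>. \<sigma> \<in> A) U"
    and ultra: "\<And>P. eventually (\<lambda>x. \<not> P x) U \<longleftrightarrow> \<not> eventually P U"
    using ultrafilter_extending[of "insert G (sol ` \<Gamma>)"] by blast
  have G: "\<forall>\<^sub>F \<sigma> in U. range \<sigma> \<subseteq> carrier M" using U[of G] by (simp add: G_def)
  define w :: "('b \<Rightarrow> 'a) \<Rightarrow> 'b sk \<Rightarrow> 'a" where "w = sk_val M dec"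
  have w_Base: "w \<sigma> (Base b) = \<sigma> b" for \<sigma> b by (simp add: w_def)
  have w_in: "range \<sigma> \<subseteq> carrier M \<Longrightarrow> w \<sigma> t \<in> carrier M" for \<sigma> t
    unfolding w_def by (rule sk_val_in[OF M0])
  have skolem: "\<exists>s. \<forall>\<sigma>. sat M (w \<sigma> \<circ> v) (Ex i \<phi>) \<longrightarrow> sat M ((w \<sigma> \<circ> v)(i := w \<sigma> s)) \<phi>"
    if \<phi>: "wf_fm L \<phi>" for v i \<phi>
  proof -
    obtain n where n: "dec n = Ex i \<phi>" using dec[of "Ex i \<phi>"] \<phi> by auto
    obtain k where k: "fv \<phi> \<subseteq> {..<k}" using finite_fv[of \<phi>] unfolding finite_nat_set_iff_bounded by auto
    define s where "s = Sk n (map v [0..<k])"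
    have "sat M ((w \<sigma> \<circ> v)(i := w \<sigma> s)) \<phi>" if sat: "sat M (w \<sigma> \<circ> v) (Ex i \<phi>)" for \<sigma>
    proof -
      define as where "as = map (w \<sigma> \<circ> v) [0..<k]"
      have ws: "w \<sigma> s = witness M (Ex i \<phi>) as" by (simp add: w_def s_def n as_def comp_def)
      have "sat M ((!) as) (Ex i \<phi>) \<longleftrightarrow> sat M (w \<sigma> \<circ> v) (Ex i \<phi>)"
        by (rule sat_cong) (use k in \<open>auto simp: as_def\<close>)
      then have "sat M (((!) as)(i := w \<sigma> s)) \<phi>"
        using witness_sat[OF M0, of as i \<phi>] sat ws by simp
      moreover have "sat M (((!) as)(i := w \<sigma> s)) \<phi> \<longleftrightarrow> sat M ((w \<sigma> \<circ> v)(i := w \<sigma> s)) \<phi>"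
        by (rule sat_cong) (use k in \<open>auto simp: as_def\<close>)
      ultimately show ?thesis by simp
    qed
    then show ?thesis by blast
  qed
  define cl where "cl t = E (SOME s. \<forall>\<^sub>F \<sigma> in U. w \<sigma> s = w \<sigma> t)" for t
  have cl: "cl s = cl t \<longleftrightarrow> (\<forall>\<^sub>F \<sigma> in U. w \<sigma> s = w \<sigma> t)" for s t
  proof
    assume *: "\<forall>\<^sub>F \<sigma> in U. w \<sigma> s = w \<sigma> t"
    have "(\<forall>\<^sub>F \<sigma> in U. w \<sigma> r = w \<sigma> s) \<longleftrightarrow> (\<forall>\<^sub>F \<sigma> in U. w \<sigma> r = w \<sigma> t)" for r
    proof
      assume "\<forall>\<^sub>F \<sigma> in U. w \<sigma> r = w \<sigma> s"
      then show "\<forall>\<^sub>F \<sigma> in U. w \<sigma> r = w \<sigma> t" using * by eventually_elim simp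
    next
      assume "\<forall>\<^sub>F \<sigma> in U. w \<sigma> r = w \<sigma> t"
      then show "\<forall>\<^sub>F \<sigma> in U. w \<sigma> r = w \<sigma> s" using * by eventually_elim simp
    qed
    then show "cl s = cl t" by (simp add: cl_def)
  next
    assume "cl s = cl t"
    then have eq: "(SOME r. \<forall>\<^sub>F \<sigma> in U. w \<sigma> r = w \<sigma> s) = (SOME r. \<forall>\<^sub>F \<sigma> in U. w \<sigma> r = w \<sigma> t)"
      using E by (auto simp: cl_def dest: injD)
    have "\<forall>\<^sub>F \<sigma> in U. w \<sigma> (SOME r. \<forall>\<^sub>F \<sigma> in U. w \<sigma> r = w \<sigma> x) = w \<sigma> x" for x
      by (rule someI[of "\<lambda>r. \<forall>\<^sub>F \<sigma> in U. w \<sigma> r = w \<sigma> x" x]) simp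
    from this[of s] this[of t] show "\<forall>\<^sub>F \<sigma> in U. w \<sigma> s = w \<sigma> t"
      unfolding eq by eventually_elim simp
  qed
  define sec where "sec u = (SOME t. cl t = u)" for u
  have sec: "\<forall>\<^sub>F \<sigma> in U. w \<sigma> (sec (cl t)) = w \<sigma> t" for t
  proof -
    have "cl (sec (cl t)) = cl t" unfolding sec_def by (rule someI[of _ t]) simp
    then show ?thesis by (simp add: cl)
  qed
  define N :: "('u, 'f, 'r) struc" where "N = \<lparr>carrier = range cl,
    fun_int = (\<lambda>f us. cl (SOME t. \<forall>\<^sub>F \<sigma> in U. w \<sigma> t = fun_int M f (map (w \<sigma> \<circ> sec) us))),
    rel_int = (\<lambda>R us. \<forall>\<^sub>F \<sigma> in U. rel_int M R (map (w \<sigma> \<circ> sec) us))\<rparr>"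
  have tm_los: "\<exists>s. tm_val N (cl \<circ> v) t = cl s \<and> (\<forall>\<^sub>F \<sigma> in U. w \<sigma> s = tm_val M (w \<sigma> \<circ> v) t)"
    if "wf_tm L t" for v t
    using that
  proof (induction t)
    case (Var i)
    then show ?case by auto
  next
    case (Fun f ts)
    have "\<forall>t\<in>set ts. \<exists>s. tm_val N (cl \<circ> v) t = cl s \<and> (\<forall>\<^sub>F \<sigma> in U. w \<sigma> s = tm_val M (w \<sigma> \<circ> v) t)"
    proof
      fix t assume t: "t \<in> set ts"
      then have "wf_tm L t" using Fun.prems by (simp add: list_all_iff)
      then show "\<exists>s. tm_val N (cl \<circ> v) t = cl s \<and> (\<forall>\<^sub>F \<sigma> in U. w \<sigma> s = tm_val M (w \<sigma> \<circ> v) t)"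
        by (rule Fun.IH[OF t])
    qed
    from bchoice[OF this] obtain S where S: "\<And>t. t \<in> set ts \<Longrightarrow> tm_val N (cl \<circ> v) t = cl (S t)"
      "\<And>t. t \<in> set ts \<Longrightarrow> \<forall>\<^sub>F \<sigma> in U. w \<sigma> (S t) = tm_val M (w \<sigma> \<circ> v) t" by blast
    define us where "us = map (tm_val N (cl \<circ> v)) ts"
    have "\<forall>\<^sub>F \<sigma> in U. w \<sigma> (sec (tm_val N (cl \<circ> v) t)) = tm_val M (w \<sigma> \<circ> v) t" if t: "t \<in> set ts" for t
      using S(2)[OF t] sec[of "S t"] unfolding S(1)[OF t] by eventually_elim simp
    then have "\<forall>\<^sub>F \<sigma> in U. \<forall>t\<in>set ts. w \<sigma> (sec (tm_val N (cl \<circ> v) t)) = tm_val M (w \<sigma> \<circ> v) t"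
      by (intro eventually_ball_finite) auto
    then have us: "\<forall>\<^sub>F \<sigma> in U. map (w \<sigma> \<circ> sec) us = map (tm_val M (w \<sigma> \<circ> v)) ts"
      by eventually_elim (simp add: us_def)
    define n where "n = length ts"
    define v' where "v' j = sec (us ! j)" for j
    have "wf_fm L (Eq (Var n) (Fun f (map Var [0..<n])))"
      using Fun.prems by (simp add: list_all_iff n_def)
    from skolem[OF this, of v' n] obtain s where
      s: "\<And>\<sigma>. sat M (w \<sigma> \<circ> v') (Ex n (Eq (Var n) (Fun f (map Var [0..<n])))) \<Longrightarrow>
        sat M ((w \<sigma> \<circ> v')(n := w \<sigma> s)) (Eq (Var n) (Fun f (map Var [0..<n])))" by blast
    have mv: "map (tm_val M ((w \<sigma> \<circ> v')(n := a)) \<circ> Var) [0..<n] = map (w \<sigma> \<circ> sec) us" for \<sigma> a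
      by (rule nth_equalityI) (simp_all add: us_def n_def v'_def)
    have ex: "\<forall>\<^sub>F \<sigma> in U. w \<sigma> s = fun_int M f (map (w \<sigma> \<circ> sec) us)"
      using G
    proof eventually_elim
      case (elim \<sigma>)
      have "fun_int M f (map (w \<sigma> \<circ> sec) us) \<in> carrier M"
        using M Fun.prems w_in[OF elim]
        by (auto simp: is_structure_def closed_under_def us_def image_subset_iff)
      then have "sat M (w \<sigma> \<circ> v') (Ex n (Eq (Var n) (Fun f (map Var [0..<n]))))"
        by (simp add: mv)
      from s[OF this] show ?case by (simp add: mv)
    qed
    define t where "t = (SOME t. \<forall>\<^sub>F \<sigma> in U. w \<sigma> t = fun_int M f (map (w \<sigma> \<circ> sec) us))"
    have "\<forall>\<^sub>F \<sigma> in U. w \<sigma> t = fun_int M f (map (w \<sigma> \<circ> sec) us)"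
      unfolding t_def by (rule someI[of _ s]) (rule ex)
    then have "\<forall>\<^sub>F \<sigma> in U. w \<sigma> t = tm_val M (w \<sigma> \<circ> v) (Fun f ts)"
      using us by eventually_elim (simp only: tm_val.simps)
    moreover have "tm_val N (cl \<circ> v) (Fun f ts) = cl t"
      by (simp only: tm_val.simps us_def[symmetric]) (simp add: N_def t_def)
    ultimately show ?case by blast
  qed
  have los: "sat N (cl \<circ> v) \<phi> \<longleftrightarrow> (\<forall>\<^sub>F \<sigma> in U. sat M (w \<sigma> \<circ> v) \<phi>)" if "wf_fm L \<phi>" for v \<phi>
    using that
  proof (induction \<phi> arbitrary: v)
    case (Eq s t)
    from tm_los[of s v] tm_los[of t v] Eq obtain s' t'
      where *: "tm_val N (cl \<circ> v) s = cl s'" "\<forall>\<^sub>F \<sigma> in U. w \<sigma> s' = tm_val M (w \<sigma> \<circ> v) s"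
        "tm_val N (cl \<circ> v) t = cl t'" "\<forall>\<^sub>F \<sigma> in U. w \<sigma> t' = tm_val M (w \<sigma> \<circ> v) t" by auto
    have "\<forall>\<^sub>F \<sigma> in U. w \<sigma> s' = w \<sigma> t' \<longleftrightarrow> sat M (w \<sigma> \<circ> v) (Eq s t)"
      using *(2,4) by eventually_elim simp
    then have "(\<forall>\<^sub>F \<sigma> in U. w \<sigma> s' = w \<sigma> t') \<longleftrightarrow> (\<forall>\<^sub>F \<sigma> in U. sat M (w \<sigma> \<circ> v) (Eq s t))"
      by (rule eventually_cong[OF _ ]) auto
    then show ?case by (simp only: sat.simps *(1,3) cl)
  next
    case (Rel R ts)
    have "\<forall>t\<in>set ts. \<exists>s. tm_val N (cl \<circ> v) t = cl s \<and> (\<forall>\<^sub>F \<sigma> in U. w \<sigma> s = tm_val M (w \<sigma> \<circ> v) t)"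
    proof
      fix t assume "t \<in> set ts"
      then have "wf_tm L t" using Rel.prems by simp
      then show "\<exists>s. tm_val N (cl \<circ> v) t = cl s \<and> (\<forall>\<^sub>F \<sigma> in U. w \<sigma> s = tm_val M (w \<sigma> \<circ> v) t)"
        by (rule tm_los)
    qed
    from bchoice[OF this] obtain S where S: "\<And>t. t \<in> set ts \<Longrightarrow> tm_val N (cl \<circ> v) t = cl (S t)"
      "\<And>t. t \<in> set ts \<Longrightarrow> \<forall>\<^sub>F \<sigma> in U. w \<sigma> (S t) = tm_val M (w \<sigma> \<circ> v) t" by blast
    have "\<forall>\<^sub>F \<sigma> in U. w \<sigma> (sec (tm_val N (cl \<circ> v) t)) = tm_val M (w \<sigma> \<circ> v) t" if t: "t \<in> set ts" for t
      using S(2)[OF t] sec[of "S t"] unfolding S(1)[OF t] by eventually_elim simp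
    then have "\<forall>\<^sub>F \<sigma> in U. \<forall>t\<in>set ts. w \<sigma> (sec (tm_val N (cl \<circ> v) t)) = tm_val M (w \<sigma> \<circ> v) t"
      by (intro eventually_ball_finite) auto
    then have "\<forall>\<^sub>F \<sigma> in U. map (w \<sigma> \<circ> sec) (map (tm_val N (cl \<circ> v)) ts) = map (tm_val M (w \<sigma> \<circ> v)) ts"
      by eventually_elim simp
    then have "\<forall>\<^sub>F \<sigma> in U. rel_int M R (map (w \<sigma> \<circ> sec) (map (tm_val N (cl \<circ> v)) ts)) \<longleftrightarrow>
        sat M (w \<sigma> \<circ> v) (Rel R ts)"
      by eventually_elim (simp only: sat.simps)
    then have *: "(\<forall>\<^sub>F \<sigma> in U. rel_int M R (map (w \<sigma> \<circ> sec) (map (tm_val N (cl \<circ> v)) ts))) \<longleftrightarrow>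
        (\<forall>\<^sub>F \<sigma> in U. sat M (w \<sigma> \<circ> v) (Rel R ts))"
      by (rule eventually_cong[OF _ ]) auto
    have "sat N (cl \<circ> v) (Rel R ts) \<longleftrightarrow>
        (\<forall>\<^sub>F \<sigma> in U. rel_int M R (map (w \<sigma> \<circ> sec) (map (tm_val N (cl \<circ> v)) ts)))"
      by (simp only: sat.simps) (simp only: N_def struc.simps)
    from trans[OF this *] show ?case .
  next
    case (Neg \<phi>)
    then show ?case by (simp add: ultra)
  next
    case (And \<phi> \<psi>)
    then show ?case by (simp add: eventually_conj_iff)
  next
    case (Ex i \<phi>)
    have upd: "cl \<circ> v(i := s) = (cl \<circ> v)(i := cl s)" "w \<sigma> \<circ> v(i := s) = (w \<sigma> \<circ> v)(i := w \<sigma> s)"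
      for s \<sigma> by auto
    have "sat N (cl \<circ> v) (Ex i \<phi>) \<longleftrightarrow> (\<exists>s. sat N (cl \<circ> v(i := s)) \<phi>)"
      unfolding upd by (simp add: N_def)
    also have "\<dots> \<longleftrightarrow> (\<exists>s. \<forall>\<^sub>F \<sigma> in U. sat M (w \<sigma> \<circ> v(i := s)) \<phi>)"
      using Ex.IH Ex.prems by (simp add: comp_def)
    also have "\<dots> \<longleftrightarrow> (\<forall>\<^sub>F \<sigma> in U. sat M (w \<sigma> \<circ> v) (Ex i \<phi>))"
    proof
      assume "\<exists>s. \<forall>\<^sub>F \<sigma> in U. sat M (w \<sigma> \<circ> v(i := s)) \<phi>"
      then obtain s where "\<forall>\<^sub>F \<sigma> in U. sat M (w \<sigma> \<circ> v(i := s)) \<phi>" by blast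
      then show "\<forall>\<^sub>F \<sigma> in U. sat M (w \<sigma> \<circ> v) (Ex i \<phi>)"
        using G
      proof eventually_elim
        case (elim \<sigma>)
        then show ?case using w_in[of \<sigma> s] unfolding upd by auto
      qed
    next
      assume *: "\<forall>\<^sub>F \<sigma> in U. sat M (w \<sigma> \<circ> v) (Ex i \<phi>)"
      obtain s where s: "\<And>\<sigma>. sat M (w \<sigma> \<circ> v) (Ex i \<phi>) \<Longrightarrow> sat M ((w \<sigma> \<circ> v)(i := w \<sigma> s)) \<phi>"
        using skolem[of \<phi> v i] Ex.prems by auto
      have "\<forall>\<^sub>F \<sigma> in U. sat M (w \<sigma> \<circ> v(i := s)) \<phi>"
        using * unfolding upd by eventually_elim (rule s)
      then show "\<exists>s. \<forall>\<^sub>F \<sigma> in U. sat M (w \<sigma> \<circ> v(i := s)) \<phi>" by blast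
    qed
    finally show ?case .
  qed
  show thesis
  proof
    show "is_structure L N"
      by (auto simp: is_structure_def closed_under_def N_def)
    show "range (cl \<circ> Base) \<subseteq> carrier N" by (auto simp: N_def)
    fix \<phi> v assume \<phi>: "(\<phi>, v) \<in> \<Gamma>"
    have "\<forall>\<^sub>F \<sigma> in U. \<sigma> \<in> sol (\<phi>, v)" using U[of "sol (\<phi>, v)"] \<phi> by blast
    then have "\<forall>\<^sub>F \<sigma> in U. sat M (w \<sigma> \<circ> (Base \<circ> v)) \<phi>"
      by eventually_elim (simp add: sol_def w_Base comp_def)
    then show "sat N (cl \<circ> Base \<circ> v) \<phi>"
      using los[OF wf[OF \<phi>], of "Base \<circ> v"] by (simp add: comp_assoc)
  qed
qed

section \<open>Trees of models\<close>

abbreviation leq :: "('a, tree_fun, 'r tree_rel) struc \<Rightarrow> 'a \<Rightarrow> 'a \<Rightarrow> bool" where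
  "leq N a b \<equiv> rel_int N Le [a, b]"

abbreviation below :: "('a, tree_fun, 'r tree_rel) struc \<Rightarrow> 'a \<Rightarrow> 'a \<Rightarrow> bool" where
  "below N a b \<equiv> rel_int N Le [a, b] \<and> a \<noteq> b"

abbreviation mt :: "('a, tree_fun, 'r tree_rel) struc \<Rightarrow> 'a \<Rightarrow> 'a \<Rightarrow> 'a" where
  "mt N a b \<equiv> fun_int N Meet [a, b]"

abbreviation star :: "('a, tree_fun, 'r tree_rel) struc \<Rightarrow> 'r \<Rightarrow> 'a \<Rightarrow> 'a list \<Rightarrow> bool" where
  "star N R x ys \<equiv> rel_int N (Star R) (x # ys)"

text \<open>
  The tree axioms, \<open>WD\<close> and \<open>OC\<close> in semantic form. The axioms that come from \<open>T\<^sub>\<forall>\<close> are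
  treated by \<open>cone_copy_sat\<close>.
\<close>

locale star_tree =
  fixes L :: "('f, 'r) language" and N :: "('a, tree_fun, 'r tree_rel) struc"
  assumes ne: "carrier N \<noteq> {}"
    and mt_in: "x \<in> carrier N \<Longrightarrow> y \<in> carrier N \<Longrightarrow> mt N x y \<in> carrier N"
    and leq_refl: "x \<in> carrier N \<Longrightarrow> leq N x x"
    and leq_antisym: "x \<in> carrier N \<Longrightarrow> y \<in> carrier N \<Longrightarrow> leq N x y \<Longrightarrow> leq N y x \<Longrightarrow> x = y"
    and leq_trans: "x \<in> carrier N \<Longrightarrow> y \<in> carrier N \<Longrightarrow> z \<in> carrier N \<Longrightarrow>
      leq N x y \<Longrightarrow> leq N y z \<Longrightarrow> leq N x z"
    and leq_linear: "x \<in> carrier N \<Longrightarrow> y \<in> carrier N \<Longrightarrow> z \<in> carrier N \<Longrightarrow>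
      leq N y x \<Longrightarrow> leq N z x \<Longrightarrow> leq N y z \<or> leq N z y"
    and mt1: "x \<in> carrier N \<Longrightarrow> y \<in> carrier N \<Longrightarrow> leq N (mt N x y) x"
    and mt2: "x \<in> carrier N \<Longrightarrow> y \<in> carrier N \<Longrightarrow> leq N (mt N x y) y"
    and mt_greatest: "x \<in> carrier N \<Longrightarrow> y \<in> carrier N \<Longrightarrow> z \<in> carrier N \<Longrightarrow>
      leq N z x \<Longrightarrow> leq N z y \<Longrightarrow> leq N z (mt N x y)"
    and WD: "R \<in> rel_syms L \<Longrightarrow> length ys = rel_ar L R \<Longrightarrow> length ys' = rel_ar L R \<Longrightarrow>
      x \<in> carrier N \<Longrightarrow> set ys \<subseteq> carrier N \<Longrightarrow> set ys' \<subseteq> carrier N \<Longrightarrow> star N R x ys \<Longrightarrow>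
      (\<And>i. i < rel_ar L R \<Longrightarrow> below N x (mt N (ys ! i) (ys' ! i))) \<Longrightarrow> star N R x ys'"
    and OC: "R \<in> rel_syms L \<Longrightarrow> length ys = rel_ar L R \<Longrightarrow> x \<in> carrier N \<Longrightarrow>
      set ys \<subseteq> carrier N \<Longrightarrow> star N R x ys \<Longrightarrow> y \<in> set ys \<Longrightarrow> below N x y"

lemma sat_le [simp]: "sat N v (le s t) \<longleftrightarrow> leq N (tm_val N v s) (tm_val N v t)"
  by (simp add: le_def)

lemma sat_lt [simp]: "sat N v (lt s t) \<longleftrightarrow> below N (tm_val N v s) (tm_val N v t)"
  by (simp add: lt_def)

lemma tm_val_meet [simp]: "tm_val N v (meet s t) = mt N (tm_val N v s) (tm_val N v t)"
  by (simp add: meet_def)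

lemma holds_star_axiom:
  "holds N (star_axiom \<psi>) \<longleftrightarrow> (\<forall>v. range v \<subseteq> carrier N \<longrightarrow>
    (\<forall>i\<in>fv \<psi>. below N (v 0) (v (Suc i))) \<longrightarrow> sat N v (star_fm \<psi>))"
  by (simp add: holds_def star_axiom_def finite_fv ball_conj_distrib)

lemma star_lang_simps [simp]:
  "fun_syms (star_lang L) = {Meet}" "rel_syms (star_lang L) = insert Le (Star ` rel_syms L)"
  "fun_ar (star_lang L) f = 2" "rel_ar (star_lang L) Le = 2"
  "rel_ar (star_lang L) (Star R) = Suc (rel_ar L R)"
  by (simp_all add: star_lang_def)

lemma closed_under_star_lang:
  "closed_under (star_lang L) N X \<longleftrightarrow> (\<forall>x\<in>X. \<forall>y\<in>X. mt N x y \<in> X)"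
proof
  assume *: "closed_under (star_lang L) N X"
  show "\<forall>x\<in>X. \<forall>y\<in>X. mt N x y \<in> X"
  proof (intro ballI)
    fix x y assume "x \<in> X" "y \<in> X"
    then show "mt N x y \<in> X"
      using *[unfolded closed_under_def, rule_format, of Meet "[x, y]"] by simp
  qed
next
  assume *: "\<forall>x\<in>X. \<forall>y\<in>X. mt N x y \<in> X"
  show "closed_under (star_lang L) N X"
    unfolding closed_under_def
  proof (intro ballI allI impI)
    fix f as assume "length as = fun_ar (star_lang L) f \<and> set as \<subseteq> X"
    then obtain x y where "as = [x, y]" "x \<in> X" "y \<in> X"
      by (auto simp: numeral_2_eq_2 length_Suc_conv)
    then show "fun_int N f as \<in> X" using * by (cases f) simp
  qed
qed

lemma is_structure_star_lang:
  "is_structure (star_lang L) N \<longleftrightarrow>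
    carrier N \<noteq> {} \<and> (\<forall>x\<in>carrier N. \<forall>y\<in>carrier N. mt N x y \<in> carrier N)"
  by (simp add: is_structure_def closed_under_star_lang)

lemma holdsD: "holds N \<phi> \<Longrightarrow> range v \<subseteq> carrier N \<Longrightarrow> sat N v \<phi>"
  by (simp add: holds_def)

lemma star_tree_if_holds:
  fixes N :: "('a, tree_fun, 'r tree_rel) struc"
  assumes N: "is_structure (star_lang L) N" and T: "\<And>\<phi>. \<phi> \<in> star_theory L U \<Longrightarrow> holds N \<phi>"
  shows "star_tree L N"
proof -
  define v where "v x y z = (\<lambda>i :: nat. if i = 0 then x else if i = 1 then y else z)" for x y z :: 'a
  have v: "v x y z 0 = x" "v x y z (Suc 0) = y" "v x y z 2 = z" for x y z by (simp_all add: v_def)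
  have Tr: "sat N (v x y z) \<phi>" if "\<phi> \<in> Tr" "x \<in> carrier N" "y \<in> carrier N" "z \<in> carrier N" for x y z \<phi>
    by (rule holdsD[OF T]) (use that in \<open>auto simp: star_theory_def v_def\<close>)
  note Tr = Tr[unfolded Tr_def Let_def]
  note N = N[unfolded is_structure_star_lang]
  show ?thesis
  proof
    show "carrier N \<noteq> {}" using N by simp
    fix x y z assume x: "x \<in> carrier N"
    show "leq N x x"
      using Tr[of "le (Var 0) (Var 0)" x x x] x by (simp add: v)
    assume y: "y \<in> carrier N"
    show "mt N x y \<in> carrier N" using N x y by simp
    show "leq N (mt N x y) x"
      using Tr[of "le (meet (Var 0) (Var 1)) (Var 0)" x y x] x y by (simp add: v)
    show "leq N (mt N x y) y"
      using Tr[of "le (meet (Var 0) (Var 1)) (Var 1)" x y x] x y by (simp add: v)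
    show "leq N x y \<Longrightarrow> leq N y x \<Longrightarrow> x = y"
      using Tr[of "Imps [le (Var 0) (Var 1), le (Var 1) (Var 0)] (Eq (Var 0) (Var 1))" x y x] x y
      by (simp add: v)
    assume z: "z \<in> carrier N"
    show "leq N x y \<Longrightarrow> leq N y z \<Longrightarrow> leq N x z"
      using Tr[of "Imps [le (Var 0) (Var 1), le (Var 1) (Var 2)] (le (Var 0) (Var 2))" x y z] x y z
      by (simp add: v)
    show "leq N y x \<Longrightarrow> leq N z x \<Longrightarrow> leq N y z \<or> leq N z y"
      using Tr[of "Imps [le (Var 1) (Var 0), le (Var 2) (Var 0)]
        (Or (le (Var 1) (Var 2)) (le (Var 2) (Var 1)))" x y z] x y z
      by (simp add: v)
    show "leq N z x \<Longrightarrow> leq N z y \<Longrightarrow> leq N z (mt N x y)"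
      using Tr[of "Imps [le (Var 2) (Var 0), le (Var 2) (Var 1)]
        (le (Var 2) (meet (Var 0) (Var 1)))" x y z] x y z
      by (simp add: v)
  next
    fix R ys ys' x
    assume R: "R \<in> rel_syms L" and len: "length ys = rel_ar L R" "length ys' = rel_ar L R"
      and in_N: "x \<in> carrier N" "set ys \<subseteq> carrier N" "set ys' \<subseteq> carrier N"
      and *: "star N R x ys" "\<And>i. i < rel_ar L R \<Longrightarrow> below N x (mt N (ys ! i) (ys' ! i))"
    define n where "n = rel_ar L R"
    define w where "w i = (if i = 0 then x else if i \<le> n then ys ! (i - 1)
      else if i \<le> 2 * n then ys' ! (i - 1 - n) else x)" for i
    have "range w \<subseteq> carrier N"
      using in_N len by (auto simp: w_def n_def subset_iff)
    moreover have "WD n R \<in> star_theory L U" using R by (auto simp: star_theory_def n_def)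
    ultimately have sat: "sat N w (WD n R)" by (intro holdsD[OF T])
    have w: "w 0 = x" "map (\<lambda>i. w (Suc i)) [0..<n] = ys" "map (\<lambda>i. w (Suc (n + i))) [0..<n] = ys'"
      using len by (auto simp: w_def n_def intro!: nth_equalityI)
    have w': "w (Suc i) = ys ! i" "w (Suc (n + i)) = ys' ! i" if "i < n" for i
      using that by (auto simp: w_def)
    show "star N R x ys'"
      using sat * w w' by (simp add: WD_def comp_def n_def[symmetric])
  next
    fix R ys x y
    assume R: "R \<in> rel_syms L" and len: "length ys = rel_ar L R"
      and in_N: "x \<in> carrier N" "set ys \<subseteq> carrier N"
      and *: "star N R x ys" "y \<in> set ys"
    define n where "n = rel_ar L R"
    obtain i where i: "i < n" "ys ! i = y" using *(2) len n_def by (metis in_set_conv_nth)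
    define w where "w i = (if i = 0 then x else if i \<le> n then ys ! (i - 1) else x)" for i
    have "range w \<subseteq> carrier N"
      using in_N len by (auto simp: w_def n_def subset_iff)
    moreover have "OC n R i \<in> star_theory L U" using R i by (auto simp: star_theory_def n_def)
    ultimately have sat: "sat N w (OC n R i)" by (intro holdsD[OF T])
    have w: "w 0 = x" "map (\<lambda>i. w (Suc i)) [0..<n] = ys" "w (Suc i) = y"
      using len i by (auto simp: w_def n_def intro!: nth_equalityI)
    show "below N x y"
      using sat * w by (simp add: OC_def comp_def)
  qed
qed

lemma star_theory_holds_if:
  fixes N :: "('a, tree_fun, 'r tree_rel) struc"
  assumes "star_tree L N" and ax: "\<And>\<psi>. \<psi> \<in> U \<Longrightarrow> holds N (star_axiom \<psi>)"
    and \<phi>: "\<phi> \<in> star_theory L U"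
  shows "holds N \<phi>"
proof -
  interpret star_tree L N by fact
  from \<phi> consider "\<phi> \<in> Tr" | R where "\<phi> = WD (rel_ar L R) R" "R \<in> rel_syms L"
    | R i where "\<phi> = OC (rel_ar L R) R i" "R \<in> rel_syms L" "i < rel_ar L R"
    | \<psi> where "\<psi> \<in> U" "\<phi> = star_axiom \<psi>"
    unfolding star_theory_def by blast
  then show ?thesis
  proof cases
    case 1
    show ?thesis
      unfolding holds_def
    proof (intro allI impI)
      fix v :: "nat \<Rightarrow> 'a" assume "range v \<subseteq> carrier N"
      then have v: "v i \<in> carrier N" for i by auto
      show "sat N v \<phi>"
        using 1 leq_refl[OF v[of 0]] leq_antisym[OF v[of 0] v[of 1]] leq_trans[OF v[of 0] v[of 1] v[of 2]]
          leq_linear[OF v[of 0] v[of 1] v[of 2]] mt1[OF v[of 0] v[of 1]] mt2[OF v[of 0] v[of 1]]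
          mt_greatest[OF v[of 0] v[of 1] v[of 2]]
        unfolding Tr_def Let_def insert_iff empty_iff by (elim disjE) simp_all
    qed
  next
    case (2 R)
    show ?thesis
      unfolding holds_def
    proof (intro allI impI)
      fix v :: "nat \<Rightarrow> 'a" assume "range v \<subseteq> carrier N"
      then have v: "v i \<in> carrier N" for i by auto
      show "sat N v \<phi>"
        unfolding 2(1) WD_def sat_Imps
      proof
        assume *: "\<forall>\<phi>\<in>set (Rel (Star R) (Var 0 # map (\<lambda>i. Var (1 + i)) [0..<rel_ar L R]) #
          map (\<lambda>i. lt (Var 0) (meet (Var (1 + i)) (Var (1 + rel_ar L R + i)))) [0..<rel_ar L R]).
          sat N v \<phi>"
        have "star N R (v 0) (map (\<lambda>i. v (1 + rel_ar L R + i)) [0..<rel_ar L R])"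
          by (rule WD[OF 2(2), of "map (\<lambda>i. v (1 + i)) [0..<rel_ar L R]"])
            (use v * in \<open>auto simp: comp_def\<close>)
        then show "sat N v (Rel (Star R) (Var 0 # map (\<lambda>i. Var (1 + rel_ar L R + i)) [0..<rel_ar L R]))"
          by (simp add: comp_def)
      qed
    qed
  next
    case (3 R i)
    show ?thesis
      unfolding holds_def
    proof (intro allI impI)
      fix v :: "nat \<Rightarrow> 'a" assume "range v \<subseteq> carrier N"
      then have v: "v i \<in> carrier N" for i by auto
      show "sat N v \<phi>"
        unfolding 3(1) OC_def sat_Imp
      proof
        assume "sat N v (Rel (Star R) (Var 0 # map (\<lambda>i. Var (1 + i)) [0..<rel_ar L R]))"
        then have "star N R (v 0) (map (\<lambda>i. v (1 + i)) [0..<rel_ar L R])" by (simp add: comp_def)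
        then have "below N (v 0) (v (1 + i))"
          by (rule OC[OF 3(2), rotated 3]) (use v 3(3) in auto)
        then show "sat N v (lt (Var 0) (Var (1 + i)))" by simp
      qed
    qed
  next
    case 4
    then show ?thesis using ax by simp
  qed
qed

lemma star_tm_wf: "fun_syms L = {} \<Longrightarrow> wf_tm L t \<Longrightarrow> wf_tm L' (star_tm t)"
  by (cases t) auto

lemma star_fm_wf:
  assumes "fun_syms L = {}"
  shows "wf_fm L \<psi> \<Longrightarrow> wf_fm (star_lang L) (star_fm \<psi>)"
  using star_tm_wf[OF assms] by (induction \<psi>) (auto simp: lt_def le_def meet_def)

lemma star_fm_qf: "quantifier_free \<psi> \<Longrightarrow> quantifier_free (star_fm \<psi>)"
  by (induction \<psi>) (auto simp: lt_def le_def)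

text \<open>
  So the theory is universal and passes from the finite models to their Fraisse limit.
\<close>

lemma star_theory_wf_qf:
  assumes L: "finite_relational L" and U: "universal_theory L U" and \<phi>: "\<phi> \<in> star_theory L U"
  shows "wf_fm (star_lang L) \<phi> \<and> quantifier_free \<phi>"
proof -
  have "fun_syms L = {}" using L by (simp add: finite_relational_def)
  then show ?thesis
    using \<phi> U unfolding star_theory_def universal_theory_def
    by (auto simp: Tr_def Let_def WD_def OC_def star_axiom_def lt_def le_def meet_def Or_def
        star_fm_wf star_fm_qf)
qed

text \<open>
  Without constants and nullary relations there are no quantifier-free sentences. Hence
  \<open>star_axiom \<psi>\<close> has premises, and these force the root variable to lie below something.
\<close>

lemma relational_qf_fv:
  assumes "finite_relational L"
  shows "wf_fm L \<psi> \<Longrightarrow> quantifier_free \<psi> \<Longrightarrow> fv \<psi> \<noteq> {}"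
proof (induction \<psi>)
  case (Eq s t)
  then show ?case using assms by (cases s) (auto simp: finite_relational_def)
next
  case (Rel R ts)
  then have "ts \<noteq> []" using assms by (auto simp: finite_relational_def)
  moreover have "\<forall>t\<in>set ts. tm_vars t \<noteq> {}"
  proof
    fix t assume "t \<in> set ts"
    then have "wf_tm L t" using Rel by auto
    then show "tm_vars t \<noteq> {}" using assms by (cases t) (auto simp: finite_relational_def)
  qed
  ultimately show ?case by (cases ts) auto
qed auto

text \<open>
  The points above \<open>c\<close>, up to the equivalence of having a meet above \<open>c\<close>, form an
  \<open>L\<close>-structure under the relations \<open>R\<^sup>*(c, \<dots>)\<close>. Here \<open>Y\<close> embeds \<open>S\<close> into it.
\<close>

definition cone_copy ::
  "('f, 'r) language \<Rightarrow> ('x, 'f, 'r) struc \<Rightarrow> ('a, tree_fun, 'r tree_rel) struc \<Rightarrow> 'a \<Rightarrow> ('x \<Rightarrow> 'a)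
    \<Rightarrow> bool" where
  "cone_copy L S N c Y \<longleftrightarrow> c \<in> carrier N \<and> Y ` carrier S \<subseteq> carrier N \<and>
    (\<forall>x\<in>carrier S. below N c (Y x)) \<and>
    (\<forall>x\<in>carrier S. \<forall>y\<in>carrier S. below N c (mt N (Y x) (Y y)) \<longleftrightarrow> x = y) \<and>
    (\<forall>R\<in>rel_syms L. \<forall>xs. tuple S (rel_ar L R) xs \<longrightarrow> (star N R c (map Y xs) \<longleftrightarrow> rel_int S R xs))"

lemma cone_copy_star:
  assumes "cone_copy L S N c Y" "R \<in> rel_syms L" "tuple S (rel_ar L R) xs"
  shows "star N R c (map Y xs) \<longleftrightarrow> rel_int S R xs"
  using assms by (simp add: cone_copy_def)

text \<open>
  The formula \<open>\<psi>\<^sup>*(c, y)\<close> was designed to say that \<open>\<psi>\<close> holds in the structure on the cone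
  above \<open>c\<close>.
\<close>

lemma cone_copy_sat:
  assumes C: "cone_copy L S N c Y" and L: "fun_syms L = {}"
  shows "wf_fm L \<psi> \<Longrightarrow> quantifier_free \<psi> \<Longrightarrow> w 0 = c \<Longrightarrow>
    (\<And>i. i \<in> fv \<psi> \<Longrightarrow> v i \<in> carrier S \<and> w (Suc i) = Y (v i)) \<Longrightarrow>
    sat N w (star_fm \<psi>) \<longleftrightarrow> sat S v \<psi>"
proof (induction \<psi>)
  case (Eq s t)
  then obtain i j where ij: "s = Var i" "t = Var j" using L by (cases s; cases t) auto
  then show ?case using C Eq.prems(3,4) by (auto simp: cone_copy_def)
next
  case (Rel R ts)
  have "\<exists>i. t = Var i" if "t \<in> set ts" for t
  proof -
    have "wf_tm L t" using that Rel.prems(1) by simp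
    then show ?thesis using L by (cases t) auto
  qed
  then have "\<exists>i. \<forall>t\<in>set ts. t = Var (i t)" by metis
  then obtain f where f: "\<And>t. t \<in> set ts \<Longrightarrow> t = Var (f t)" by auto
  define ks where "ks = map f ts"
  have ts: "ts = map Var ks" unfolding ks_def map_map using f by (auto intro!: map_idI[symmetric])
  have "tuple S (rel_ar L R) (map v ks)"
    using Rel.prems by (auto simp: tuple_def ts)
  moreover have w: "map (\<lambda>i. w (Suc i)) ks = map Y (map v ks)"
    using Rel.prems(4) by (auto simp: ts)
  moreover have "R \<in> rel_syms L" using Rel.prems by simp
  ultimately have "star N R c (map (\<lambda>i. w (Suc i)) ks) \<longleftrightarrow> rel_int S R (map v ks)"
    unfolding w using cone_copy_star[OF C] by blast
  then show ?case using Rel.prems(3) by (simp add: ts comp_def)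
qed auto

text \<open>
  The simplest tree of models: one root \<open>0\<close>, and the points of \<open>A\<close> as pairwise incomparable leaves
  directly above it.
\<close>

definition bouquet :: "(nat, 'f, 'r) struc \<Rightarrow> (nat, tree_fun, 'r tree_rel) struc" where
  "bouquet A = \<lparr>carrier = insert 0 (Suc ` carrier A),
    fun_int = (\<lambda>_ as. if as ! 0 = as ! 1 then as ! 0 else 0),
    rel_int = (\<lambda>S as. case S of Le \<Rightarrow> as ! 0 = 0 \<or> as ! 0 = as ! 1
      | Star R \<Rightarrow> hd as = 0 \<and> 0 \<notin> set (tl as) \<and> rel_int A R (map (\<lambda>x. x - 1) (tl as)))\<rparr>"

lemma bouquet_simps [simp]:
  "carrier (bouquet A) = insert 0 (Suc ` carrier A)"
  "leq (bouquet A) x y \<longleftrightarrow> x = 0 \<or> x = y"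
  "mt (bouquet A) x y = (if x = y then x else 0)"
  "star (bouquet A) R x ys \<longleftrightarrow> x = 0 \<and> 0 \<notin> set ys \<and> rel_int A R (map (\<lambda>x. x - 1) ys)"
  by (auto simp: bouquet_def)

lemma star_tree_bouquet: "star_tree L (bouquet A)"
proof
  fix R ys ys' and x :: nat
  assume len: "length ys = rel_ar L R" "length ys' = rel_ar L R"
    and s: "star (bouquet A) R x ys"
    and *: "\<And>i. i < rel_ar L R \<Longrightarrow> below (bouquet A) x (mt (bouquet A) (ys ! i) (ys' ! i))"
  have "ys = ys'"
  proof (rule nth_equalityI)
    fix i assume "i < length ys"
    then show "ys ! i = ys' ! i" using *[of i] len s by (auto split: if_splits)
  qed (simp add: len)
  then show "star (bouquet A) R x ys'" using s by simp
next
  fix R and ys :: "nat list" and x y :: nat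
  assume s: "star (bouquet A) R x ys" and y: "y \<in> set ys"
  then have "x = 0" "0 \<notin> set ys" by (auto simp del: One_nat_def)
  then show "below (bouquet A) x y" using y by (cases y) auto
qed (auto split: if_splits)

lemma cone_copy_bouquet: "cone_copy L A (bouquet A) 0 Suc"
  unfolding cone_copy_def by (auto simp: comp_def)

text \<open>
  A premise \<open>x < y\<close> forces \<open>x\<close> to be the root, where the axiom says that \<open>A\<close> satisfies \<open>\<psi>\<close>.
\<close>

lemma bouquet_in_finite_models:
  assumes L: "finite_relational L" and U: "universal_theory L U"
    and A: "A \<in> finite_models L U"
  shows "bouquet A \<in> finite_models (star_lang L) (star_theory L U)"
proof -
  have fs: "fun_syms L = {}" using L by (simp add: finite_relational_def)
  have "holds (bouquet A) (star_axiom \<psi>)" if \<psi>: "\<psi> \<in> U" for \<psi>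
    unfolding holds_star_axiom
  proof (intro allI impI)
    fix v :: "nat \<Rightarrow> nat"
    assume v: "range v \<subseteq> carrier (bouquet A)"
      and *: "\<forall>i\<in>fv \<psi>. below (bouquet A) (v 0) (v (Suc i))"
    have wf: "wf_fm L \<psi>" "quantifier_free \<psi>" using \<psi> U by (auto simp: universal_theory_def)
    obtain i0 where i0: "i0 \<in> fv \<psi>" using relational_qf_fv[OF L wf] by auto
    have v0: "v 0 = 0" using * i0 by auto
    have vs: "v (Suc i) - 1 \<in> carrier A \<and> v (Suc i) = Suc (v (Suc i) - 1)" if "i \<in> fv \<psi>" for i
    proof -
      have "v (Suc i) \<noteq> 0" using * that v0 by auto
      moreover have "v (Suc i) \<in> insert 0 (Suc ` carrier A)" using v by auto
      ultimately show ?thesis by auto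
    qed
    define u where "u i = (if i \<in> fv \<psi> then v (Suc i) - 1 else v (Suc i0) - 1)" for i
    have u: "range u \<subseteq> carrier A" using vs i0 by (auto simp: u_def)
    have "holds A \<psi>" using A \<psi> by (auto simp: finite_models_def models_def)
    then have "sat A u \<psi>" using u by (rule holdsD)
    moreover have "u i \<in> carrier A \<and> v (Suc i) = Suc (u i)" if "i \<in> fv \<psi>" for i
      using vs[OF that] that by (simp add: u_def)
    ultimately show "sat (bouquet A) v (star_fm \<psi>)"
      using cone_copy_sat[where w = v and v = u, OF cone_copy_bouquet fs wf v0] by blast
  qed
  then have "holds (bouquet A) \<phi>" if "\<phi> \<in> star_theory L U" for \<phi>
    using star_theory_holds_if[OF star_tree_bouquet _ that] by blast
  moreover have "is_structure (star_lang L) (bouquet A)"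
    by (simp add: is_structure_star_lang)
  moreover have "finite (carrier (bouquet A))" using A by (simp add: finite_models_def)
  ultimately show ?thesis by (simp add: finite_models_def models_def)
qed

context star_tree
begin

lemma is_structure: "is_structure (star_lang L) N"
  using ne mt_in by (simp add: is_structure_star_lang)

lemma mt_idem: "x \<in> carrier N \<Longrightarrow> mt N x x = x"
  using mt1 mt_greatest leq_refl leq_antisym mt_in by metis

lemma mt_eq_left: "x \<in> carrier N \<Longrightarrow> y \<in> carrier N \<Longrightarrow> leq N x y \<Longrightarrow> mt N x y = x"
  using mt1 mt_greatest leq_refl leq_antisym mt_in by metis

lemma mt_commute: "x \<in> carrier N \<Longrightarrow> y \<in> carrier N \<Longrightarrow> mt N x y = mt N y x"
  by (intro leq_antisym mt_greatest mt_in mt1 mt2)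

lemma leq_mt_iff:
  "x \<in> carrier N \<Longrightarrow> y \<in> carrier N \<Longrightarrow> z \<in> carrier N \<Longrightarrow>
    leq N z (mt N x y) \<longleftrightarrow> leq N z x \<and> leq N z y"
  using mt1[of x y] mt2[of x y] mt_greatest[of x y z] leq_trans[of z "mt N x y" x]
    leq_trans[of z "mt N x y" y] mt_in[of x y] by blast

lemma less_leq_trans:
  "x \<in> carrier N \<Longrightarrow> y \<in> carrier N \<Longrightarrow> z \<in> carrier N \<Longrightarrow> below N x y \<Longrightarrow> leq N y z \<Longrightarrow> below N x z"
  using leq_trans[of x y z] leq_antisym[of x y] by blast

lemma leq_less_trans:
  "x \<in> carrier N \<Longrightarrow> y \<in> carrier N \<Longrightarrow> z \<in> carrier N \<Longrightarrow> leq N x y \<Longrightarrow> below N y z \<Longrightarrow> below N x z"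
  using leq_trans[of x y z] leq_antisym[of y z] by blast

text \<open>
  The meets of \<open>x\<close> with \<open>y\<close>, \<open>z\<close> and \<open>w\<close> lie in the chain below \<open>x\<close>, and the least of the three
  is the meet of all four points. So the pairwise meets of a finite set are closed under meets, and
  trees are locally finite.
\<close>

lemma mt_of_mts:
  assumes "x \<in> carrier N" "y \<in> carrier N" "z \<in> carrier N" "w \<in> carrier N"
  shows "\<exists>u\<in>{y, z, w}. mt N (mt N x y) (mt N z w) = mt N x u"
proof -
  note m = mt_in[OF assms(1)]
  have lin: "leq N (mt N x a) (mt N x b) \<or> leq N (mt N x b) (mt N x a)"
    if "a \<in> carrier N" "b \<in> carrier N" for a b
    using leq_linear[OF assms(1) m[OF that(1)] m[OF that(2)]] mt1 assms(1) that by blast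
  have tr: "leq N (mt N x a) (mt N x b) \<Longrightarrow> leq N (mt N x b) (mt N x d) \<Longrightarrow> leq N (mt N x a) (mt N x d)"
    if "a \<in> carrier N" "b \<in> carrier N" "d \<in> carrier N" for a b d
    using leq_trans[OF m[OF that(1)] m[OF that(2)] m[OF that(3)]] .
  have rf: "leq N (mt N x a) (mt N x a)" if "a \<in> carrier N" for a
    using leq_refl[OF m[OF that]] .
  obtain u where u: "u \<in> {y, z, w}" "leq N (mt N x u) (mt N x y)"
    "leq N (mt N x u) (mt N x z)" "leq N (mt N x u) (mt N x w)"
  proof (cases "leq N (mt N x y) (mt N x z)")
    case yz: True
    show ?thesis
    proof (cases "leq N (mt N x y) (mt N x w)")
      case True
      then show ?thesis using that[of y] yz rf[OF assms(2)] by simp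
    next
      case False
      then have wy: "leq N (mt N x w) (mt N x y)" using lin[OF assms(2,4)] by simp
      then show ?thesis using that[of w] tr[OF assms(4,2,3) wy yz] rf[OF assms(4)] by simp
    qed
  next
    case False
    then have zy: "leq N (mt N x z) (mt N x y)" using lin[OF assms(2,3)] by simp
    show ?thesis
    proof (cases "leq N (mt N x z) (mt N x w)")
      case True
      then show ?thesis using that[of z] zy rf[OF assms(3)] by simp
    next
      case False
      then have wz: "leq N (mt N x w) (mt N x z)" using lin[OF assms(3,4)] by simp
      then show ?thesis using that[of w] tr[OF assms(4,3,2) wz zy] rf[OF assms(4)] by simp
    qed
  qed
  have u': "u \<in> carrier N" "mt N x u \<in> carrier N" using u(1) assms m by auto
  have le: "leq N (mt N x u) x \<and> leq N (mt N x u) y \<and> leq N (mt N x u) z \<and> leq N (mt N x u) w"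
    using u u' assms leq_mt_iff by auto
  let ?m = "mt N (mt N x y) (mt N z w)"
  have in_N: "mt N x y \<in> carrier N" "mt N z w \<in> carrier N" "?m \<in> carrier N"
    using assms mt_in by auto
  have "leq N (mt N x u) ?m" using le u' in_N assms leq_mt_iff by auto
  moreover have "leq N ?m (mt N x y)" "leq N ?m (mt N z w)" using in_N mt1 mt2 by auto
  then have "leq N ?m x \<and> leq N ?m y \<and> leq N ?m z \<and> leq N ?m w" using in_N assms leq_mt_iff by auto
  then have "leq N ?m (mt N x u)" using u(1) u' in_N assms leq_mt_iff by auto
  ultimately have "?m = mt N x u" using leq_antisym in_N u' by blast
  then show ?thesis using u(1) by blast
qed

lemma locally_finite: "locally_finite (star_lang L) N"
  unfolding locally_finite_def
proof (intro allI impI, elim conjE)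
  fix P X assume P: "P \<subseteq> carrier N" "closed_under (star_lang L) N P" and X: "finite X" "X \<subseteq> P"
  define Y where "Y = (\<lambda>(x, y). mt N x y) ` (X \<times> X)"
  have "finite Y" using X by (simp add: Y_def)
  moreover have "X \<subseteq> Y"
  proof
    fix x assume "x \<in> X"
    then show "x \<in> Y" using mt_idem[of x] P X by (force simp: Y_def)
  qed
  moreover have "Y \<subseteq> P" using P(2) X(2) by (auto simp: Y_def closed_under_star_lang)
  moreover have "closed_under (star_lang L) N Y"
    unfolding closed_under_star_lang
  proof (intro ballI)
    fix a b assume "a \<in> Y" "b \<in> Y"
    then obtain x y z w where xs: "x \<in> X" "y \<in> X" "z \<in> X" "w \<in> X" "a = mt N x y" "b = mt N z w"
      by (auto simp: Y_def)
    then obtain u where "u \<in> {y, z, w}" "mt N a b = mt N x u"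
      using mt_of_mts[of x y z w] X P by blast
    then show "mt N a b \<in> Y" using xs by (auto simp: Y_def)
  qed
  ultimately show "\<exists>Y. finite Y \<and> X \<subseteq> Y \<and> Y \<subseteq> P \<and> closed_under (star_lang L) N Y" by blast
qed

end

section \<open>Cones and branches\<close>

context star_tree
begin

lemma leq_iff_mt: "x \<in> carrier N \<Longrightarrow> y \<in> carrier N \<Longrightarrow> leq N x y \<longleftrightarrow> mt N x y = x"
  using mt_eq_left[of x y] mt2[of x y] by auto

end

text \<open>
  The order need not be checked, since \<open>x \<le> y\<close> means \<open>x \<and> y = x\<close>.
\<close>

lemma star_embeddingI:
  fixes N :: "('a, tree_fun, 'r tree_rel) struc" and N' :: "('b, tree_fun, 'r tree_rel) struc"
  assumes trees: "star_tree L N" "star_tree L N'"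
    and P: "P \<subseteq> carrier N" "\<And>x y. x \<in> P \<Longrightarrow> y \<in> P \<Longrightarrow> mt N x y \<in> P"
    and h: "h ` P \<subseteq> carrier N'" "inj_on h P"
    and meets: "\<And>x y. x \<in> P \<Longrightarrow> y \<in> P \<Longrightarrow> h (mt N x y) = mt N' (h x) (h y)"
    and stars: "\<And>R w ys. R \<in> rel_syms L \<Longrightarrow> length ys = rel_ar L R \<Longrightarrow> w \<in> P \<Longrightarrow> set ys \<subseteq> P \<Longrightarrow>
      star N R w ys \<longleftrightarrow> star N' R (h w) (map h ys)"
  shows "embedding (star_lang L) (restr N P) N' h"
  unfolding embedding_def
proof (intro conjI ballI allI impI)
  show "h ` carrier (restr N P) \<subseteq> carrier N'" "inj_on h (carrier (restr N P))"
    using h by auto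
next
  fix f as assume "tuple (restr N P) (fun_ar (star_lang L) f) as"
  then obtain x y where "as = [x, y]" "x \<in> P" "y \<in> P"
    by (auto simp: tuple_def numeral_2_eq_2 length_Suc_conv)
  then show "h (fun_int (restr N P) f as) = fun_int N' f (map h as)"
    using meets by (cases f) simp
next
  fix S as assume S: "S \<in> rel_syms (star_lang L)" and as: "tuple (restr N P) (rel_ar (star_lang L) S) as"
  show "rel_int (restr N P) S as \<longleftrightarrow> rel_int N' S (map h as)"
  proof (cases S)
    case Le
    then obtain x y where xy: "as = [x, y]" "x \<in> P" "y \<in> P"
      using as by (auto simp: tuple_def numeral_2_eq_2 length_Suc_conv)
    have in_N: "x \<in> carrier N" "y \<in> carrier N" "h x \<in> carrier N'" "h y \<in> carrier N'"
      using xy P(1) h(1) by auto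
    have "leq N x y \<longleftrightarrow> mt N x y = x" by (rule star_tree.leq_iff_mt[OF trees(1) in_N(1,2)])
    also have "\<dots> \<longleftrightarrow> h (mt N x y) = h x"
      using inj_on_eq_iff[OF h(2) P(2)[OF xy(2,3)] xy(2)] by simp
    also have "\<dots> \<longleftrightarrow> leq N' (h x) (h y)"
      using star_tree.leq_iff_mt[OF trees(2) in_N(3,4)] meets[OF xy(2,3)] by simp
    finally show ?thesis using Le xy(1) by simp
  next
    case (Star R)
    then obtain w ys where "as = w # ys" "w \<in> P" "set ys \<subseteq> P" "length ys = rel_ar L R"
      using as by (cases as) (auto simp: tuple_def)
    then show ?thesis using stars[of R ys w] Star S by auto
  qed
qed

context star_tree
begin

lemma star_irrefl:
  assumes "R \<in> rel_syms L" "rel_ar L R > 0" "length ys = rel_ar L R" "x \<in> carrier N" "set ys \<subseteq> {x}"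
  shows "\<not> star N R x ys"
proof
  assume s: "star N R x ys"
  have "ys \<noteq> []" using assms by auto
  then have "x \<in> set ys" using assms(5) by (cases ys) auto
  then show False using OC[OF assms(1,3,4) _ s, of x] assms(4,5) by auto
qed

text \<open>
  A point outside the cone above \<open>c\<close> meets all points of that cone in the same point.
\<close>

lemma mt_below_cone:
  assumes "c \<in> carrier N" "d \<in> carrier N" "z \<in> carrier N" "leq N c z" "\<not> leq N c d"
  shows "mt N d z = mt N d c"
proof -
  have m: "mt N d z \<in> carrier N" "mt N d c \<in> carrier N" using assms mt_in by auto
  have "leq N (mt N d z) c \<or> leq N c (mt N d z)"
    using leq_linear[OF assms(3) m(1) assms(1)] mt2[OF assms(2,3)] assms(4) by simp
  moreover have "\<not> leq N c (mt N d z)" using leq_mt_iff[OF assms(2,3,1)] assms(5) by simp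
  ultimately have "leq N (mt N d z) (mt N d c)"
    using leq_mt_iff[OF assms(2,1) m(1)] mt1[OF assms(2,3)] by simp
  moreover have "leq N (mt N d c) (mt N d z)"
    using leq_mt_iff[OF assms(2,3) m(2)] mt1[OF assms(2,1)] mt2[OF assms(2,1)]
      leq_trans[OF m(2) assms(1,3)] assms(4) by simp
  ultimately show ?thesis by (rule leq_antisym[OF m])
qed

text \<open>
  If \<open>w\<close> is not in the cone above \<open>c\<close> but below a point of it, then \<open>w < c\<close>, and all points of the
  cone are equivalent for the relations at \<open>w\<close>. This is what well-definedness is for.
\<close>

lemma star_move:
  assumes R: "R \<in> rel_syms L" and len: "length ys = rel_ar L R" "length ys' = rel_ar L R"
    and in_N: "c \<in> carrier N" "w \<in> carrier N" "set ys \<subseteq> carrier N" "set ys' \<subseteq> carrier N"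
    and w: "\<not> leq N c w" and s: "star N R w ys"
    and move: "\<And>i. i < rel_ar L R \<Longrightarrow> ys ! i = ys' ! i \<or> leq N c (ys ! i) \<and> leq N c (ys' ! i)"
  shows "star N R w ys'"
proof (rule WD[OF R len in_N(2-4) s])
  fix i assume i: "i < rel_ar L R"
  have y: "ys ! i \<in> carrier N" "ys' ! i \<in> carrier N" "ys ! i \<in> set ys"
    using i len in_N nth_mem[of i ys] nth_mem[of i ys'] by auto
  have wy: "below N w (ys ! i)" by (rule OC[OF R len(1) in_N(2,3) s y(3)])
  from move[OF i] show "below N w (mt N (ys ! i) (ys' ! i))"
  proof
    assume "ys ! i = ys' ! i"
    then show ?thesis using wy mt_idem[OF y(1)] by simp
  next
    assume *: "leq N c (ys ! i) \<and> leq N c (ys' ! i)"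
    then have "leq N w c" using leq_linear[OF y(1) in_N(2,1)] wy w by blast
    moreover have "w \<noteq> c" using w leq_refl[OF in_N(1)] by auto
    moreover have "leq N c (mt N (ys ! i) (ys' ! i))" using * leq_mt_iff[OF y(1,2) in_N(1)] by simp
    ultimately show ?thesis using less_leq_trans[OF in_N(2,1) mt_in[OF y(1,2)]] by simp
  qed
qed

text \<open>
  The cone above \<open>c\<close> consists of all points \<open>x\<close> with \<open>c \<le> x\<close>. From outside, the cone above \<open>c\<close> looks like a single point, by \<open>mt_below_cone\<close> and \<open>star_move\<close>.
  From inside, nothing outside is visible either: relations at a point of the cone only hold of points
  above it. So a partial isomorphism of the cone can be glued to the identity outside.
\<close>

lemma
  fixes h Z c
  defines "H \<equiv> \<lambda>x. if leq N c x then h x else x"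
    and "P \<equiv> {d \<in> carrier N. \<not> leq N c d} \<union> Z"
  assumes ar: "\<And>R. R \<in> rel_syms L \<Longrightarrow> rel_ar L R > 0" and c: "c \<in> carrier N"
    and Z: "Z \<subseteq> carrier N" "\<And>z. z \<in> Z \<Longrightarrow> leq N c z" "closed_under (star_lang L) N Z"
    and h: "embedding (star_lang L) (restr N Z) N h" "\<And>z. z \<in> Z \<Longrightarrow> leq N c (h z)"
  shows cone_closed: "closed_under (star_lang L) N P"
    and cone_embedding: "embedding (star_lang L) (restr N P) N H"
proof -
  have PN: "P \<subseteq> carrier N" using Z by (auto simp: P_def)
  have Hh: "H z = h z" if "z \<in> Z" for z using Z that by (simp add: H_def)
  have Hd: "H d = d" if "\<not> leq N c d" for d using that by (simp add: H_def)
  have PZ: "x \<in> Z" if "x \<in> P" "leq N c x" for x using that by (auto simp: P_def)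
  have HN: "H x \<in> carrier N" if "x \<in> P" for x
    using that embedding_into[OF h(1), of x] PN Hh PZ by (cases "leq N c x") (auto simp: Hd)
  have Hc: "leq N c (H x) \<longleftrightarrow> leq N c x" if "x \<in> P" for x
    using that PZ[of x] h(2)[of x] Hh[of x] by (cases "leq N c x") (auto simp: Hd)
  have Zm: "mt N x y \<in> Z" if "x \<in> Z" "y \<in> Z" for x y
    using Z(3) that by (simp add: closed_under_star_lang)
  have low: "\<not> leq N c (mt N x y)" if "x \<in> carrier N" "y \<in> carrier N" "\<not> leq N c x \<or> \<not> leq N c y" for x y
    using leq_mt_iff[OF that(1,2) c] that(3) by simp
  have mP: "mt N x y \<in> P" if "x \<in> P" "y \<in> P" for x y
  proof (cases "x \<in> Z \<and> y \<in> Z")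
    case True
    then show ?thesis using Zm by (simp add: P_def)
  next
    case False
    then have "\<not> leq N c x \<or> \<not> leq N c y" using PZ that by blast
    then have "\<not> leq N c (mt N x y)" using low that PN by blast
    moreover have "mt N x y \<in> carrier N" using mt_in that PN by blast
    ultimately show ?thesis by (simp add: P_def)
  qed
  show "closed_under (star_lang L) N P" using mP by (simp add: closed_under_star_lang)
  have Hm: "H (mt N x y) = mt N (H x) (H y)" if xy: "x \<in> P" "y \<in> P" for x y
  proof -
    have N: "x \<in> carrier N" "y \<in> carrier N" "H x \<in> carrier N" "H y \<in> carrier N"
      using xy PN HN by auto
    consider "leq N c x" "leq N c y" | "\<not> leq N c x" "\<not> leq N c y"
      | "\<not> leq N c x" "leq N c y" | "leq N c x" "\<not> leq N c y" by blast
    then show ?thesis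
    proof cases
      case 1
      then have Zxy: "x \<in> Z" "y \<in> Z" using PZ xy by auto
      have "h (mt N x y) = mt N (h x) (h y)"
        using embedding_fun[OF h(1), of Meet "[x, y]"] Zxy by (simp add: tuple_def)
      then show ?thesis using Hh Zxy Zm by simp
    next
      case 2
      then show ?thesis using Hd low[OF N(1,2)] by simp
    next
      case 3
      have "mt N x (H y) = mt N x c" "mt N x y = mt N x c"
        using mt_below_cone[OF c N(1,4) _ 3(1)] mt_below_cone[OF c N(1,2) 3(2,1)] Hc[OF xy(2)] 3 by auto
      then show ?thesis using Hd low[OF N(1,2)] 3 by simp
    next
      case 4
      have "mt N y (H x) = mt N y c" "mt N y x = mt N y c"
        using mt_below_cone[OF c N(2,3) _ 4(2)] mt_below_cone[OF c N(2,1) 4] Hc[OF xy(1)] 4 by auto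
      then show ?thesis
        using Hd low[OF N(1,2)] 4 mt_commute[OF N(1,2)] mt_commute[OF N(3,2)] by simp
    qed
  qed
  have inj: "inj_on H P"
  proof (rule inj_onI)
    fix x y assume xy: "x \<in> P" "y \<in> P" "H x = H y"
    then have "leq N c x \<longleftrightarrow> leq N c y" using Hc by metis
    then show "x = y"
      using xy PZ Hh Hd embedding_inj[OF h(1)] by (cases "leq N c x") (auto dest: inj_onD)
  qed
  show "embedding (star_lang L) (restr N P) N H"
  proof (rule star_embeddingI[OF star_tree_axioms star_tree_axioms PN])
    show "H ` P \<subseteq> carrier N" using HN by auto
    show "inj_on H P" by (rule inj)
    show "\<And>x y. x \<in> P \<Longrightarrow> y \<in> P \<Longrightarrow> mt N x y \<in> P" by (rule mP)
    show "\<And>x y. x \<in> P \<Longrightarrow> y \<in> P \<Longrightarrow> H (mt N x y) = mt N (H x) (H y)" by (rule Hm)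
  next
    fix R w ys assume R: "R \<in> rel_syms L" and len: "length ys = rel_ar L R" and w: "w \<in> P"
      and ys: "set ys \<subseteq> P"
    have len': "length (map H ys) = rel_ar L R" using len by simp
    have yN: "set ys \<subseteq> carrier N" "set (map H ys) \<subseteq> carrier N" "w \<in> carrier N" "H w \<in> carrier N"
      using ys w PN HN by auto
    show "star N R w ys \<longleftrightarrow> star N R (H w) (map H ys)"
    proof (cases "leq N c w")
      case False
      have mv: "ys ! i = map H ys ! i \<or> leq N c (ys ! i) \<and> leq N c (map H ys ! i)"
        if "i < rel_ar L R" for i
      proof (cases "leq N c (ys ! i)")
        case True
        have "ys ! i \<in> P" using that len ys nth_mem[of i ys] by auto
        then show ?thesis using Hc[of "ys ! i"] True that len by simp
      qed (simp add: Hd that len)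
      then have mv': "map H ys ! i = ys ! i \<or> leq N c (map H ys ! i) \<and> leq N c (ys ! i)"
        if "i < rel_ar L R" for i using that by metis
      show ?thesis
        unfolding Hd[OF False]
        using star_move[OF R len len' c yN(3,1,2) False _ mv]
          star_move[OF R len' len c yN(3,2,1) False _ mv'] by blast
    next
      case True
      then have wZ: "w \<in> Z" "H w = h w" using PZ w Hh by auto
      have "set ys \<subseteq> Z" if "star N R w ys"
      proof
        fix y assume y: "y \<in> set ys"
        have "leq N w y" using OC[OF R len yN(3,1) that y] by simp
        then have "leq N c y" using leq_trans[OF c yN(3)] True yN(1) y by blast
        then show "y \<in> Z" using PZ ys y by blast
      qed
      moreover have "set ys \<subseteq> Z" if "star N R (H w) (map H ys)"
      proof
        fix y assume y: "y \<in> set ys"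
        have "leq N (H w) (H y)" using OC[OF R len' yN(4,2) that] y by simp
        moreover have "H y \<in> carrier N" using HN ys y by blast
        ultimately have "leq N c (H y)" using leq_trans[OF c yN(4)] Hc[OF w] True by blast
        then show "y \<in> Z" using PZ ys y Hc by blast
      qed
      moreover have "star N R w ys \<longleftrightarrow> star N R (H w) (map H ys)" if "set ys \<subseteq> Z"
      proof -
        have m: "map H ys = map h ys" using that Hh by auto
        have "tuple (restr N Z) (rel_ar (star_lang L) (Star R)) (w # ys)"
          using that wZ len by (simp add: tuple_def)
        from embedding_rel[OF h(1) _ this] show ?thesis using R unfolding m wZ(2) by simp
      qed
      ultimately show ?thesis by blast
    qed
  qed
qed

lemma branchD:
  assumes "branch N B"
  shows branch_subset: "B \<subseteq> carrier N"
    and branch_total: "x \<in> B \<Longrightarrow> y \<in> B \<Longrightarrow> leq N x y \<or> leq N y x"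
    and branch_maximal: "y \<in> carrier N \<Longrightarrow> (\<And>b. b \<in> B \<Longrightarrow> leq N b y \<or> leq N y b) \<Longrightarrow> y \<in> B"
proof -
  note B = assms[unfolded branch_def pred_on.maxchain_def]
  show sub: "B \<subseteq> carrier N" using B by (auto simp: pred_on.chain_def)
  have tot: "leq N x y \<or> leq N y x" if "x \<in> B" "y \<in> B" for x y
    using B that sub leq_refl[of x] by (auto simp: pred_on.chain_def)
  then show "x \<in> B \<Longrightarrow> y \<in> B \<Longrightarrow> leq N x y \<or> leq N y x" .
  assume y: "y \<in> carrier N" "\<And>b. b \<in> B \<Longrightarrow> leq N b y \<or> leq N y b"
  have "pred_on.chain (carrier N) (\<lambda>a b. leq N a b) (insert y B)"
    unfolding pred_on.chain_def using y sub tot by auto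
  then show "y \<in> B" using B by (metis insertI1 psubsetI subset_insertI)
qed

end

lemma single_point_embedding:
  assumes trees: "star_tree L N" "star_tree L N'" and ar: "\<And>R. R \<in> rel_syms L \<Longrightarrow> rel_ar L R > 0"
    and xy: "x \<in> carrier N" "y \<in> carrier N'"
  shows "embedding (star_lang L) (restr N {x}) N' (\<lambda>_. y)"
proof (rule star_embeddingI[OF trees])
  fix R w ys
  assume R: "R \<in> rel_syms L" "length ys = rel_ar L R" "w \<in> {x}" "set ys \<subseteq> {x}"
  then have "\<not> star N R w ys" "\<not> star N' R y (map (\<lambda>_. y) ys)"
    using star_tree.star_irrefl[OF trees(1) R(1) ar[OF R(1)] R(2) xy(1)]
      star_tree.star_irrefl[OF trees(2) R(1) ar[OF R(1)] _ xy(2), of "map (\<lambda>_. y) ys"]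
    by auto
  then show "star N R w ys \<longleftrightarrow> star N' R y (map (\<lambda>_. y) ys)" by simp
qed (use xy star_tree.mt_idem[OF trees(1)] star_tree.mt_idem[OF trees(2)] in auto)

text \<open>
  Structures that share with the models of \<open>T\<^sup>*\<close> the properties which give quantifier elimination.
\<close>

locale star_model = star_tree L M
  for L :: "('f, 'r) language" and M :: "('m, tree_fun, 'r tree_rel) struc" +
  fixes U :: "('f, 'r) fm set"
  assumes L: "finite_relational L" and U: "universal_theory L U"
    and rich: "rich (star_lang L) (finite_models (star_lang L) (star_theory L U)) M"
begin

lemma arity_pos: "R \<in> rel_syms L \<Longrightarrow> rel_ar L R > 0"
  using L by (simp add: finite_relational_def)

lemma no_funs: "fun_syms L = {}"
  using L by (simp add: finite_relational_def)

text \<open>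
  The point \<open>b\<close> is a copy of the root of the bouquet of \<open>A\<close>, and the extension property extends this
  to the whole bouquet.
\<close>

lemma place_above:
  assumes b: "b \<in> carrier M" and A: "A \<in> finite_models L U"
  obtains Y where "cone_copy L A M b Y"
proof -
  let ?K = "finite_models (star_lang L) (star_theory L U)"
  have s: "is_structure (star_lang L) (restr M {b})"
    using mt_idem[OF b] by (simp add: is_structure_star_lang)
  have emb: "embedding (star_lang L) (restr M {b}) (bouquet A) (\<lambda>_. 0)"
    by (rule single_point_embedding[OF star_tree_axioms star_tree_bouquet arity_pos]) (simp_all add: b)
  have "extension_property (star_lang L) ?K M" using rich by (simp add: rich_def)
  from extension_propertyD[OF this _ _ s bouquet_in_finite_models[OF L U A] emb] b
  obtain g where g: "embedding (star_lang L) (bouquet A) M g" "g 0 = b" by auto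
  have gN: "g x \<in> carrier M" if "x \<in> carrier (bouquet A)" for x using embedding_into[OF g(1) that] .
  have g_eq: "g x = g y \<longleftrightarrow> x = y" if "x \<in> carrier (bouquet A)" "y \<in> carrier (bouquet A)" for x y
    using inj_on_eq_iff[OF embedding_inj[OF g(1)] that] .
  have gle: "leq M (g x) (g y) \<longleftrightarrow> x = 0 \<or> x = y"
    if "x \<in> carrier (bouquet A)" "y \<in> carrier (bouquet A)" for x y
    using embedding_rel[OF g(1), of Le "[x, y]"] that by (simp add: tuple_def)
  have gm: "mt M (g x) (g y) = (if x = y then g x else b)"
    if "x \<in> carrier (bouquet A)" "y \<in> carrier (bouquet A)" for x y
    using embedding_fun[OF g(1), of Meet "[x, y]"] that g(2) by (simp add: tuple_def)
  have "cone_copy L A M b (g \<circ> Suc)"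
    unfolding cone_copy_def
  proof (intro conjI ballI allI impI)
    show "b \<in> carrier M" by fact
    show "(g \<circ> Suc) ` carrier A \<subseteq> carrier M" using gN by auto
    fix x assume x: "x \<in> carrier A"
    have bx: "below M b (g (Suc x))" using gle[of 0 "Suc x"] g_eq[of 0 "Suc x"] x g(2) by simp
    then show "leq M b ((g \<circ> Suc) x)" "b \<noteq> (g \<circ> Suc) x" by simp_all
    fix y assume y: "y \<in> carrier A"
    show "below M b (mt M ((g \<circ> Suc) x) ((g \<circ> Suc) y)) \<longleftrightarrow> x = y"
      using bx gm[of "Suc x" "Suc y"] x y by (cases "x = y") simp_all
  next
    fix R xs assume R: "R \<in> rel_syms L" and xs: "tuple A (rel_ar L R) xs"
    have "tuple (bouquet A) (rel_ar (star_lang L) (Star R)) (0 # map Suc xs)"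
      using xs by (auto simp: tuple_def)
    from embedding_rel[OF g(1) _ this] R
    show "star M R b (map (g \<circ> Suc) xs) \<longleftrightarrow> rel_int A R xs"
      by (simp add: g(2) comp_def)
  qed
  then show thesis using that by blast
qed

context
  fixes A0 and B
  assumes A0: "A0 \<in> finite_models L U" and B: "branch M B"
begin

lemma no_maximal_element:
  assumes "x \<in> carrier M"
  obtains y where "y \<in> carrier M" "below M x y"
proof -
  obtain Y where Y: "cone_copy L A0 M x Y" using place_above[OF assms A0] .
  obtain a where "a \<in> carrier A0"
    using A0 by (auto simp: finite_models_def models_def is_structure_def)
  then show thesis using Y that[of "Y a"] by (auto simp: cone_copy_def)
qed

text \<open>
  Some \<open>y\<close> lies above \<open>x\<close>. If no point of \<open>B\<close> did, then \<open>x\<close> would be the maximum of \<open>B\<close>, and \<open>y\<close>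
  could be added to the chain.
\<close>

lemma branch_unbounded:
  assumes x: "x \<in> B"
  obtains b where "b \<in> B" "below M x b"
proof -
  note BM = branch_subset[OF B]
  have xM: "x \<in> carrier M" using x BM by auto
  obtain y where y: "y \<in> carrier M" "below M x y" using no_maximal_element[OF xM] by blast
  have "\<exists>b\<in>B. below M x b"
  proof (rule ccontr)
    assume *: "\<not> (\<exists>b\<in>B. below M x b)"
    have "leq M b y" if b: "b \<in> B" for b
    proof -
      have "leq M b x" using branch_total[OF B b x] * b leq_refl[OF xM] by auto
      then show ?thesis using leq_trans[of b x y] b BM xM y by auto
    qed
    then have "y \<in> B" using branch_maximal[OF B y(1)] by blast
    then show False using * y(2) by blast
  qed
  then show thesis using that by blast
qed

lemma branch_finite_bound:
  assumes "finite X" "X \<subseteq> B"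
  obtains b where "b \<in> B" "\<And>x. x \<in> X \<Longrightarrow> below M x b"
proof -
  note BM = branch_subset[OF B]
  have "\<exists>b\<in>B. \<forall>x\<in>X. below M x b"
    using assms
  proof (induction X rule: finite_induct)
    case empty
    obtain x where "x \<in> carrier M" using ne by auto
    then have "B \<noteq> {}" using branch_maximal[OF B, of x] by blast
    then show ?case by auto
  next
    case (insert x X)
    then obtain b where b: "b \<in> B" "\<forall>x\<in>X. below M x b" by auto
    have x: "x \<in> B" using insert by simp
    obtain m where m: "m \<in> B" "leq M x m" "leq M b m"
      using branch_total[OF B b(1) x] leq_refl[of x] leq_refl[of b] b(1) x BM by blast
    obtain b' where b': "b' \<in> B" "below M m b'" using branch_unbounded[OF m(1)] by blast
    have "below M y b'" if "y \<in> B" "leq M y m" for y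
      using leq_less_trans[of y m b'] that m b' BM by blast
    moreover have "leq M y m" if "y \<in> X" for y
      using leq_trans[of y b m] b that m BM insert.prems by blast
    ultimately have "\<forall>y\<in>insert x X. below M y b'" using x m(2) insert.prems by blast
    then show ?case using b'(1) by blast
  qed
  then show thesis using that by blast
qed

text \<open>
  A point above all of \<open>B\<close> would belong to \<open>B\<close> by maximality, but \<open>B\<close> is unbounded. For finitely many
  points, go to an upper bound in \<open>B\<close>.
\<close>

lemma branch_not_below:
  assumes "finite X" "X \<subseteq> carrier M"
  obtains b where "b \<in> B" "\<And>x. x \<in> X \<Longrightarrow> \<not> leq M b x"
proof -
  note BM = branch_subset[OF B]
  have "\<exists>b\<in>B. \<not> leq M b x" if x: "x \<in> carrier M" for x
  proof (rule ccontr)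
    assume *: "\<not> (\<exists>b\<in>B. \<not> leq M b x)"
    then have "x \<in> B" using branch_maximal[OF B x] by blast
    then obtain b where "b \<in> B" "below M x b" using branch_unbounded by blast
    then show False using * leq_antisym[of x b] x BM by blast
  qed
  then have "\<forall>x\<in>X. \<exists>b. b \<in> B \<and> \<not> leq M b x" using assms(2) by blast
  from bchoice[OF this] obtain f where f: "\<forall>x\<in>X. f x \<in> B \<and> \<not> leq M (f x) x" by blast
  obtain b where b: "b \<in> B" "\<And>y. y \<in> f ` X \<Longrightarrow> below M y b"
    using branch_finite_bound[of "f ` X"] assms(1) f by blast
  have "\<not> leq M b x" if x: "x \<in> X" for x
  proof
    assume "leq M b x"
    then have "leq M (f x) x"
      using leq_trans[of "f x" b x] b(2)[of "f x"] b(1) x f BM assms(2) by blast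
    then show False using f x by blast
  qed
  then show thesis using that b(1) by blast
qed

end

end

section \<open>Models above a branch\<close>

lemma limit_model_rich:
  assumes fin: "finite (fun_syms L)" "finite (rel_syms L)"
    and lim: "fraisse_limit L (finite_models L U) F"
    and U: "\<And>\<psi>. \<psi> \<in> U \<Longrightarrow> wf_fm L \<psi> \<and> quantifier_free \<psi>"
    and N: "models L N (Th L F)" and lf: "locally_finite L N"
  shows "rich L (finite_models L U) N"
proof -
  have F: "is_structure L F" using lim by (simp add: fraisse_limit_def)
  have "holds N \<psi>" if "\<psi> \<in> U" for \<psi>
    using models_Th_holds[OF F N] fraisse_limit_holds[OF lim that] U[OF that] by blast
  then have "\<forall>A h. finite (carrier A) \<and> is_structure L A \<and> embedding L A N h \<longrightarrow>
      A \<in> finite_models L U"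
    using finite_substructure_in_finite_models[of L _ N _ U] U by blast
  moreover have "extension_property L (finite_models L U) N"
    using extension_property_transfer[OF fin fraisse_limit_extension_property[OF lim] F N]
    by (simp add: finite_models_def models_def)
  ultimately show ?thesis using N lf by (simp add: rich_def models_def)
qed

lemma star_lang_finite:
  assumes "finite_relational L"
  shows "finite (fun_syms (star_lang L))" "finite (rel_syms (star_lang L))"
  using assms by (simp_all add: finite_relational_def)

lemma star_model_if_limit:
  assumes L: "finite_relational L" and U: "universal_theory L U"
    and lim: "fraisse_limit (star_lang L) (finite_models (star_lang L) (star_theory L U)) F"
    and N: "models (star_lang L) N (Th (star_lang L) F)"
  shows "star_model L N U"
proof -
  have F: "is_structure (star_lang L) F" using lim by (simp add: fraisse_limit_def)
  have "holds N \<phi>" if "\<phi> \<in> star_theory L U" for \<phi>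
    using models_Th_holds[OF F N] fraisse_limit_holds[OF lim that] star_theory_wf_qf[OF L U that]
    by blast
  moreover have "is_structure (star_lang L) N" using N by (simp add: models_def)
  ultimately have tree: "star_tree L N" by (intro star_tree_if_holds)
  have "rich (star_lang L) (finite_models (star_lang L) (star_theory L U)) N"
    using limit_model_rich[OF star_lang_finite[OF L] lim star_theory_wf_qf[OF L U] N
        star_tree.locally_finite[OF tree]] .
  then show ?thesis using tree L U by (simp add: star_model_def star_model_axioms_def)
qed

lemma relational_model_rich:
  assumes L: "finite_relational L" and U: "universal_theory L U"
    and lim: "fraisse_limit L (finite_models L U) F" and N: "models L N (Th L F)"
  shows "rich L (finite_models L U) N" "\<And>\<psi>. \<psi> \<in> U \<Longrightarrow> holds N \<psi>"
proof -
  have cl: "closed_under L N X" for X using L by (simp add: closed_under_def finite_relational_def)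
  have "locally_finite L N"
    unfolding locally_finite_def using cl by (intro allI impI) (rule exI, auto)
  then show "rich L (finite_models L U) N"
    using limit_model_rich[OF _ _ lim _ N] L U
    by (simp add: finite_relational_def universal_theory_def)
  fix \<psi> assume \<psi>: "\<psi> \<in> U"
  have "is_structure L F" using lim by (simp add: fraisse_limit_def)
  then show "holds N \<psi>"
    using models_Th_holds[OF _ N] fraisse_limit_holds[OF lim \<psi>] U \<psi>
    by (simp add: universal_theory_def)
qed

lemma finite_copy_in_finite_models:
  fixes N :: "('n, 'f, 'r) struc"
  assumes L: "finite_relational L" and U: "universal_theory L U"
    and N: "\<And>\<psi>. \<psi> \<in> U \<Longrightarrow> holds N \<psi>"
    and S: "finite S" "S \<noteq> {}" "S \<subseteq> carrier N" and f: "inj_on f S"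
  shows "copy f (restr N S) \<in> finite_models L U"
proof -
  have s: "is_structure L (restr N S)"
    using S L by (simp add: is_structure_restr closed_under_def finite_relational_def)
  have f': "inj_on f (carrier (restr N S))" using f by simp
  have "embedding L (copy f (restr N S)) N (id \<circ> inv_into (carrier (restr N S)) f)"
    by (rule embedding_comp[OF embedding_copy_inverse[OF f' s] embedding_restr_id[OF S(3)]])
  moreover have "is_structure L (copy f (restr N S))" by (rule is_structure_copy[OF f' s])
  moreover have "finite (carrier (copy f (restr N S)))" using S(1) by simp
  ultimately show ?thesis
    using finite_substructure_in_finite_models N U by (metis universal_theory_def)
qed

lemma comp_case_nat: "\<sigma> \<circ> case_nat a f = case_nat (\<sigma> a) (\<sigma> \<circ> f)"
  by (auto simp: fun_eq_iff split: nat.split)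

context star_model
begin

text \<open>
  Whatever is finitely satisfiable in a model \<open>N0\<close> of \<open>U\<close> can be realized in the cone above a point
  \<open>c\<close> that lies above the whole branch \<open>B\<close>, in an elementary extension of \<open>M\<close>. By compactness it
  suffices to do this for a finite part of the conditions, and then inside \<open>M\<close>: take for \<open>c\<close> a point \<open>b\<close>
  of \<open>B\<close> above the finitely many points of \<open>B\<close> that are mentioned, and place the finite substructure
  of \<open>N0\<close> that is involved above \<open>b\<close>.
\<close>

theorem cone_realization:
  fixes N0 :: "('n, 'f, 'r) struc" and \<Delta> :: "(('f, 'r) fm \<times> (nat \<Rightarrow> 'x)) set" and ix :: "'x \<Rightarrow> 'u"
  assumes N0: "carrier N0 \<noteq> {}" "\<And>\<psi>. \<psi> \<in> U \<Longrightarrow> holds N0 \<psi>"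
    and B: "branch M B" and inf: "infinite (UNIV :: 'u set)"
    and fits: "set_fits (carrier M) TYPE('u)" and ix: "inj ix"
    and wf: "\<And>\<psi> v. (\<psi>, v) \<in> \<Delta> \<Longrightarrow> wf_fm L \<psi> \<and> quantifier_free \<psi>"
    and finsat: "\<And>\<Delta>0. finite \<Delta>0 \<Longrightarrow> \<Delta>0 \<subseteq> \<Delta> \<Longrightarrow>
      \<exists>\<theta>. range \<theta> \<subseteq> carrier N0 \<and> (\<forall>(\<psi>, v)\<in>\<Delta>0. sat N0 (\<theta> \<circ> v) \<psi>)"
  obtains N :: "('u, tree_fun, 'r tree_rel) struc" and e :: "'m \<Rightarrow> 'u" and c :: 'u and Y :: "'x \<Rightarrow> 'u"
  where "is_structure (star_lang L) N" "elementary_embedding (star_lang L) M N e"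
    "c \<in> carrier N" "range Y \<subseteq> carrier N" "\<And>b. b \<in> B \<Longrightarrow> below N (e b) c" "\<And>x. below N c (Y x)"
    "\<And>\<psi> v. (\<psi>, v) \<in> \<Delta> \<Longrightarrow> sat N (case_nat c (Y \<circ> v)) (star_fm \<psi>)"
proof -
  obtain a0 where a0: "a0 \<in> carrier N0" using N0 by auto
  have A0: "copy (\<lambda>_. 0) (restr N0 {a0}) \<in> finite_models L U"
    by (rule finite_copy_in_finite_models[OF L U N0(2)]) (use a0 in auto)
  note BM = branch_subset[OF B]
  obtain iM :: "'m \<Rightarrow> 'u" where iM: "inj_on iM (carrier M)"
    using fits unfolding set_fits_def card_fits_def card_of_ordLeq[symmetric] by blast
  obtain m0 where m0: "m0 \<in> carrier M" using ne by auto
  define dec where "dec u = (if u \<in> iM ` carrier M then inv_into (carrier M) iM u else m0)" for u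
  have dec_in: "dec u \<in> carrier M" for u using m0 by (auto simp: dec_def inv_into_into)
  have dec_iM: "dec (iM m) = m" if "m \<in> carrier M" for m using that iM by (simp add: dec_def)
  obtain p :: "'u \<times> 'u \<Rightarrow> 'u" where p: "inj p" by (rule infinite_pairing[OF inf])
  obtain z :: "nat \<Rightarrow> 'u" where z: "inj z" by (rule infinite_nat_embedding[OF inf])
  have p_eq: "p x = p y \<longleftrightarrow> x = y" for x y using p by (auto dest: injD)
  have z_eq: "z x = z y \<longleftrightarrow> x = y" for x y using z by (auto dest: injD)
  define ib :: "'u + 'x option \<Rightarrow> 'u" where "ib t = (case t of Inl u \<Rightarrow> p (z 0, u)
    | Inr None \<Rightarrow> p (z 1, z 0) | Inr (Some x) \<Rightarrow> p (z 2, ix x))" for t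
  have ib: "inj ib"
    using ix by (auto simp: ib_def inj_def p_eq z_eq split: sum.splits option.splits)
  \<comment> \<open>The last three sets of conditions say that \<open>c\<close> is above \<open>B\<close>, that the points of the cone are above
    \<open>c\<close>, and that they satisfy \<open>\<Delta>\<close>.\<close>
  define diagram :: "((tree_fun, 'r tree_rel) fm \<times> (nat \<Rightarrow> 'u + 'x option)) set"
    where "diagram = {(\<phi>, Inl \<circ> u) | \<phi> u. wf_fm (star_lang L) \<phi> \<and> sat M (dec \<circ> u) \<phi>}"
  define k2 :: "'u \<Rightarrow> (tree_fun, 'r tree_rel) fm \<times> (nat \<Rightarrow> 'u + 'x option)"
    where "k2 u = (lt (Var 0) (Var 1), case_nat (Inl u) (\<lambda>_. Inr None))" for u
  define k3 :: "'x \<Rightarrow> (tree_fun, 'r tree_rel) fm \<times> (nat \<Rightarrow> 'u + 'x option)"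
    where "k3 x = (lt (Var 0) (Var 1), case_nat (Inr None) (\<lambda>_. Inr (Some x)))" for x
  define k4 :: "('f, 'r) fm \<times> (nat \<Rightarrow> 'x) \<Rightarrow> (tree_fun, 'r tree_rel) fm \<times> (nat \<Rightarrow> 'u + 'x option)"
    where "k4 = (\<lambda>(\<psi>, v). (star_fm \<psi>, case_nat (Inr None) (Inr \<circ> Some \<circ> v)))"
  define \<Gamma> where "\<Gamma> = diagram \<union> k2 ` {u. dec u \<in> B} \<union> range k3 \<union> k4 ` \<Delta>"
  have wf_lt: "wf_fm (star_lang L) (lt (Var i) (Var j))" for i j by (simp add: lt_def le_def)
  have wf\<Gamma>: "wf_fm (star_lang L) \<phi>" if "(\<phi>, v) \<in> \<Gamma>" for \<phi> v
    using that wf unfolding \<Gamma>_def diagram_def k2_def k3_def k4_def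
    by (auto simp: wf_lt star_fm_wf[OF no_funs])
  have fin\<Gamma>: "\<exists>\<sigma>. range \<sigma> \<subseteq> carrier M \<and> (\<forall>(\<phi>, v)\<in>\<Gamma>0. sat M (\<sigma> \<circ> v) \<phi>)"
    if \<Gamma>0: "finite \<Gamma>0" "\<Gamma>0 \<subseteq> \<Gamma>" for \<Gamma>0
  proof -
    have fin: "finite (\<Gamma>0 \<inter> k2 ` {u. dec u \<in> B})" "finite (\<Gamma>0 \<inter> range k3)" "finite (\<Gamma>0 \<inter> k4 ` \<Delta>)"
      using \<Gamma>0(1) by auto
    obtain U0 where U0: "finite U0" "U0 \<subseteq> {u. dec u \<in> B}" "\<Gamma>0 \<inter> k2 ` {u. dec u \<in> B} = k2 ` U0"
      using finite_subset_image[OF fin(1) Int_lower2] by blast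
    obtain X3 where X3: "finite X3" "\<Gamma>0 \<inter> range k3 = k3 ` X3"
      using finite_subset_image[OF fin(2) Int_lower2] by blast
    obtain \<Delta>0 where \<Delta>0: "finite \<Delta>0" "\<Delta>0 \<subseteq> \<Delta>" "\<Gamma>0 \<inter> k4 ` \<Delta> = k4 ` \<Delta>0"
      using finite_subset_image[OF fin(3) Int_lower2] by blast
    obtain b where b: "b \<in> B" "\<And>x. x \<in> dec ` U0 \<Longrightarrow> below M x b"
      using branch_finite_bound[OF A0 B, of "dec ` U0"] U0 by auto
    obtain \<theta> where \<theta>: "range \<theta> \<subseteq> carrier N0" "\<forall>(\<psi>, v)\<in>\<Delta>0. sat N0 (\<theta> \<circ> v) \<psi>"
      using finsat[OF \<Delta>0(1,2)] by blast
    fix x0 :: 'x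
    define X where "X = insert x0 (X3 \<union> (\<Union>(\<psi>, v)\<in>\<Delta>0. v ` fv \<psi>))"
    have X: "finite X" "x0 \<in> X" using X3 \<Delta>0(1) by (auto simp: X_def finite_fv)
    define S where "S = \<theta> ` X"
    have S: "finite S" "S \<noteq> {}" "S \<subseteq> carrier N0" using X \<theta>(1) by (auto simp: S_def)
    obtain f :: "'n \<Rightarrow> nat" where f: "inj_on f S" using finite_imp_inj_to_nat_seg[OF S(1)] by blast
    define A where "A = copy f (restr N0 S)"
    have A: "A \<in> finite_models L U"
      unfolding A_def by (rule finite_copy_in_finite_models[OF L U N0(2) S f])
    have bM: "b \<in> carrier M" using b BM by auto
    obtain Y where Y: "cone_copy L A M b Y" using place_above[OF bM A] .
    have YM: "Y a \<in> carrier M" "below M b (Y a)" if "a \<in> carrier A" for a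
      using Y that by (auto simp: cone_copy_def)
    have fA: "f (\<theta> x) \<in> carrier A" if "x \<in> X" for x using that by (simp add: A_def S_def)
    \<comment> \<open>No condition in \<open>\<Gamma>0\<close> depends on variables outside \<open>X\<close>; these get the value of \<open>x0\<close>.\<close>
    define r where "r x = (if x \<in> X then x else x0)" for x
    have rX: "r x \<in> X" for x using X by (simp add: r_def)
    define \<sigma> where "\<sigma> t = (case t of Inl u \<Rightarrow> dec u | Inr None \<Rightarrow> b | Inr (Some x) \<Rightarrow> Y (f (\<theta> (r x))))"
      for t
    have \<sigma>: "\<sigma> (Inl u) = dec u" "\<sigma> (Inr None) = b" "\<sigma> (Inr (Some x)) = Y (f (\<theta> (r x)))" for u x
      by (simp_all add: \<sigma>_def)
    have "\<sigma> t \<in> carrier M" for t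
      using dec_in bM YM(1)[OF fA[OF rX]] by (cases t rule: sum.exhaust) (auto simp: \<sigma>_def split: option.split)
    then have "range \<sigma> \<subseteq> carrier M" by auto
    moreover have "sat M (\<sigma> \<circ> v) \<phi>" if \<phi>v: "(\<phi>, v) \<in> \<Gamma>0" for \<phi> v
    proof -
      consider "(\<phi>, v) \<in> diagram" | "(\<phi>, v) \<in> k2 ` U0" | "(\<phi>, v) \<in> k3 ` X3" | "(\<phi>, v) \<in> k4 ` \<Delta>0"
        using \<phi>v \<Gamma>0(2) unfolding \<Gamma>_def U0(3)[symmetric] X3(2)[symmetric] \<Delta>0(3)[symmetric] by blast
      then show ?thesis
      proof cases
        case 1
        then obtain u where "v = Inl \<circ> u" "sat M (dec \<circ> u) \<phi>" by (auto simp: diagram_def)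
        moreover have "\<sigma> \<circ> (Inl \<circ> u) = dec \<circ> u" by (simp add: fun_eq_iff \<sigma>)
        ultimately show ?thesis by simp
      next
        case 2
        then show ?thesis using b(2) by (auto simp: k2_def \<sigma>)
      next
        case 3
        then show ?thesis using YM(2)[OF fA[OF rX]] by (auto simp: k3_def \<sigma>)
      next
        case 4
        then obtain \<psi> u where \<psi>: "(\<psi>, u) \<in> \<Delta>0" "\<phi> = star_fm \<psi>"
          "v = case_nat (Inr None) (Inr \<circ> Some \<circ> u)" by (auto simp: k4_def)
        have wf\<psi>: "wf_fm L \<psi>" "quantifier_free \<psi>" using wf \<psi>(1) \<Delta>0(2) by auto
        have uX: "u i \<in> X" if "i \<in> fv \<psi>" for i using that \<psi>(1) by (auto simp: X_def)
        have "sat N0 (\<theta> \<circ> u) \<psi>" using \<theta>(2) \<psi>(1) by auto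
        moreover have s: "is_structure L (restr N0 S)"
          using S no_funs by (simp add: is_structure_restr closed_under_def)
        have "sat N0 (\<theta> \<circ> u) \<psi> \<longleftrightarrow> sat (restr N0 S) (\<theta> \<circ> u) \<psi>"
          by (rule embedding_sat_qf[OF embedding_restr_id[OF S(3)] s wf\<psi>]) (use uX in \<open>auto simp: S_def\<close>)
        moreover have "sat A (f \<circ> \<theta> \<circ> u) \<psi> \<longleftrightarrow> sat (restr N0 S) (\<theta> \<circ> u) \<psi>"
          unfolding A_def
          by (rule embedding_sat_qf[OF embedding_copy s wf\<psi>]) (use uX f in \<open>auto simp: S_def\<close>)
        moreover have "sat M (\<sigma> \<circ> v) (star_fm \<psi>) \<longleftrightarrow> sat A (f \<circ> \<theta> \<circ> u) \<psi>"
          by (rule cone_copy_sat[OF Y no_funs wf\<psi>]) (use uX fA in \<open>auto simp: \<psi>(3) \<sigma> r_def\<close>)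
        ultimately show ?thesis by (simp add: \<psi>(2))
      qed
    qed
    ultimately show ?thesis by blast
  qed
  obtain N :: "('u, tree_fun, 'r tree_rel) struc" and \<tau> where N: "is_structure (star_lang L) N"
    "range \<tau> \<subseteq> carrier N" "\<And>\<phi> v. (\<phi>, v) \<in> \<Gamma> \<Longrightarrow> sat N (\<tau> \<circ> v) \<phi>"
  proof (rule compactness[where \<Gamma> = \<Gamma>, OF star_lang_finite[OF L] is_structure inf ib], goal_cases)
    case (1 \<phi> v)
    show ?case by (rule wf\<Gamma>[OF 1(2)])
  next
    case (2 \<Gamma>0)
    show ?case by (rule fin\<Gamma>[OF 2(2,3)])
  next
    case (3 N \<tau>)
    show ?case by (rule 3(1)[OF 3(2,3)]) (rule 3(4))
  qed
  define e where "e m = \<tau> (Inl (iM m))" for m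
  have e_sat: "sat N (e \<circ> v) \<phi>"
    if "wf_fm (star_lang L) \<phi>" "range v \<subseteq> carrier M" "sat M v \<phi>" for \<phi> v
  proof -
    have "dec \<circ> (iM \<circ> v) = v" using that(2) dec_iM by (auto simp: fun_eq_iff)
    then have "(\<phi>, Inl \<circ> (iM \<circ> v)) \<in> diagram"
      unfolding diagram_def using that by (intro CollectI exI[of _ \<phi>] exI[of _ "iM \<circ> v"]) simp
    then have "sat N (\<tau> \<circ> (Inl \<circ> (iM \<circ> v))) \<phi>" by (intro N(3)) (simp add: \<Gamma>_def)
    moreover have "\<tau> \<circ> (Inl \<circ> (iM \<circ> v)) = e \<circ> v" by (simp add: fun_eq_iff e_def)
    ultimately show ?thesis by simp
  qed
  show thesis
  proof
    show "is_structure (star_lang L) N" by fact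
    show "elementary_embedding (star_lang L) M N e"
      unfolding elementary_embedding_def
    proof (intro conjI allI impI, goal_cases)
      case 1
      then show ?case using N(2) by (auto simp: e_def)
    next
      case (2 \<phi> v)
      then show ?case using e_sat[of \<phi> v] e_sat[of "Neg \<phi>" v] by auto
    qed
    show "\<tau> (Inr None) \<in> carrier N" "range (\<lambda>x. \<tau> (Inr (Some x))) \<subseteq> carrier N" using N(2) by auto
    show "below N (e b) (\<tau> (Inr None))" if "b \<in> B" for b
    proof -
      have "k2 (iM b) \<in> \<Gamma>" using that dec_iM BM by (auto simp: \<Gamma>_def)
      then show ?thesis using N(3)[of "fst (k2 (iM b))" "snd (k2 (iM b))"] by (simp add: k2_def e_def)
    qed
    show "below N (\<tau> (Inr None)) (\<tau> (Inr (Some x)))" for x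
    proof -
      have "k3 x \<in> \<Gamma>" by (auto simp: \<Gamma>_def)
      then show ?thesis using N(3)[of "fst (k3 x)" "snd (k3 x)"] by (simp add: k3_def)
    qed
    fix \<psi> v assume "(\<psi>, v) \<in> \<Delta>"
    then have "k4 (\<psi>, v) \<in> \<Gamma>" by (auto simp: \<Gamma>_def)
    then have "sat N (\<tau> \<circ> case_nat (Inr None) (Inr \<circ> Some \<circ> v)) (star_fm \<psi>)"
      using N(3)[of "fst (k4 (\<psi>, v))" "snd (k4 (\<psi>, v))"] by (simp add: k4_def)
    moreover have "\<tau> \<circ> (Inr \<circ> Some \<circ> v) = (\<lambda>x. \<tau> (Inr (Some x))) \<circ> v" by (simp add: fun_eq_iff)
    ultimately show "sat N (case_nat (\<tau> (Inr None)) ((\<lambda>x. \<tau> (Inr (Some x))) \<circ> v)) (star_fm \<psi>)"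
      by (simp add: comp_case_nat)
  qed
qed

end

lemma elementary_embedding_models:
  fixes N :: "('b, 'f, 'r) struc"
  assumes N: "is_structure L N" and e: "elementary_embedding L M N e"
    and M: "models L M (Th L F)"
  shows "models L N (Th L F)"
proof -
  obtain m where m: "m \<in> carrier M" using M by (auto simp: models_def is_structure_def)
  have "holds N \<phi>" if \<phi>: "\<phi> \<in> Th L F" for \<phi>
    unfolding holds_def
  proof (intro allI impI)
    fix w :: "nat \<Rightarrow> 'b"
    have f: "wf_fm L \<phi>" "fv \<phi> = {}" using \<phi> by (auto simp: Th_def)
    have "holds M \<phi>" using M \<phi> by (auto simp: models_def)
    then have "sat M (\<lambda>_. m) \<phi>" using m by (auto simp: holds_def)
    then have "sat N (e \<circ> (\<lambda>_. m)) \<phi>"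
      using e f(1) m by (auto simp: elementary_embedding_def)
    moreover have "sat N (e \<circ> (\<lambda>_. m)) \<phi> \<longleftrightarrow> sat N w \<phi>" by (rule sat_cong) (simp add: f(2))
    ultimately show "sat N w \<phi>" by simp
  qed
  then show ?thesis using N by (simp add: models_def)
qed

context star_model
begin

lemma elementary_leq:
  assumes "elementary_embedding (star_lang L) M N e" "x \<in> carrier M" "y \<in> carrier M"
  shows "leq N (e x) (e y) \<longleftrightarrow> leq M x y" "e x = e y \<longleftrightarrow> x = y"
proof -
  have r: "range (case_nat x (\<lambda>_. y)) \<subseteq> carrier M" using assms(2,3) by (auto split: nat.split)
  have *: "sat M (case_nat x (\<lambda>_. y)) \<phi> \<longleftrightarrow> sat N (e \<circ> case_nat x (\<lambda>_. y)) \<phi>"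
    if "wf_fm (star_lang L) \<phi>" for \<phi>
    using assms(1) that r by (simp add: elementary_embedding_def)
  show "leq N (e x) (e y) \<longleftrightarrow> leq M x y" "e x = e y \<longleftrightarrow> x = y"
    using *[of "le (Var 0) (Var 1)"] *[of "Eq (Var 0) (Var 1)"] by (simp_all add: le_def)
qed

lemma not_below_image:
  assumes A0: "A0 \<in> finite_models L U" and B: "branch M B"
    and N: "star_model L N U" and e: "elementary_embedding (star_lang L) M N e"
    and c: "c \<in> carrier N" "\<And>b. b \<in> B \<Longrightarrow> below N (e b) c" and m: "m \<in> carrier M"
  shows "\<not> leq N c (e m)"
proof
  assume le: "leq N c (e m)"
  interpret N: star_model L N U by fact
  obtain b where b: "b \<in> B" "\<not> leq M b m" using branch_not_below[OF A0 B, of "{m}"] m by auto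
  have bM: "b \<in> carrier M" using b(1) branch_subset[OF B] by auto
  have eN: "e b \<in> carrier N" "e m \<in> carrier N" using e bM m by (auto simp: elementary_embedding_def)
  have "leq N (e b) (e m)" using N.leq_trans[OF eN(1) c(1) eN(2)] c(2)[OF b(1)] le by simp
  then show False using b(2) elementary_leq(1)[OF e bM m] by simp
qed

text \<open>
  Let \<open>\<phi>(x, p)\<close> be in \<open>q\<close>, and let \<open>b\<close> in \<open>B\<close> be below no entry of \<open>p\<close>. Then all points above \<open>b\<close>
  agree on \<open>\<phi>(x, p)\<close>: such points are exchanged by a map that fixes everything outside the cone above
  \<open>b\<close>. Since \<open>q\<close> is consistent, \<open>\<phi>(x, p)\<close> has a solution in \<open>M\<close> above \<open>b\<close>, so every point of \<open>N\<close>
  above \<open>B\<close> is a solution.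
\<close>

lemma realizes_above_branch:
  assumes A0: "A0 \<in> finite_models L U" and B: "branch M B"
    and q: "complete_type (star_lang L) M 1 (carrier M) q" "above_branch B \<subseteq> q"
    and N: "star_model L N U" and e: "elementary_embedding (star_lang L) M N e"
    and z: "z \<in> carrier N" "\<And>b. b \<in> B \<Longrightarrow> below N (e b) z"
  shows "realizes N 1 (push e q) [z]"
proof -
  interpret N: star_model L N U by fact
  have eN: "e m \<in> carrier N" if "m \<in> carrier M" for m
    using e that by (auto simp: elementary_embedding_def)
  have "sat_at N ([z] @ map e p) \<phi>" if \<phi>p: "(\<phi>, p) \<in> q" for \<phi> p
  proof -
    have "(\<phi>, p) \<in> forms_over (star_lang L) 1 (carrier M)" using q(1) \<phi>p by (auto simp: complete_type_def)
    then have \<phi>: "wf_fm (star_lang L) \<phi>" "fv \<phi> \<subseteq> {..<1 + length p}" and p: "set p \<subseteq> carrier M"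
      by (auto simp: forms_over_def)
    obtain b where b: "b \<in> B" "\<And>x. x \<in> set p \<Longrightarrow> \<not> leq M b x"
      using branch_not_below[OF A0 B finite_set p] by blast
    have bM: "b \<in> carrier M" using b(1) branch_subset[OF B] by auto
    have "{(\<phi>, p), (lt (Var 1) (Var 0), [b])} \<subseteq> q"
      using \<phi>p q(2) b(1) by (auto simp: above_branch_def)
    moreover have "consistent M 1 q" using q(1) by (simp add: complete_type_def)
    ultimately obtain as where as: "realizes M 1 {(\<phi>, p), (lt (Var 1) (Var 0), [b])} as"
      unfolding consistent_def by (meson finite.emptyI finite.insertI)
    then obtain a where a: "as = [a]" "a \<in> carrier M"
      by (auto simp: realizes_def tuple_def length_Suc_conv)
    have sat: "sat_at M ([a] @ p) \<phi>" and ba: "below M b a"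
      using as a(1) by (auto simp: realizes_def sat_at_def)
    define v where "v i = (if i < 1 + length p then ([a] @ p) ! i else a)" for i
    have v_in: "v i \<in> set ([a] @ p)" for i
      unfolding v_def using nth_mem[of i "[a] @ p"] by auto
    have vM: "range v \<subseteq> carrier M" using v_in a(2) p by (force simp del: append_Cons)
    have "sat M v \<phi>"
      using sat unfolding sat_at_def by (rule sat_cong[THEN iffD1, rotated]) (use \<phi>(2) in \<open>auto simp: v_def\<close>)
    then have satN: "sat N (e \<circ> v) \<phi>" using e \<phi>(1) vM by (simp add: elementary_embedding_def)
    have leqs: "leq N (e b) (e a)" "\<And>x. x \<in> set p \<Longrightarrow> \<not> leq N (e b) (e x)"
      using elementary_leq(1)[OF e bM] a(2) ba b(2) p by auto
    \<comment> \<open>Exchange \<open>e a\<close>, the only point of \<open>P\<close> in the cone above \<open>e b\<close>, for \<open>z\<close>.\<close>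
    define H where "H = (\<lambda>x. if leq N (e b) x then z else x)"
    define P where "P = {d \<in> carrier N. \<not> leq N (e b) d} \<union> {e a}"
    have emb: "embedding (star_lang L) (restr N {e a}) N (\<lambda>_. z)"
      by (rule single_point_embedding[OF N.star_tree_axioms N.star_tree_axioms arity_pos])
        (use eN a z in auto)
    have cl: "closed_under (star_lang L) N {e a}"
      using N.mt_idem[OF eN[OF a(2)]] by (simp add: closed_under_star_lang)
    note cone = N.arity_pos eN[OF bM] _ _ cl emb
    have P: "closed_under (star_lang L) N P" "embedding (star_lang L) (restr N P) N H"
      unfolding P_def H_def
      by (rule N.cone_closed[OF cone] N.cone_embedding[OF cone]; use eN a z(2)[OF b(1)] leqs in auto)+
    have PN: "P \<subseteq> carrier N" using eN[OF a(2)] by (auto simp: P_def)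
    have "sat N (e \<circ> v) \<phi> \<longleftrightarrow> sat N (\<lambda>i. ([z] @ map e p) ! i) \<phi>"
    proof (rule rich_sat_iff[OF N.rich PN P \<phi>(1)])
      show "P \<noteq> {}" by (simp add: P_def)
      fix i assume "i \<in> fv \<phi>"
      then have i: "i < 1 + length p" using \<phi>(2) by auto
      show "(e \<circ> v) i \<in> P \<and> ([z] @ map e p) ! i = H ((e \<circ> v) i)"
      proof (cases i)
        case 0
        then show ?thesis using leqs by (simp add: v_def P_def H_def)
      next
        case (Suc j)
        then have j: "j < length p" "v i = p ! j" using i by (auto simp: v_def)
        then have pj: "p ! j \<in> set p" by simp
        then have "e (p ! j) \<in> carrier N" "\<not> leq N (e b) (e (p ! j))" using leqs eN p by auto
        then show ?thesis using j Suc by (simp add: P_def H_def)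
      qed
    qed
    then show ?thesis using satN by (simp add: sat_at_def)
  qed
  then show ?thesis using z(1) by (auto simp: realizes_def push_def tuple_def)
qed

end

text \<open>
  The case in which the conditions are the quantifier-free type of an enumeration \<open>j\<close> of \<open>X\<close>.
\<close>

lemma (in star_model) cone_realization_structure:
  fixes N0 :: "('n, 'f, 'r) struc" and j :: "'u \<Rightarrow> 'n"
  assumes N0: "carrier N0 \<noteq> {}" "\<And>\<psi>. \<psi> \<in> U \<Longrightarrow> holds N0 \<psi>"
    and B: "branch M B" and inf: "infinite (UNIV :: 'u set)"
    and fits: "set_fits (carrier M) TYPE('u)" and X: "X \<subseteq> carrier N0" "range j = X"
  obtains N :: "('u, tree_fun, 'r tree_rel) struc" and e :: "'m \<Rightarrow> 'u" and c :: 'u and Y :: "'n \<Rightarrow> 'u"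
  where "is_structure (star_lang L) N" "elementary_embedding (star_lang L) M N e"
    "\<And>b. b \<in> B \<Longrightarrow> below N (e b) c" "cone_copy L (restr N0 X) N c Y"
proof -
  define \<Delta> where "\<Delta> = {(\<psi>, v). wf_fm L \<psi> \<and> quantifier_free \<psi> \<and> sat N0 (j \<circ> v) \<psi>}"
  obtain N :: "('u, tree_fun, 'r tree_rel) struc" and e :: "'m \<Rightarrow> 'u" and c :: 'u and Y :: "'u \<Rightarrow> 'u"
    where N: "is_structure (star_lang L) N" "elementary_embedding (star_lang L) M N e"
    "c \<in> carrier N" "range Y \<subseteq> carrier N" "\<And>b. b \<in> B \<Longrightarrow> below N (e b) c" "\<And>x. below N c (Y x)"
    "\<And>\<psi> v. (\<psi>, v) \<in> \<Delta> \<Longrightarrow> sat N (case_nat c (Y \<circ> v)) (star_fm \<psi>)"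
  proof (rule cone_realization[where \<Delta> = \<Delta>, OF N0 B inf fits inj_on_id], goal_cases)
    case (1 \<psi>)
    then show ?case by simp
  next
    case (2 \<psi> v)
    then show ?case by (simp add: \<Delta>_def)
  next
    case (3 \<Delta>0)
    show ?case
      by (rule exI[of _ j]) (use 3 X in \<open>auto simp: \<Delta>_def\<close>)
  next
    case (4 N e c Y)
    show ?case by (rule 4(1)[OF 4(2-5)]) (use 4 in auto)
  qed
  have sat: "sat N (case_nat c (Y \<circ> v)) (star_fm \<psi>) \<longleftrightarrow> sat N0 (j \<circ> v) \<psi>"
    if "wf_fm L \<psi>" "quantifier_free \<psi>" for \<psi> v
    using N(7)[of \<psi> v] N(7)[of "Neg \<psi>" v] that by (auto simp: \<Delta>_def)
  define s where "s x = (SOME u. j u = x)" for x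
  have js: "j (s x) = x" if "x \<in> X" for x
    using that X(2) unfolding s_def by (metis (mono_tags) rangeE someI_ex)
  have "cone_copy L (restr N0 X) N c (Y \<circ> s)"
    unfolding cone_copy_def
  proof (intro conjI ballI allI impI, goal_cases)
    case 1
    then show ?case by fact
  next
    case 2
    then show ?case using N(4) by auto
  next
    case (3 x)
    then show ?case using N(6) by simp
  next
    case (4 x)
    then show ?case using N(6) by simp
  next
    case (5 x y)
    then show ?case
      using sat[of "Eq (Var 0) (Var 1)" "case_nat (s x) (\<lambda>_. s y)"] js by simp
  next
    case (6 R xs)
    then have R: "R \<in> rel_syms L" and xs: "length xs = rel_ar L R" "set xs \<subseteq> X" by (auto simp: tuple_def)
    define v where "v i = s (xs ! i)" for i
    have m: "map (\<lambda>i. Y (v i)) [0..<rel_ar L R] = map (Y \<circ> s) xs" "map (\<lambda>i. j (v i)) [0..<rel_ar L R] = xs"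
      using xs js by (auto intro!: nth_equalityI simp: v_def subset_iff)
    show ?case
      using sat[of "Rel R (map Var [0..<rel_ar L R])" v] R m by (simp add: comp_def)
  qed
  then show thesis using that[OF N(1,2,5)] by blast
qed

text \<open>
  The situation provided by \<open>cone_realization_structure\<close>. The points of \<open>S\<close> need not exhaust the cone.
\<close>

locale cone_extension = star_model L M U
  for L :: "('f, 'r) language" and M :: "('m, tree_fun, 'r tree_rel) struc" and U +
  fixes B :: "'m set" and N :: "('u, tree_fun, 'r tree_rel) struc" and e c
    and S :: "('n, 'f, 'r) struc" and Y
  assumes nonempty: "finite_models L U \<noteq> {}" and B: "branch M B"
    and N_model: "star_model L N U" and e: "elementary_embedding (star_lang L) M N e"
    and above: "b \<in> B \<Longrightarrow> below N (e b) c" and copy: "cone_copy L S N c Y"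
begin

sublocale N: star_model L N U by (rule N_model)

lemma c_in: "c \<in> carrier N" using copy by (simp add: cone_copy_def)
lemma Y_in: "x \<in> carrier S \<Longrightarrow> Y x \<in> carrier N" using copy by (auto simp: cone_copy_def)
lemma Y_above: "x \<in> carrier S \<Longrightarrow> below N c (Y x)" using copy by (auto simp: cone_copy_def)
lemma e_in: "m \<in> carrier M \<Longrightarrow> e m \<in> carrier N"
  using e by (auto simp: elementary_embedding_def)
lemma mt_Y_less: "x \<in> carrier S \<Longrightarrow> y \<in> carrier S \<Longrightarrow> below N c (mt N (Y x) (Y y)) \<longleftrightarrow> x = y"
  using copy by (simp add: cone_copy_def)

lemma Y_eq_iff: "x \<in> carrier S \<Longrightarrow> y \<in> carrier S \<Longrightarrow> Y x = Y y \<longleftrightarrow> x = y"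
  using mt_Y_less[of x y] N.mt_idem[OF Y_in, of y] Y_above[of y] by auto

lemma mt_Y:
  assumes "x \<in> carrier S" "y \<in> carrier S"
  shows "mt N (Y x) (Y y) = (if x = y then Y x else c)"
proof (cases "x = y")
  case True
  then show ?thesis using N.mt_idem Y_in assms by simp
next
  case False
  have "leq N c (mt N (Y x) (Y y))" using N.leq_mt_iff c_in Y_in Y_above assms by simp
  then show ?thesis using mt_Y_less[OF assms] False by auto
qed

lemma mt_c_Y: "x \<in> carrier S \<Longrightarrow> mt N c (Y x) = c" "x \<in> carrier S \<Longrightarrow> mt N (Y x) c = c"
  using N.mt_eq_left[OF c_in Y_in] N.mt_commute[OF c_in Y_in] Y_above by auto

lemma Y_not_below:
  assumes "x \<in> carrier S" "y \<in> carrier S"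
  shows "\<not> below N (Y x) (Y y)"
  using mt_Y[OF assms] N.mt_eq_left[OF Y_in Y_in, OF assms] Y_above[OF assms(1)]
  by (auto split: if_splits)

lemma e_not_above: "m \<in> carrier M \<Longrightarrow> \<not> leq N c (e m)"
  using nonempty not_below_image[OF _ B N_model e c_in above] by blast

text \<open>
  Two points in the image of \<open>Y\<close> meet in \<open>c\<close>, and none of them is below another one. So the only
  relations on \<open>insert c (Y ` X)\<close> are those at \<open>c\<close>, and these are the relations of \<open>S\<close>.
\<close>

lemma lift_embedding:
  assumes X: "X \<subseteq> carrier S" and g: "embedding L (restr S X) S g"
    and h: "h c = c" "\<And>x. x \<in> X \<Longrightarrow> h (Y x) = Y (g x)"
  shows "embedding (star_lang L) (restr N (insert c (Y ` X))) N h"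
    "closed_under (star_lang L) N (insert c (Y ` X))"
proof -
  have gS: "g x \<in> carrier S" if "x \<in> X" for x using embedding_into[OF g] that by simp
  have g_eq: "g x = g y \<longleftrightarrow> x = y" if "x \<in> X" "y \<in> X" for x y
    using inj_on_eq_iff[OF embedding_inj[OF g]] that by simp
  have XS: "x \<in> carrier S" if "x \<in> X" for x using X that by auto
  have cY: "c \<noteq> Y x" if "x \<in> carrier S" for x using Y_above that by auto
  have m: "mt N x y \<in> insert c (Y ` X)" if "x \<in> insert c (Y ` X)" "y \<in> insert c (Y ` X)" for x y
    using that mt_Y mt_c_Y N.mt_idem[OF c_in] XS by auto
  then show "closed_under (star_lang L) N (insert c (Y ` X))" by (simp add: closed_under_star_lang)
  show "embedding (star_lang L) (restr N (insert c (Y ` X))) N h"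
  proof (rule star_embeddingI[OF N.star_tree_axioms N.star_tree_axioms])
    show "insert c (Y ` X) \<subseteq> carrier N" using c_in Y_in XS by auto
    show "h ` insert c (Y ` X) \<subseteq> carrier N" using c_in Y_in gS h by auto
    show "inj_on h (insert c (Y ` X))"
    proof (rule inj_onI)
      fix z z' assume z: "z \<in> insert c (Y ` X)" "z' \<in> insert c (Y ` X)" "h z = h z'"
      have hc: "h y = c \<longleftrightarrow> y = c" if y: "y \<in> insert c (Y ` X)" for y
      proof (cases "y = c")
        case False
        then obtain x where "x \<in> X" "y = Y x" using y by auto
        then show ?thesis using h(2)[of x] cY[OF gS, of x] False by auto
      qed (simp add: h)
      show "z = z'"
      proof (cases "z = c")
        case True
        then show ?thesis using hc[OF z(2)] z(3) h(1) by simp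
      next
        case False
        then have "z' \<noteq> c" using hc[OF z(1)] z(3) h(1) by auto
        then obtain x x' where x: "x \<in> X" "z = Y x" "x' \<in> X" "z' = Y x'" using z False by auto
        then have "Y (g x) = Y (g x')" using z(3) h(2) by simp
        then show ?thesis using Y_eq_iff[OF gS[OF x(1)] gS[OF x(3)]] g_eq[OF x(1,3)] x by simp
      qed
    qed
    show "mt N x y \<in> insert c (Y ` X)" if "x \<in> insert c (Y ` X)" "y \<in> insert c (Y ` X)" for x y
      by (rule m[OF that])
    show "h (mt N x y) = mt N (h x) (h y)" if "x \<in> insert c (Y ` X)" "y \<in> insert c (Y ` X)" for x y
      using that h mt_Y mt_c_Y N.mt_idem[OF c_in] XS gS g_eq by auto
  next
    fix R w ys assume R: "R \<in> rel_syms L" and len: "length ys = rel_ar L R"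
      and w: "w \<in> insert c (Y ` X)" and ys: "set ys \<subseteq> insert c (Y ` X)"
    have ysN: "set ys \<subseteq> carrier N" using ys c_in Y_in XS by auto
    have hysN: "set (map h ys) \<subseteq> carrier N" using ys c_in Y_in gS h by auto
    have y0: "ys \<noteq> []" using len arity_pos[OF R] by auto
    show "star N R w ys \<longleftrightarrow> star N R (h w) (map h ys)"
    proof (cases "w = c")
      case wc: True
      show ?thesis
      proof (cases "c \<in> set ys")
        case True
        then have "c \<in> set (map h ys)" using h by force
        then show ?thesis
          using wc h N.OC[OF R len c_in ysN _ True] N.OC[OF R _ c_in hysN, of c] len by auto
      next
        case False
        then have "\<forall>y\<in>set ys. \<exists>x. x \<in> X \<and> y = Y x" using ys by auto
        from bchoice[OF this] obtain k where k: "\<forall>y\<in>set ys. k y \<in> X \<and> y = Y (k y)" by blast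
        define xs where "xs = map k ys"
        have xs: "ys = map Y xs" "set xs \<subseteq> X" "length xs = rel_ar L R"
          using k len by (auto simp: xs_def intro!: map_idI[symmetric])
        have "star N R c ys \<longleftrightarrow> rel_int S R xs"
          unfolding xs(1) by (rule cone_copy_star[OF copy R]) (use xs X in \<open>auto simp: tuple_def\<close>)
        also have "\<dots> \<longleftrightarrow> rel_int S R (map g xs)"
          using embedding_rel[OF g R, of xs] xs by (simp add: tuple_def)
        also have "\<dots> \<longleftrightarrow> star N R c (map Y (map g xs))"
          by (rule cone_copy_star[OF copy R, symmetric]) (use xs gS in \<open>auto simp: tuple_def\<close>)
        also have "map Y (map g xs) = map h ys" using xs h by auto
        finally show ?thesis using wc h by simp
      qed
    next
      case False
      then obtain x where x: "x \<in> X" "w = Y x" using w by auto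
      obtain y where y: "y \<in> set ys" using y0 by (cases ys) auto
      have nl: "\<not> below N (Y x') z" if "x' \<in> carrier S" "z \<in> insert c (Y ` carrier S)" for x' z
        using that Y_not_below Y_above[OF that(1)] N.leq_antisym[OF c_in Y_in] by auto
      have "\<not> below N w y" using nl[of x y] x y ys XS by auto
      moreover have "\<not> below N (h w) (h y)"
      proof -
        have "h w = Y (g x)" "h y \<in> insert c (Y ` carrier S)" using x h y ys gS by auto
        then show ?thesis using nl gS x by simp
      qed
      ultimately show ?thesis
        using N.OC[OF R len _ ysN _ y, of w] N.OC[OF R _ _ hysN, of "h w" "h y"] len y x h XS gS Y_in
        by auto
    qed
  qed
qed

text \<open>
  No point of \<open>M\<close> is above \<open>c\<close>, so \<open>H\<close> is the result of gluing \<open>lift_embedding\<close> to the identity outside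
  the cone above \<open>c\<close>.
\<close>

theorem lift_sat:
  assumes X: "X \<subseteq> carrier S" and g: "embedding L (restr S X) S g"
    and H: "\<And>m. m \<in> carrier M \<Longrightarrow> H (e m) = e m" "H c = c" "\<And>x. x \<in> X \<Longrightarrow> H (Y x) = Y (g x)"
    and \<phi>: "wf_fm (star_lang L) \<phi>"
    and vw: "\<And>i. i \<in> fv \<phi> \<Longrightarrow> v i \<in> insert c (e ` carrier M \<union> Y ` X) \<and> w i = H (v i)"
  shows "sat N v \<phi> \<longleftrightarrow> sat N w \<phi>"
proof -
  define Z where "Z = insert c (Y ` X)"
  define K where "K = (\<lambda>x. if leq N c x then H x else x)"
  define P where "P = {d \<in> carrier N. \<not> leq N c d} \<union> Z"
  have gS: "g x \<in> carrier S" if "x \<in> X" for x using embedding_into[OF g] that by simp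
  have Z: "Z \<subseteq> carrier N" "\<And>z. z \<in> Z \<Longrightarrow> leq N c z" "\<And>z. z \<in> Z \<Longrightarrow> leq N c (H z)"
    using c_in Y_in Y_above X H gS N.leq_refl[OF c_in] by (auto simp: Z_def)
  note l = lift_embedding[OF X g H(2,3), folded Z_def]
  have P: "closed_under (star_lang L) N P" "embedding (star_lang L) (restr N P) N K"
    unfolding P_def K_def
    by (rule N.cone_closed[OF N.arity_pos c_in Z(1,2) l(2,1) Z(3)]
        N.cone_embedding[OF N.arity_pos c_in Z(1,2) l(2,1) Z(3)]; assumption)+
  show ?thesis
  proof (rule rich_sat_iff[OF N.rich _ P \<phi>])
    show "P \<subseteq> carrier N" "P \<noteq> {}" using Z by (auto simp: P_def Z_def)
    fix i assume "i \<in> fv \<phi>"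
    then have *: "v i \<in> insert c (e ` carrier M \<union> Y ` X)" "w i = H (v i)" using vw by auto
    from *(1) consider "v i \<in> Z" | m where "m \<in> carrier M" "v i = e m" by (auto simp: Z_def)
    then show "v i \<in> P \<and> w i = K (v i)"
    proof cases
      case 1
      then show ?thesis using Z(2) *(2) by (simp add: P_def K_def)
    next
      case 2
      then show ?thesis using e_not_above[OF 2(1)] e_in[OF 2(1)] *(2) H(1) by (simp add: P_def K_def)
    qed
  qed
qed

end

section \<open>Indiscernible sequences in a cone\<close>

lemma tm_val_restr: "tm_val (restr N X) v t = tm_val N v t"
proof (induction t)
  case (Fun f ts)
  then have "map (tm_val (restr N X) v) ts = map (tm_val N v) ts" by simp
  then show ?case by (simp only: tm_val.simps) simp
qed simp

lemma sat_restr_qf: "quantifier_free \<phi> \<Longrightarrow> sat (restr N X) v \<phi> \<longleftrightarrow> sat N v \<phi>"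
  by (induction \<phi>) (simp_all add: tm_val_restr cong: map_cong)

lemma same_atoms_restr: "same_atoms L (restr N X) as (restr N X) bs \<longleftrightarrow> same_atoms L N as N bs"
  using atoms_props(2)[of _ L "length as"] by (auto simp: same_atoms_def sat_at_def sat_restr_qf)

lemma same_atoms_partial:
  assumes L: "finite_relational L" and same: "same_atoms L S as S bs"
    and in_S: "set as \<subseteq> carrier S" "set bs \<subseteq> carrier S"
  obtains g where "embedding L (restr S (set as)) S g" "map g as = bs"
proof (cases "as = []")
  case True
  have "embedding L (restr S (set as)) S id"
    using L True by (auto simp: embedding_def finite_relational_def tuple_def)
  moreover have "map id as = bs" using same True by (simp add: same_atoms_def)
  ultimately show thesis using that by blast
next
  case False
  have "same_atoms L (restr S (set as)) as S bs"
    using same atoms_props(2)[of _ L "length as"] by (auto simp: same_atoms_def sat_at_def sat_restr_qf)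
  moreover have "is_structure L (restr S (set as))"
    using L False by (simp add: is_structure_restr closed_under_def finite_relational_def)
  ultimately show thesis using same_atoms_embedding[of L "restr S (set as)" as S bs] in_S(2) that by auto
qed

text \<open>
  By quantifier elimination, indiscernibility in a model of \<open>T\<close> only concerns the atomic formulas. Unlike
  indiscernibility, this makes sense in the substructure on the points that are relevant.
\<close>

definition qf_indiscernible ::
  "('f, 'r) language \<Rightarrow> ('a, 'f, 'r) struc \<Rightarrow> 'a set \<Rightarrow> (nat \<Rightarrow> 'a list) \<Rightarrow> bool" where
  "qf_indiscernible L S A I \<longleftrightarrow>
    (\<exists>l. (\<forall>i. tuple S l (I i)) \<and>
      (\<forall>is js p. sorted_wrt (<) is \<and> sorted_wrt (<) js \<and> length is = length js \<and> set p \<subseteq> A \<longrightarrow>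
        same_atoms L S (concat (map I is) @ p) S (concat (map I js) @ p)))"

lemma length_concat_const:
  "(\<And>xs. xs \<in> set xss \<Longrightarrow> length xs = l) \<Longrightarrow> length (concat xss) = length xss * l"
  by (induction xss) auto

lemma length_concat_tuples:
  assumes "\<And>i. tuple S l (I i)"
  shows "length (concat (map I is)) = length is * l"
  using assms by (subst length_concat_const[where l = l]) (auto simp: tuple_def)

theorem indiscernible_iff_qf:
  assumes L: "finite_relational L" and N: "rich L K N" and X: "A \<subseteq> X" "X \<subseteq> carrier N"
    and I: "\<And>i. set (I i) \<subseteq> X"
  shows "indiscernible L N A I \<longleftrightarrow> qf_indiscernible L (restr N X) A I"
proof
  assume "indiscernible L N A I"
  then obtain l where l: "\<And>i. tuple N l (I i)" and
    *: "\<And>is js \<phi> p. sorted_wrt (<) is \<Longrightarrow> sorted_wrt (<) js \<Longrightarrow> length is = length js \<Longrightarrow>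
      (\<phi>, p) \<in> forms_over L (length is * l) A \<Longrightarrow>
      sat_at N (concat (map I is) @ p) \<phi> \<longleftrightarrow> sat_at N (concat (map I js) @ p) \<phi>"
    unfolding indiscernible_def by blast
  have "same_atoms L N (concat (map I is) @ p) N (concat (map I js) @ p)"
    if "sorted_wrt (<) is" "sorted_wrt (<) js" "length is = length js" "set p \<subseteq> A" for "is" js p
    unfolding same_atoms_def
  proof (intro conjI ballI)
    note len = length_concat_tuples[of N l I, OF l]
    show "length (concat (map I is) @ p) = length (concat (map I js) @ p)" using that(3) len by simp
    fix \<phi> assume "\<phi> \<in> atoms L (length (concat (map I is) @ p))"
    then have "\<phi> \<in> atoms L (length is * l + length p)" using len by simp
    from atoms_props[OF this] have "(\<phi>, p) \<in> forms_over L (length is * l) A"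
      using that(4) by (simp add: forms_over_def)
    then show "sat_at N (concat (map I is) @ p) \<phi> \<longleftrightarrow> sat_at N (concat (map I js) @ p) \<phi>"
      by (rule *[OF that(1-3)])
  qed
  moreover have "tuple (restr N X) l (I i)" for i using l[of i] I[of i] by (simp add: tuple_def)
  ultimately show "qf_indiscernible L (restr N X) A I"
    unfolding qf_indiscernible_def same_atoms_restr by blast
next
  assume "qf_indiscernible L (restr N X) A I"
  then obtain l where l: "\<And>i. tuple (restr N X) l (I i)" and
    *: "\<And>is js p. sorted_wrt (<) is \<Longrightarrow> sorted_wrt (<) js \<Longrightarrow> length is = length js \<Longrightarrow> set p \<subseteq> A \<Longrightarrow>
      same_atoms L N (concat (map I is) @ p) N (concat (map I js) @ p)"
    unfolding qf_indiscernible_def same_atoms_restr by blast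
  have "sat_at N (concat (map I is) @ p) \<phi> \<longleftrightarrow> sat_at N (concat (map I js) @ p) \<phi>"
    if a: "sorted_wrt (<) is" "sorted_wrt (<) js" "length is = length js"
      and \<phi>p: "(\<phi>, p) \<in> forms_over L (length is * l) A" for "is" js \<phi> p
  proof -
    define as where "as = concat (map I is) @ p"
    define bs where "bs = concat (map I js) @ p"
    have p: "set p \<subseteq> A" and wf: "wf_fm L \<phi>" and fv: "fv \<phi> \<subseteq> {..<length is * l + length p}"
      using \<phi>p by (auto simp: forms_over_def)
    have len: "length as = length is * l + length p"
      using length_concat_tuples[of "restr N X" l I, OF l] by (simp add: as_def)
    have in_N: "set as \<subseteq> carrier N" "set bs \<subseteq> carrier N"
      using I X p by (auto simp: as_def bs_def)
    have same: "same_atoms L N as N bs" unfolding as_def bs_def by (rule *[OF a p])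
    obtain g where g: "embedding L (restr N (set as)) N g" "map g as = bs"
      by (rule same_atoms_partial[OF L same in_N])
    show ?thesis
    proof (cases "as = []")
      case True
      then have "bs = []" using g(2) by simp
      then have "as = bs" using True by simp
      then show ?thesis by (simp add: as_def bs_def)
    next
      case False
      have "sat N ((!) as) \<phi> \<longleftrightarrow> sat N ((!) bs) \<phi>"
      proof (rule rich_sat_iff[OF N in_N(1) _ g(1) wf])
        show "closed_under L N (set as)"
          using L by (simp add: closed_under_def finite_relational_def)
        show "set as \<noteq> {}" using False by simp
        fix i assume "i \<in> fv \<phi>"
        then have "i < length as" using fv len by auto
        then show "as ! i \<in> set as \<and> bs ! i = g (as ! i)" using g(2) by auto
      qed
      then show ?thesis by (simp add: sat_at_def as_def bs_def)
    qed
  qed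
  moreover have "tuple N l (I i)" for i using l[of i] X by (auto simp: tuple_def)
  ultimately show "indiscernible L N A I" unfolding indiscernible_def by blast
qed

lemma concat_nth_const:
  "(\<And>xs. xs \<in> set xss \<Longrightarrow> length xs = l) \<Longrightarrow> k < length xss \<Longrightarrow> r < l \<Longrightarrow>
    concat xss ! (k * l + r) = xss ! k ! r"
proof (induction xss arbitrary: k)
  case (Cons xs xss)
  then show ?case by (cases k) (auto simp: nth_append)
qed simp

lemma less_times_Suc: "k < m \<Longrightarrow> r < l \<Longrightarrow> k * l + r < m * (l :: nat)"
proof -
  assume "k < m" "r < l"
  then have "k * l + r < Suc k * l" "Suc k * l \<le> m * l"
    by (simp, intro mult_le_mono1) simp
  then show ?thesis by simp
qed

text \<open>
  In a concatenation of blocks of length \<open>l\<close>, of which there are \<open>m\<close>, followed by parameters: where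
  the \<open>i\<close>-th entry goes when a new entry is put in front of every block.
\<close>

definition shift_pos :: "nat \<Rightarrow> nat \<Rightarrow> nat \<Rightarrow> nat" where
  "shift_pos m l i =
    (if i < m * l then (i div l) * Suc l + Suc (i mod l) else m * Suc l + (i - m * l))"

lemma shift_pos:
  assumes I: "\<And>i. length (I i) = l" and i: "i < length is * l + length p"
  shows "shift_pos (length is) l i < length is * Suc l + length p"
    "(concat (map (\<lambda>i. c # map Y (I i)) is) @ map Y p) ! shift_pos (length is) l i =
      Y ((concat (map I is) @ p) ! i)"
proof -
  let ?J = "\<lambda>i. c # map Y (I i)" and ?m = "length is"
  have lenI: "length (concat (map I is)) = ?m * l"
    by (subst length_concat_const[where l = l]) (auto simp: I)
  have lenJ: "length (concat (map ?J is)) = ?m * Suc l"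
    by (subst length_concat_const[where l = "Suc l"]) (auto simp: I)
  have "shift_pos ?m l i < ?m * Suc l + length p \<and>
    (concat (map ?J is) @ map Y p) ! shift_pos ?m l i = Y ((concat (map I is) @ p) ! i)"
  proof (cases "i < ?m * l")
    case True
    define k where "k = i div l"
    define r where "r = i mod l"
    have l: "l > 0" using True by (cases l) auto
    have k: "k < ?m" using True by (simp add: k_def less_mult_imp_div_less)
    have r: "r < l" "i = k * l + r" using l by (simp_all add: r_def k_def)
    have pos: "shift_pos ?m l i = k * Suc l + Suc r" using True by (simp add: shift_pos_def k_def r_def)
    have lt: "k * Suc l + Suc r < ?m * Suc l" using less_times_Suc[OF k, of "Suc r" "Suc l"] r by simp
    have "concat (map ?J is) ! (k * Suc l + Suc r) = map ?J is ! k ! Suc r"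
      by (rule concat_nth_const) (use I k r in auto)
    moreover have "concat (map I is) ! (k * l + r) = map I is ! k ! r"
      by (rule concat_nth_const) (use I k r in auto)
    moreover have "k * l + r < ?m * l" using True r by simp
    ultimately show ?thesis
      using pos lt lenI lenJ k r I by (simp add: nth_append del: mult_Suc_right)
  next
    case False
    then have pos: "shift_pos ?m l i = ?m * Suc l + (i - ?m * l)" by (simp add: shift_pos_def)
    obtain j where j: "i = ?m * l + j" using False by (metis le_Suc_ex not_less)
    then show ?thesis using pos i lenI lenJ by (simp add: nth_append del: mult_Suc_right)
  qed
  then show "shift_pos ?m l i < ?m * Suc l + length p"
    "(concat (map ?J is) @ map Y p) ! shift_pos ?m l i = Y ((concat (map I is) @ p) ! i)" by auto
qed

context cone_extension
begin

text \<open>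
  The point \<open>c\<close> is made part of every tuple. It is outside \<open>M\<close>, and so it would otherwise not be
  available to the formulas \<open>\<psi>\<^sup>*(c, y)\<close> that witness a failure of indiscernibility.
\<close>

definition lift_seq :: "(nat \<Rightarrow> 'n list) \<Rightarrow> nat \<Rightarrow> 'u list" where
  "lift_seq I i = c # map Y (I i)"

lemma lift_tuple: "tuple S l (I i) \<Longrightarrow> tuple N (Suc l) (lift_seq I i)"
  using c_in Y_in by (auto simp: tuple_def lift_seq_def)

lemma lift_map_eq:
  assumes as: "X \<subseteq> carrier S"
  shows "\<exists>H. (\<forall>m\<in>carrier M. H (e m) = e m) \<and> H c = c \<and> (\<forall>x\<in>X. H (Y x) = Y (g x))"
proof -
  define H where "H z = (if z \<in> Y ` X then Y (g (inv_into (carrier S) Y z)) else z)" for z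
  have inj: "inj_on Y (carrier S)" using Y_eq_iff by (auto simp: inj_on_def)
  have "H (e m) = e m" if "m \<in> carrier M" for m
  proof -
    have "e m \<notin> Y ` X" using e_not_above[OF that] Y_above as by (metis imageE subsetD)
    then show ?thesis by (simp add: H_def)
  qed
  moreover have "H c = c"
  proof -
    have "c \<notin> Y ` X" using Y_above as by (metis imageE subsetD)
    then show ?thesis by (simp add: H_def)
  qed
  moreover have "H (Y x) = Y (g x)" if "x \<in> X" for x
  proof -
    have "inv_into (carrier S) Y (Y x) = x" by (rule inv_into_f_f[OF inj]) (use that as in auto)
    then show ?thesis using that by (simp add: H_def)
  qed
  ultimately show ?thesis by (intro exI[of _ H]) simp
qed

text \<open>
  Given increasing \<open>is\<close> and \<open>js\<close> and parameters, indiscernibility in \<open>S\<close> provides a partial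
  isomorphism of \<open>S\<close> that maps one tuple to the other and fixes the parameters, and \<open>lift_sat\<close> makes
  of it a map that preserves all formulas of the tree with parameters in \<open>M\<close>.
\<close>

theorem lift_mutually_indiscernible:
  assumes I: "\<And>\<alpha>. \<alpha> \<in> K \<Longrightarrow> qf_indiscernible L S (\<Union>\<beta>\<in>K - {\<alpha>}. \<Union>i. set (I \<beta> i)) (I \<alpha>)"
  shows "mutually_indiscernible (star_lang L) N (e ` carrier M) K (\<lambda>\<alpha>. lift_seq (I \<alpha>))"
  unfolding mutually_indiscernible_def
proof
  fix \<alpha> assume \<alpha>: "\<alpha> \<in> K"
  define D where "D = (\<Union>\<beta>\<in>K - {\<alpha>}. \<Union>i. set (I \<beta> i))"
  have I_in: "set (I \<beta> i) \<subseteq> carrier S" if "\<beta> \<in> K" for \<beta> i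
    using I[OF that] by (auto simp: qf_indiscernible_def tuple_def)
  have D: "D \<subseteq> carrier S" using I_in by (auto simp: D_def)
  from I[OF \<alpha>, folded D_def] obtain l where l: "\<And>i. tuple S l (I \<alpha> i)" and
    same: "\<And>is js p. sorted_wrt (<) is \<Longrightarrow> sorted_wrt (<) js \<Longrightarrow> length is = length js \<Longrightarrow> set p \<subseteq> D \<Longrightarrow>
      same_atoms L S (concat (map (I \<alpha>) is) @ p) S (concat (map (I \<alpha>) js) @ p)"
    unfolding qf_indiscernible_def by blast
  let ?J = "lift_seq (I \<alpha>)"
  have J: "tuple N (Suc l) (?J i)" for i by (rule lift_tuple) (rule l)
  let ?A = "e ` carrier M \<union> (\<Union>\<beta>\<in>K - {\<alpha>}. \<Union>i. set (lift_seq (I \<beta>) i))"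
  have A: "?A \<subseteq> insert c (e ` carrier M \<union> Y ` D)" by (auto simp: lift_seq_def D_def)
  have "sat_at N (concat (map ?J is) @ p) \<phi> \<longleftrightarrow> sat_at N (concat (map ?J js) @ p) \<phi>"
    if a: "sorted_wrt (<) is" "sorted_wrt (<) js" "length is = length js"
      and \<phi>p: "(\<phi>, p) \<in> forms_over (star_lang L) (length is * Suc l) ?A" for "is" js \<phi> p
  proof -
    have p: "set p \<subseteq> ?A" and wf: "wf_fm (star_lang L) \<phi>"
      and fv: "fv \<phi> \<subseteq> {..<length is * Suc l + length p}" using \<phi>p by (auto simp: forms_over_def)
    have "finite {x \<in> D. Y x \<in> set p}"
    proof (rule finite_subset)
      show "{x \<in> D. Y x \<in> set p} \<subseteq> inv_into (carrier S) Y ` set p"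
      proof
        fix x assume x: "x \<in> {x \<in> D. Y x \<in> set p}"
        have "inj_on Y (carrier S)" using Y_eq_iff by (auto simp: inj_on_def)
        then have "x = inv_into (carrier S) Y (Y x)" using x D by (intro inv_into_f_f[symmetric]) auto
        then show "x \<in> inv_into (carrier S) Y ` set p" using x by blast
      qed
    qed simp
    then obtain p0 where p0: "set p0 = {x \<in> D. Y x \<in> set p}" using finite_list by blast
    define as where "as = concat (map (I \<alpha>) is) @ p0"
    define bs where "bs = concat (map (I \<alpha>) js) @ p0"
    have in_S: "set as \<subseteq> carrier S" "set bs \<subseteq> carrier S"
      using I_in[OF \<alpha>] p0 D by (auto simp: as_def bs_def)
    have same': "same_atoms L S as S bs"
      unfolding as_def bs_def by (rule same[OF a]) (use p0 in auto)
    obtain g where g: "embedding L (restr S (set as)) S g" "map g as = bs"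
      by (rule same_atoms_partial[OF L same' in_S])
    from lift_map_eq[OF in_S(1), of g] obtain H where H: "\<And>m. m \<in> carrier M \<Longrightarrow> H (e m) = e m"
      "H c = c" "\<And>x. x \<in> set as \<Longrightarrow> H (Y x) = Y (g x)" by blast
    have gs: "map g (concat (map (I \<alpha>) is)) = concat (map (I \<alpha>) js)" "map g p0 = p0"
      using g(2) length_concat_tuples[of S l "I \<alpha>", OF l] a(3) by (auto simp: as_def bs_def)
    have I_eq: "map (map g) (map (I \<alpha>) is) = map (I \<alpha>) js"
    proof (rule concat_eq_concat_iff[THEN iffD1, rotated 2])
      show "concat (map (map g) (map (I \<alpha>) is)) = concat (map (I \<alpha>) js)"
        using gs(1) by (simp add: map_concat)
      show "\<forall>(x, y)\<in>set (zip (map (map g) (map (I \<alpha>) is)) (map (I \<alpha>) js)). length x = length y"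
        using l a(3) by (auto simp: tuple_def set_zip)
    qed (simp add: a(3))
    have gI: "map g (I \<alpha> (is ! k)) = I \<alpha> (js ! k)" if "k < length is" for k
      using that a(3) arg_cong[of _ _ "\<lambda>xs. xs ! k", OF I_eq] by simp
    have HJ: "map (map H) (map ?J is) = map ?J js"
    proof (rule nth_equalityI)
      fix k assume "k < length (map (map H) (map ?J is))"
      then have k: "k < length is" by simp
      then have "is ! k \<in> set is" by simp
      then have "set (I \<alpha> (is ! k)) \<subseteq> set as" unfolding as_def by fastforce
      then have "map H (map Y (I \<alpha> (is ! k))) = map Y (map g (I \<alpha> (is ! k)))" using H(3) by auto
      then show "map (map H) (map ?J is) ! k = map ?J js ! k"
        using k a(3) gI[OF k] H(2) by (simp add: lift_seq_def)
    qed (simp add: a(3))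
    have Hp: "map H p = p"
    proof (rule map_idI)
      fix z assume z: "z \<in> set p"
      then consider "z = c" | m where "m \<in> carrier M" "z = e m" | x where "x \<in> D" "z = Y x"
        using p A by blast
      then show "H z = z"
      proof cases
        case 3
        then have "x \<in> set p0" using z p0 by simp
        moreover from this have "g x = x" using gs(2) map_eq_conv[of g p0 id] by simp
        ultimately show ?thesis using H(3)[of x] 3 by (simp add: as_def)
      qed (use H in auto)
    qed
    have map_eq: "map H (concat (map ?J is) @ p) = concat (map ?J js) @ p"
      using HJ Hp by (simp add: map_concat)
    have len: "length (concat (map ?J is) @ p) = length is * Suc l + length p"
      using length_concat_tuples[of N "Suc l" ?J, OF J] by simp
    show ?thesis
      unfolding sat_at_def
    proof (rule lift_sat[OF in_S(1) g(1) H wf])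
      fix i assume "i \<in> fv \<phi>"
      then have i: "i < length (concat (map ?J is) @ p)" using fv len by auto
      have "set (concat (map ?J is) @ p) \<subseteq> insert c (e ` carrier M \<union> Y ` set as)"
      proof -
        have "set p \<subseteq> insert c (e ` carrier M \<union> Y ` set as)"
        proof
          fix z assume z: "z \<in> set p"
          then consider "z = c" | m where "m \<in> carrier M" "z = e m" | x where "x \<in> D" "z = Y x"
            using p A by blast
          then show "z \<in> insert c (e ` carrier M \<union> Y ` set as)"
          proof cases
            case 3
            then have "x \<in> set as" using z p0 by (simp add: as_def)
            then show ?thesis using 3 by blast
          qed auto
        qed
        then show ?thesis by (auto simp: lift_seq_def as_def)
      qed
      moreover have "(concat (map ?J js) @ p) ! i = H ((concat (map ?J is) @ p) ! i)"
        using nth_map[OF i, of H] unfolding map_eq .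
      ultimately show "(concat (map ?J is) @ p) ! i \<in> insert c (e ` carrier M \<union> Y ` set as) \<and>
        (concat (map ?J js) @ p) ! i = H ((concat (map ?J is) @ p) ! i)"
        using nth_mem[OF i] by blast
    qed
  qed
  then show "indiscernible (star_lang L) N ?A ?J"
    unfolding indiscernible_def using J by (intro exI[of _ "Suc l"]) blast
qed

text \<open>
  This is \<open>star_fm\<close> with the variables renamed: \<open>c\<close> sits in position \<open>0\<close>, and \<open>pos\<close> tells where the
  points of the cone are.
\<close>

lemma atom_translation:
  assumes "\<phi> \<in> atoms L n"
  obtains \<chi> where "wf_fm (star_lang L) \<chi>" "fv \<chi> \<subseteq> insert 0 (pos ` {..<n})"
    "\<And>zs as. zs ! 0 = c \<Longrightarrow> (\<And>i. i < n \<Longrightarrow> as ! i \<in> carrier S \<and> zs ! pos i = Y (as ! i)) \<Longrightarrow>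
      sat_at N zs \<chi> \<longleftrightarrow> sat_at S as \<phi>"
proof -
  from assms no_funs consider i j where "\<phi> = Eq (Var i) (Var j)" "i < n" "j < n"
    | R ks where "\<phi> = Rel R (map Var ks)" "R \<in> rel_syms L" "length ks = rel_ar L R" "set ks \<subseteq> {..<n}"
    by (auto simp: atoms_def)
  then show thesis
  proof cases
    case (1 i j)
    show ?thesis
      by (rule that[of "lt (Var 0) (meet (Var (pos i)) (Var (pos j)))"])
        (use 1 mt_Y_less in \<open>auto simp: lt_def le_def meet_def sat_at_def\<close>)
  next
    case (2 R ks)
    show ?thesis
    proof (rule that[of "Rel (Star R) (Var 0 # map (\<lambda>k. Var (pos k)) ks)"])
      fix zs as assume *: "zs ! 0 = c" "\<And>i. i < n \<Longrightarrow> as ! i \<in> carrier S \<and> zs ! pos i = Y (as ! i)"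
      have "map (\<lambda>k. zs ! pos k) ks = map Y (map ((!) as) ks)" using * 2(4) by auto
      moreover have "star N R c (map Y (map ((!) as) ks)) \<longleftrightarrow> rel_int S R (map ((!) as) ks)"
        by (rule cone_copy_star[OF copy 2(2)]) (use * 2 in \<open>auto simp: tuple_def\<close>)
      ultimately have "star N R c (map (\<lambda>k. zs ! pos k) ks) \<longleftrightarrow> rel_int S R (map ((!) as) ks)"
        by (simp only:)
      then show "sat_at N zs (Rel (Star R) (Var 0 # map (\<lambda>k. Var (pos k)) ks)) \<longleftrightarrow> sat_at S as \<phi>"
        using *(1) 2(1) by (simp add: sat_at_def comp_def)
    qed (use 2 in auto)
  qed
qed

theorem qf_indiscernible_if_lift:
  assumes l: "\<And>i. tuple S l (I i)" and b: "b \<in> carrier S"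
    and ind: "indiscernible (star_lang L) N (A \<union> {Y b}) (lift_seq I)"
  shows "qf_indiscernible L S {b} I"
proof -
  from ind obtain l' where l': "\<And>i. tuple N l' (lift_seq I i)" and
    *: "\<And>is js \<phi> p. sorted_wrt (<) is \<Longrightarrow> sorted_wrt (<) js \<Longrightarrow> length is = length js \<Longrightarrow>
      (\<phi>, p) \<in> forms_over (star_lang L) (length is * l') (A \<union> {Y b}) \<Longrightarrow>
      sat_at N (concat (map (lift_seq I) is) @ p) \<phi> \<longleftrightarrow> sat_at N (concat (map (lift_seq I) js) @ p) \<phi>"
    unfolding indiscernible_def by blast
  have l'_eq: "l' = Suc l" using l'[of 0] l[of 0] by (simp add: tuple_def lift_seq_def)
  have lenI: "length (I i) = l" for i using l by (simp add: tuple_def)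
  have "same_atoms L S (concat (map I is) @ p) S (concat (map I js) @ p)"
    if a: "sorted_wrt (<) is" "sorted_wrt (<) js" "length is = length js" and p: "set p \<subseteq> {b}" for "is" js p
  proof (cases "is = []")
    case True
    then show ?thesis using a(3) by (simp add: same_atoms_def)
  next
    case False
    define m where "m = length is"
    define n where "n = m * l + length p"
    have m0: "m > 0" using False by (simp add: m_def)
    note len = length_concat_tuples[of S l I, OF l]
    have zs: "(concat (map (lift_seq I) ks) @ map Y p) ! 0 = c \<and>
      (\<forall>i<n. (concat (map I ks) @ p) ! i \<in> carrier S \<and>
        (concat (map (lift_seq I) ks) @ map Y p) ! shift_pos m l i = Y ((concat (map I ks) @ p) ! i))"
      if ks: "length ks = m" for ks
    proof (intro conjI allI impI)
      obtain k ks' where "ks = k # ks'" using ks m0 by (cases ks) auto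
      then show "(concat (map (lift_seq I) ks) @ map Y p) ! 0 = c" by (simp add: lift_seq_def)
      fix i assume i: "i < n"
      have "set (concat (map I ks) @ p) \<subseteq> carrier S"
        using l p b by (auto simp: tuple_def)
      moreover have "i < length (concat (map I ks) @ p)" using i ks len by (simp add: n_def)
      ultimately show "(concat (map I ks) @ p) ! i \<in> carrier S" using nth_mem by blast
      show "(concat (map (lift_seq I) ks) @ map Y p) ! shift_pos m l i = Y ((concat (map I ks) @ p) ! i)"
        using shift_pos(2)[of I l i ks p c Y, OF lenI] i ks by (simp add: n_def lift_seq_def[abs_def])
    qed
    show ?thesis
      unfolding same_atoms_def
    proof (intro conjI ballI)
      show "length (concat (map I is) @ p) = length (concat (map I js) @ p)" using a(3) len by simp
      fix \<phi> assume "\<phi> \<in> atoms L (length (concat (map I is) @ p))"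
      then have "\<phi> \<in> atoms L n" using len by (simp add: n_def m_def)
      from atom_translation[where pos = "shift_pos m l", OF this] obtain \<chi> where
        \<chi>: "wf_fm (star_lang L) \<chi>" "fv \<chi> \<subseteq> insert 0 (shift_pos m l ` {..<n})" and
        sat: "\<And>zs as. zs ! 0 = c \<Longrightarrow>
          (\<And>i. i < n \<Longrightarrow> as ! i \<in> carrier S \<and> zs ! shift_pos m l i = Y (as ! i)) \<Longrightarrow>
          sat_at N zs \<chi> \<longleftrightarrow> sat_at S as \<phi>" by blast
      have "shift_pos m l i < m * Suc l + length p" if "i < n" for i
        using shift_pos(1)[of I l i "is" p, OF lenI] that by (simp add: n_def m_def)
      then have "fv \<chi> \<subseteq> {..<m * Suc l + length (map Y p)}" using \<chi>(2) m0 by auto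
      then have "(\<chi>, map Y p) \<in> forms_over (star_lang L) (length is * l') (A \<union> {Y b})"
        using \<chi>(1) p by (auto simp: forms_over_def l'_eq m_def)
      from *[OF a this]
      show "sat_at S (concat (map I is) @ p) \<phi> \<longleftrightarrow> sat_at S (concat (map I js) @ p) \<phi>"
        using sat[of "concat (map (lift_seq I) is) @ map Y p" "concat (map I is) @ p"]
          sat[of "concat (map (lift_seq I) js) @ map Y p" "concat (map I js) @ p"]
          zs[of "is"] zs[of js] a(3) by (simp add: m_def)
    qed
  qed
  then show ?thesis unfolding qf_indiscernible_def using l by blast
qed

end

section \<open>The dp-rank above a branch\<close>

text \<open>
  The hypotheses of the theorem that concern \<open>T\<^sup>*\<close> and the branch.
\<close>

locale branch_type =
  fixes L :: "('f, 'r) language" and U :: "('f, 'r) fm set"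
    and Fs :: "('d, tree_fun, 'r tree_rel) struc" and M :: "('m, tree_fun, 'r tree_rel) struc"
    and B :: "'m set" and q :: "((tree_fun, 'r tree_rel) fm \<times> 'm list) set"
  assumes L: "finite_relational L" and U: "universal_theory L U"
    and limit: "fraisse_limit (star_lang L) (finite_models (star_lang L) (star_theory L U)) Fs"
    and M: "models (star_lang L) M (Th (star_lang L) Fs)" and B: "branch M B"
    and q: "complete_type (star_lang L) M 1 (carrier M) q" "above_branch B \<subseteq> q"

sublocale branch_type \<subseteq> star_model L M U
  by (rule star_model_if_limit[OF L U limit M])

context branch_type
begin

lemma elementary_extension_star_model:
  assumes "is_structure (star_lang L) N" "elementary_embedding (star_lang L) M N e"
  shows "star_model L N U"
  by (rule star_model_if_limit[OF L U limit elementary_embedding_models[OF assms M]])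

lemma finite_models_nonempty:
  assumes "carrier N \<noteq> {}" "\<And>\<psi>. \<psi> \<in> U \<Longrightarrow> holds N \<psi>"
  shows "finite_models L U \<noteq> {}"
proof -
  obtain a where "a \<in> carrier N" using assms(1) by auto
  then have "copy (\<lambda>_. 0) (restr N {a}) \<in> finite_models L U"
    by (intro finite_copy_in_finite_models[OF L U assms(2)]) auto
  then show ?thesis by auto
qed

end

text \<open>
  An infinite type \<open>'u\<close> that has room for the index set \<open>K\<close> also has room for the entries of
  countable sequences of finite tuples indexed by \<open>K\<close>. Hence it does not matter how large the model of
  \<open>T\<close> is from which the sequences are taken.
\<close>

lemma enumerate_entries:
  fixes I :: "'k \<Rightarrow> nat \<Rightarrow> 'n list" and t :: "'k \<Rightarrow> 'u"
  assumes inf: "infinite (UNIV :: 'u set)" and t: "inj_on t K"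
  obtains j :: "'u \<Rightarrow> 'n" where "range j = insert b (\<Union>\<alpha>\<in>K. \<Union>i. set (I \<alpha> i))"
proof -
  obtain p :: "'u \<times> 'u \<Rightarrow> 'u" where p: "inj p" by (rule infinite_pairing[OF inf])
  obtain z :: "nat \<Rightarrow> 'u" where z: "inj z" by (rule infinite_nat_embedding[OF inf])
  have p_eq: "p x = p y \<longleftrightarrow> x = y" for x y using p by (auto dest: injD)
  have z_eq: "z x = z y \<longleftrightarrow> x = y" for x y using z by (auto dest: injD)
  define D where "D = {(\<alpha>, i, n). \<alpha> \<in> K \<and> n < length (I \<alpha> i)}"
  \<comment> \<open>The tag \<open>z 1\<close> keeps \<open>p (z 0, z 0)\<close> free, which enumerates \<open>b\<close>.\<close>
  define code where "code = (\<lambda>(\<alpha>, i, n). p (z 1, p (t \<alpha>, p (z i, z n))))"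
  define entry where "entry = (\<lambda>(\<alpha>, i, n). I \<alpha> i ! n)"
  have code: "inj_on code D"
    using t by (auto simp: code_def D_def inj_on_def p_eq z_eq)
  define j where "j u = (if u \<in> code ` D then entry (inv_into D code u) else b)" for u
  have "p (z 0, z 0) \<notin> code ` D" by (auto simp: code_def p_eq z_eq)
  then have "j (p (z 0, z 0)) = b" by (simp add: j_def)
  then have "b \<in> range j" by (metis rangeI)
  moreover have "entry d \<in> range j" if "d \<in> D" for d
  proof -
    have "j (code d) = entry d" using that code by (simp add: j_def)
    then show ?thesis by (metis rangeI)
  qed
  moreover have "(\<Union>\<alpha>\<in>K. \<Union>i. set (I \<alpha> i)) = entry ` D"
    by (force simp: entry_def D_def in_set_conv_nth image_iff)
  moreover have "range j \<subseteq> insert b (entry ` D)"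
    by (auto simp: j_def inv_into_into)
  ultimately show thesis using that[of j] by (metis (no_types, lifting) image_subsetI insert_subset subset_antisym)
qed

lemma card_fits_injection:
  assumes "Card_order \<kappa>" "card_fits \<kappa> TYPE('u)"
  obtains t :: "'k \<Rightarrow> 'u" where "inj_on t (Field (\<kappa> :: 'k rel))"
proof -
  have "(card_of (Field \<kappa>), card_of (UNIV :: 'u set)) \<in> ordLeq"
    using ordIso_ordLeq_trans[OF card_of_Field_ordIso[OF assms(1)]] assms(2)
    by (simp add: card_fits_def)
  then show thesis using that unfolding card_of_ordLeq[symmetric] by blast
qed

context branch_type
begin

text \<open>
  Lift the sequences and the point \<open>b0\<close> from \<open>N0\<close> to a cone above \<open>B\<close>. The lifted sequences are
  mutually indiscernible over \<open>M\<close>, and \<open>Y b0\<close> realizes \<open>q\<close>, so one of them is indiscernible over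
  \<open>Y b0\<close>. This sequence is already indiscernible over \<open>b0\<close> in \<open>N0\<close>.
\<close>

theorem dpr_less_in_cone:
  fixes N0 :: "('v, 'f, 'r) struc" and \<kappa> :: "'k rel"
  assumes inf: "infinite (UNIV :: 'u set)" and fits: "set_fits (carrier M) TYPE('u)"
    and N0: "rich L (finite_models L U) N0" "\<And>\<psi>. \<psi> \<in> U \<Longrightarrow> holds N0 \<psi>"
    and \<kappa>: "Card_order \<kappa>" "card_fits \<kappa> TYPE('u)"
    and less: "dpr_less TYPE('u) (star_lang L) M (carrier M) 1 q \<kappa>"
  shows "dpr_less_in L N0 {} 1 {(Eq (Var 0) (Var 0), [])} \<kappa>"
  unfolding dpr_less_in_def
proof (intro allI impI, elim conjE)
  fix I b
  assume mut: "mutually_indiscernible L N0 {} (Field \<kappa>) I"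
    and real: "realizes N0 1 {(Eq (Var 0) (Var 0), [])} b"
  obtain b0 where b0: "b = [b0]" "b0 \<in> carrier N0"
    using real by (auto simp: realizes_def tuple_def length_Suc_conv)
  obtain t :: "'k \<Rightarrow> 'u" where t: "inj_on t (Field \<kappa>)" by (rule card_fits_injection[OF \<kappa>])
  define X where "X = insert b0 (\<Union>\<alpha>\<in>Field \<kappa>. \<Union>i. set (I \<alpha> i))"
  obtain j :: "'u \<Rightarrow> 'v" where j: "range j = X"
    unfolding X_def by (rule enumerate_entries[OF inf t])
  have ind: "indiscernible L N0 (\<Union>\<beta>\<in>Field \<kappa> - {\<alpha>}. \<Union>i. set (I \<beta> i)) (I \<alpha>)" if "\<alpha> \<in> Field \<kappa>" for \<alpha>
    using mut that by (simp add: mutually_indiscernible_def)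
  have X: "X \<subseteq> carrier N0"
  proof -
    have "set (I \<alpha> i) \<subseteq> carrier N0" if "\<alpha> \<in> Field \<kappa>" for \<alpha> i
      using ind[OF that] by (auto simp: indiscernible_def tuple_def)
    then show ?thesis using b0 by (auto simp: X_def)
  qed
  have ne: "carrier N0 \<noteq> {}" using b0 by auto
  obtain N :: "('u, tree_fun, 'r tree_rel) struc" and e :: "'m \<Rightarrow> 'u" and c :: 'u and Y :: "'v \<Rightarrow> 'u"
    where N: "is_structure (star_lang L) N" "elementary_embedding (star_lang L) M N e"
      "\<And>b. b \<in> B \<Longrightarrow> below N (e b) c" "cone_copy L (restr N0 X) N c Y"
  proof (rule cone_realization_structure[OF ne N0(2) B inf fits X j], goal_cases)
    case (1 \<psi>)
    then show ?case by simp
  next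
    case (2 N e c Y)
    show ?case by (rule 2(1)[OF 2(2,3) _ 2(5)]) (rule 2(4))
  qed
  have N_model: "star_model L N U" by (rule elementary_extension_star_model[OF N(1,2)])
  have fm: "finite_models L U \<noteq> {}" by (rule finite_models_nonempty[OF ne N0(2)])
  interpret ext: cone_extension L M U B N e c "restr N0 X" Y
    by (intro cone_extension.intro cone_extension_axioms.intro)
      (rule star_model_axioms fm B N_model N(2) N(4) N(3); assumption)+
  have I_in: "set (I \<alpha> i) \<subseteq> X" if "\<alpha> \<in> Field \<kappa>" for \<alpha> i using that by (auto simp: X_def)
  have qf: "qf_indiscernible L (restr N0 X) (\<Union>\<beta>\<in>Field \<kappa> - {\<alpha>}. \<Union>i. set (I \<beta> i)) (I \<alpha>)"
    if \<alpha>: "\<alpha> \<in> Field \<kappa>" for \<alpha>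
  proof (rule indiscernible_iff_qf[THEN iffD1, OF L N0(1) _ X _ ind[OF \<alpha>]])
    show "(\<Union>\<beta>\<in>Field \<kappa> - {\<alpha>}. \<Union>i. set (I \<beta> i)) \<subseteq> X" using I_in by auto
  qed (rule I_in[OF \<alpha>])
  have "mutually_indiscernible (star_lang L) N (e ` carrier M) (Field \<kappa>) (\<lambda>\<alpha>. ext.lift_seq (I \<alpha>))"
    by (rule ext.lift_mutually_indiscernible) (rule qf)
  moreover have "realizes N 1 (push e q) [Y b0]"
  proof -
    have Y: "Y b0 \<in> carrier N" "below N c (Y b0)"
      using ext.Y_in ext.Y_above by (auto simp: X_def)
    obtain A0 where A0: "A0 \<in> finite_models L U" using fm by auto
    show ?thesis
    proof (rule realizes_above_branch[OF A0 B q N_model N(2) Y(1)])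
      fix b' assume b': "b' \<in> B"
      then have "e b' \<in> carrier N" using branch_subset[OF B] ext.e_in by auto
      then show "below N (e b') (Y b0)"
        using ext.N.less_leq_trans[OF _ ext.c_in Y(1) N(3)[OF b']] Y(2) by simp
    qed
  qed
  moreover have "dpr_less_in (star_lang L) N (e ` carrier M) 1 (push e q) \<kappa>"
    using less N(1,2) by (simp add: dpr_less_def)
  ultimately obtain \<beta> where \<beta>: "\<beta> \<in> Field \<kappa>"
    "indiscernible (star_lang L) N (e ` carrier M \<union> set [Y b0]) (ext.lift_seq (I \<beta>))"
    unfolding dpr_less_in_def by blast
  obtain l where l: "\<And>i. tuple (restr N0 X) l (I \<beta> i)"
    using qf[OF \<beta>(1)] unfolding qf_indiscernible_def by blast
  have qf_b: "qf_indiscernible L (restr N0 X) {b0} (I \<beta>)"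
    by (rule ext.qf_indiscernible_if_lift[OF l _]) (use \<beta>(2) in \<open>auto simp: X_def\<close>)
  have "indiscernible L N0 {b0} (I \<beta>)"
    by (rule indiscernible_iff_qf[THEN iffD2, OF L N0(1) _ X I_in[OF \<beta>(1)] qf_b]) (simp add: X_def)
  then show "\<exists>\<beta>\<in>Field \<kappa>. indiscernible L N0 ({} \<union> set b) (I \<beta>)"
    using \<beta>(1) b0(1) by auto
qed

end

section \<open>Shattering\<close>

definition shatters :: "'a set set \<Rightarrow> 'a set \<Rightarrow> bool" where
  "shatters F S \<longleftrightarrow> (\<forall>T. T \<subseteq> S \<longrightarrow> (\<exists>A\<in>F. A \<inter> S = T))"

lemma shattersD: "shatters F S \<Longrightarrow> T \<subseteq> S \<Longrightarrow> \<exists>A\<in>F. A \<inter> S = T"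
  by (simp add: shatters_def)

lemma shattersI: "(\<And>T. T \<subseteq> S \<Longrightarrow> \<exists>A\<in>F. A \<inter> S = T) \<Longrightarrow> shatters F S"
  by (simp add: shatters_def)

lemma shatters_subset:
  assumes "shatters F S" "S' \<subseteq> S"
  shows "shatters F S'"
  unfolding shatters_def
proof (intro allI impI)
  fix T assume "T \<subseteq> S'"
  then obtain A where "A \<in> F" "A \<inter> S = T" using assms unfolding shatters_def by blast
  then show "\<exists>A\<in>F. A \<inter> S' = T" using \<open>T \<subseteq> S'\<close> assms(2) by (intro bexI[of _ A]) auto
qed

text \<open>
  Pajor's form of the Sauer-Shelah lemma. Fix a point \<open>x\<close> and let \<open>G0\<close> and \<open>G1\<close> be the traces on \<open>V\<close>
  of the sets without and with \<open>x\<close>. A set shattered by \<open>G0 \<union> G1\<close> is shattered by \<open>F\<close>, and if \<open>S\<close> is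
  shattered by \<open>G0 \<inter> G1\<close>, then \<open>insert x S\<close> is shattered by \<open>F\<close>. The two cases contribute
  different sets, and \<open>card F\<close> is the sum of \<open>card (G0 \<union> G1)\<close> and \<open>card (G0 \<inter> G1)\<close>.
\<close>

theorem card_le_card_shattered:
  assumes "finite V" "F \<subseteq> Pow V"
  shows "card F \<le> card {S. S \<subseteq> V \<and> shatters F S}"
  using assms
proof (induction V arbitrary: F rule: finite_induct)
  case empty
  then have "F = {} \<or> F = {{}}" by auto
  then show ?case
  proof
    assume "F = {{}}"
    then have "{S. S \<subseteq> {} \<and> shatters F S} = {{}}" by (auto simp: shatters_def)
    then show ?thesis using \<open>F = {{}}\<close> by simp
  qed simp
next
  case (insert x V)
  define G0 where "G0 = {A \<in> F. x \<notin> A}"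
  define F1 where "F1 = {A \<in> F. x \<in> A}"
  define G1 where "G1 = (\<lambda>A. A - {x}) ` F1"
  have finF: "finite F" using insert by (meson finite.insertI finite_Pow_iff finite_subset)
  have sub: "G0 \<subseteq> Pow V" "G1 \<subseteq> Pow V" using insert.prems by (auto simp: G0_def G1_def F1_def)
  have "inj_on (\<lambda>A. A - {x}) F1" by (rule inj_onI) (auto simp: F1_def)
  then have "card G1 = card F1" by (simp add: G1_def card_image)
  moreover have "card F = card G0 + card F1"
  proof -
    have F: "F = G0 \<union> F1" "G0 \<inter> F1 = {}" unfolding G0_def F1_def by blast+
    have "finite G0" "finite F1" using finF unfolding G0_def F1_def by simp_all
    from card_Un_disjoint[OF this F(2)] show ?thesis unfolding F(1)[symmetric] .
  qed
  moreover have "finite G0" "finite G1" using finF by (auto simp: G0_def G1_def F1_def)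
  ultimately have cF: "card F = card (G0 \<union> G1) + card (G0 \<inter> G1)"
    using card_Un_Int[of G0 G1] by simp
  let ?sh = "\<lambda>V F. {S. S \<subseteq> V \<and> shatters F S}"
  have finsh: "finite (?sh V G)" for G :: "'a set set" using insert.hyps(1) by simp
  have IH: "card (G0 \<union> G1) \<le> card (?sh V (G0 \<union> G1))" "card (G0 \<inter> G1) \<le> card (?sh V (G0 \<inter> G1))"
    using sub by (intro insert.IH; auto)+
  have "?sh V (G0 \<union> G1) \<subseteq> ?sh (insert x V) F"
  proof
    fix S assume S: "S \<in> ?sh V (G0 \<union> G1)"
    then have xS: "x \<notin> S" using insert.hyps(2) by auto
    have "\<exists>A\<in>F. A \<inter> S = T" if T: "T \<subseteq> S" for T
    proof -
      have "shatters (G0 \<union> G1) S" using S by simp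
      from shattersD[OF this T] obtain A where A: "A \<in> G0 \<union> G1" "A \<inter> S = T" by blast
      show ?thesis
      proof (cases "A \<in> G0")
        case True
        then show ?thesis using A(2) by (auto simp: G0_def)
      next
        case False
        then obtain A' where "A' \<in> F" "A = A' - {x}" using A(1) by (auto simp: G1_def F1_def)
        moreover from this have "A' \<inter> S = T" using A(2) xS by auto
        ultimately show ?thesis by blast
      qed
    qed
    then have "shatters F S" by (rule shattersI)
    then show "S \<in> ?sh (insert x V) F" using S by auto
  qed
  moreover have "insert x ` ?sh V (G0 \<inter> G1) \<subseteq> ?sh (insert x V) F"
  proof
    fix S' assume "S' \<in> insert x ` ?sh V (G0 \<inter> G1)"
    then obtain S where S: "S \<subseteq> V" "shatters (G0 \<inter> G1) S" "S' = insert x S" by auto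
    have xS: "x \<notin> S" using S(1) insert.hyps(2) by auto
    have "\<exists>A\<in>F. A \<inter> S' = T" if T: "T \<subseteq> S'" for T
    proof -
      have "T - {x} \<subseteq> S" using T S(3) by auto
      from shattersD[OF S(2) this] obtain A where A: "A \<in> G0 \<inter> G1" "A \<inter> S = T - {x}" by blast
      then have "A \<in> F" "x \<notin> A" by (auto simp: G0_def)
      obtain A' where A': "A' \<in> F" "x \<in> A'" "A = A' - {x}" using A(1) by (auto simp: G1_def F1_def)
      show ?thesis
      proof (cases "x \<in> T")
        case True
        then have "A' \<inter> S' = T" using A(2) A' S(3) T by auto
        then show ?thesis using A'(1) by blast
      next
        case False
        then have "A \<inter> S' = T" using A(2) \<open>x \<notin> A\<close> S(3) by auto
        then show ?thesis using \<open>A \<in> F\<close> by blast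
      qed
    qed
    then have "shatters F S'" by (rule shattersI)
    then show "S' \<in> ?sh (insert x V) F" using S by auto
  qed
  moreover have "?sh V (G0 \<union> G1) \<inter> insert x ` ?sh V (G0 \<inter> G1) = {}"
    using insert.hyps(2) by auto
  moreover have "card (insert x ` ?sh V (G0 \<inter> G1)) = card (?sh V (G0 \<inter> G1))"
    using insert.hyps(2) by (intro card_image inj_onI) (auto simp: insert_ident)
  moreover have "finite (?sh (insert x V) F)" using insert.hyps(1) by simp
  ultimately have "card (?sh V (G0 \<union> G1)) + card (?sh V (G0 \<inter> G1)) \<le> card (?sh (insert x V) F)"
    using finsh card_Un_disjoint[of "?sh V (G0 \<union> G1)" "insert x ` ?sh V (G0 \<inter> G1)"]
      card_mono[of "?sh (insert x V) F" "?sh V (G0 \<union> G1) \<union> insert x ` ?sh V (G0 \<inter> G1)"]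
    by simp
  then show ?case using IH cF by linarith
qed

text \<open>
  A set with fewer than \<open>d\<close> elements is listed by a list of length \<open>d\<close>, padded with \<open>None\<close>.
\<close>

lemma card_small_subsets:
  assumes "finite V"
  shows "card {S. S \<subseteq> V \<and> card S < d} \<le> (card V + 1) ^ d"
proof -
  let ?W = "insert None (Some ` V)"
  let ?l = "{xs. set xs \<subseteq> ?W \<and> length xs = d}"
  have "{S. S \<subseteq> V \<and> card S < d} \<subseteq> (\<lambda>xs. {x. Some x \<in> set xs}) ` ?l"
  proof
    fix S assume S: "S \<in> {S. S \<subseteq> V \<and> card S < d}"
    then have "finite S" using assms finite_subset by blast
    then obtain xs where xs: "set xs = S" "length xs = card S"
      by (metis distinct_card finite_distinct_list)
    let ?ys = "map Some xs @ replicate (d - card S) None"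
    have "?ys \<in> ?l" using S xs by auto
    moreover have "{x. Some x \<in> set ?ys} = S" using xs by auto
    ultimately show "S \<in> (\<lambda>xs. {x. Some x \<in> set xs}) ` ?l" by (intro rev_image_eqI[of ?ys]) simp_all
  qed
  moreover have fin: "finite ?l" using assms by (intro finite_lists_length_eq) simp
  ultimately have "card {S. S \<subseteq> V \<and> card S < d} \<le> card ?l"
    by (meson card_image_le card_mono finite_imageI order_trans)
  also have "\<dots> = card ?W ^ d" using assms by (intro card_lists_length_eq) simp
  also have "card ?W = card V + 1" using assms by (subst card_insert_disjoint) (auto simp: card_image)
  finally show ?thesis .
qed

theorem sauer_shelah:
  assumes V: "finite V" "F \<subseteq> Pow V" and d: "\<And>S. S \<subseteq> V \<Longrightarrow> card S = d \<Longrightarrow> \<not> shatters F S"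
  shows "card F \<le> (card V + 1) ^ d"
proof -
  have "card S < d" if S: "S \<subseteq> V" "shatters F S" for S
  proof (rule ccontr)
    assume "\<not> card S < d"
    then obtain S' where "S' \<subseteq> S" "card S' = d" by (meson not_less obtain_subset_with_card_n)
    then show False using d[of S'] S shatters_subset[OF S(2)] by auto
  qed
  then have "{S. S \<subseteq> V \<and> shatters F S} \<subseteq> {S. S \<subseteq> V \<and> card S < d}" by auto
  then have "card {S. S \<subseteq> V \<and> shatters F S} \<le> card {S. S \<subseteq> V \<and> card S < d}"
    using V(1) by (intro card_mono) auto
  then show ?thesis
    using card_le_card_shattered[OF V] card_small_subsets[OF V(1), of d] by linarith
qed

lemma poly_less_exp:
  fixes a b E :: nat
  shows "\<exists>k. (a * k + b) ^ E < 2 ^ k"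
proof -
  define c where "c = a + b"
  \<comment> \<open>With \<open>j = 2 * t\<close> and \<open>k = 2 ^ j\<close> the claim becomes \<open>E * (j + c) < 2 ^ j\<close>.\<close>
  define t where "t = E * (c + 2)"
  have t: "t + 1 \<le> 2 ^ t" using less_exp[of t] by linarith
  have lin: "E * (2 * t + c) < 2 ^ (2 * t)"
  proof (cases "E = 0")
    case False
    then have t1: "t \<ge> 1" by (simp add: t_def)
    have "E * (2 * t + c) = 2 * E * t + E * c" by (simp add: algebra_simps)
    also have "E * c \<le> E * c * t" using t1 by simp
    then have "2 * E * t + E * c \<le> t * t" by (simp add: t_def algebra_simps)
    also have "t * t < (t + 1) * (t + 1)" by simp
    also have "\<dots> \<le> 2 ^ t * 2 ^ t" using t by (rule mult_le_mono) (use t in simp)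
    also have "\<dots> = 2 ^ (2 * t)" by (simp add: power_add[symmetric] mult_2)
    finally show ?thesis .
  qed simp
  define j where "j = 2 * t"
  have "a * 2 ^ j + b \<le> c * 2 ^ j"
  proof -
    have "b \<le> b * 2 ^ j" by simp
    then show ?thesis by (simp add: c_def algebra_simps)
  qed
  also have "\<dots> \<le> 2 ^ c * 2 ^ j" using less_exp[of c] by simp
  also have "\<dots> = 2 ^ (j + c)" by (simp add: power_add mult.commute)
  finally have "(a * 2 ^ j + b) ^ E \<le> (2 ^ (j + c)) ^ E" by (rule power_mono) simp
  also have "\<dots> = 2 ^ (E * (j + c))" by (simp add: power_mult[symmetric] mult.commute)
  also have "\<dots> < 2 ^ (2 ^ j)" using lin by (intro power_strict_increasing) (simp_all add: j_def)
  finally show ?thesis by blast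
qed

section \<open>The independence property in one variable\<close>

definition substitute :: "nat set \<Rightarrow> 'a \<Rightarrow> 'a list \<Rightarrow> 'a list" where
  "substitute J w t = map (\<lambda>i. if i \<in> J then w else t ! i) [0..<length t]"

text \<open>
  The parameter tuples in \<open>T\<close> that are related to \<open>w\<close> by the formula \<open>R\<close> with a single variable
  in the positions \<open>J\<close>.
\<close>

definition trace :: "('a, 'f, 'r) struc \<Rightarrow> 'r \<Rightarrow> nat set \<Rightarrow> 'a list set \<Rightarrow> 'a \<Rightarrow> 'a list set" where
  "trace N R J T w = {t \<in> T. rel_int N R (substitute J w t)}"

text \<open>
  Having this for all \<open>d\<close> is the independence property of that formula, in dual form: the parameter
  tuples are shattered by the single variable.
\<close>

definition atom_shatters :: "('f, 'r) language \<Rightarrow> ('a, 'f, 'r) struc \<Rightarrow> 'r \<Rightarrow> nat set \<Rightarrow> nat \<Rightarrow> bool" where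
  "atom_shatters L N R J d \<longleftrightarrow>
    (\<exists>T. finite T \<and> card T = d \<and> (\<forall>t\<in>T. tuple N (rel_ar L R) t) \<and>
      shatters (trace N R J T ` carrier N) T)"

text \<open>
  Equality of types over \<open>A\<close>, expressed by a partial isomorphism that fixes \<open>A\<close>.
\<close>

definition same_type :: "('f, 'r) language \<Rightarrow> ('a, 'f, 'r) struc \<Rightarrow> 'a set \<Rightarrow> 'a list \<Rightarrow> 'a list \<Rightarrow> bool" where
  "same_type L N A y z \<longleftrightarrow>
    (\<exists>g. embedding L (restr N (A \<union> set y)) N g \<and> (\<forall>a\<in>A. g a = a) \<and> map g y = z)"

lemma same_type_sat:
  assumes L: "finite_relational L" and N: "rich L K N" and A: "A \<subseteq> carrier N" "A \<noteq> {}"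
    and y: "set y \<subseteq> carrier N" and same: "same_type L N A y z"
    and \<phi>: "wf_fm L \<phi>" "fv \<phi> \<subseteq> {..<length y + length p}" and p: "set p \<subseteq> A"
  shows "sat_at N (y @ p) \<phi> \<longleftrightarrow> sat_at N (z @ p) \<phi>"
proof -
  obtain g where g: "embedding L (restr N (A \<union> set y)) N g" "\<forall>a\<in>A. g a = a" "map g y = z"
    using same by (auto simp: same_type_def)
  have mp: "map g (y @ p) = z @ p" using g p by (auto intro!: map_idI)
  show ?thesis
    unfolding sat_at_def
  proof (rule rich_sat_iff[OF N _ _ g(1) \<phi>(1)])
    show "A \<union> set y \<subseteq> carrier N" "A \<union> set y \<noteq> {}" using A y by auto
    show "closed_under L N (A \<union> set y)" using L by (simp add: closed_under_def finite_relational_def)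
    fix i assume "i \<in> fv \<phi>"
    then have i: "i < length (y @ p)" using \<phi>(2) by auto
    have "(y @ p) ! i \<in> A \<union> set y" using nth_mem[OF i] p by auto
    moreover have "(z @ p) ! i = g ((y @ p) ! i)" using nth_map[OF i, of g] unfolding mp .
    ultimately show "(y @ p) ! i \<in> A \<union> set y \<and> (z @ p) ! i = g ((y @ p) ! i)" by blast
  qed
qed

lemma same_type_extend:
  assumes L: "finite_relational L" and N: "rich L K N" and A: "finite A" "A \<subseteq> carrier N" "A \<noteq> {}"
    and y: "set y \<subseteq> carrier N" and same: "same_type L N A y z" and w: "w \<in> carrier N"
  obtains w' where "w' \<in> carrier N" "same_type L N A (y @ [w]) (z @ [w'])"
proof -
  obtain g where g: "embedding L (restr N (A \<union> set y)) N g" "\<forall>a\<in>A. g a = a" "map g y = z"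
    using same by (auto simp: same_type_def)
  have s: "is_structure L (restr N (A \<union> set y))"
    using L A by (simp add: is_structure_restr closed_under_def finite_relational_def)
  obtain Y h where Y: "insert w (A \<union> set y) \<subseteq> Y" "embedding L (restr N Y) N h"
    "\<And>x. x \<in> A \<union> set y \<Longrightarrow> h x = g x"
    using rich_extend_embedding[OF N _ _ s g(1) w] A y by (metis Un_least finite_UnI finite_set)
  have "embedding L (restr N (A \<union> set (y @ [w]))) N h"
    by (rule embedding_restr_subset[OF Y(2)]) (use Y(1) in auto)
  moreover have "\<forall>a\<in>A. h a = a" using Y(3) g(2) by auto
  moreover have "map h y = z" using Y(3) g(3) by auto
  ultimately have "same_type L N A (y @ [w]) (z @ [h w])"
    unfolding same_type_def by (intro exI[of _ h]) simp
  moreover have "h w \<in> carrier N" using embedding_into[OF Y(2), of w] Y(1) by simp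
  ultimately show thesis using that by blast
qed

lemma same_type_length: "same_type L N A y z \<Longrightarrow> length z = length y"
  by (auto simp: same_type_def)

lemma same_type_in: "same_type L N A y z \<Longrightarrow> set z \<subseteq> carrier N"
proof -
  assume "same_type L N A y z"
  then obtain g where "embedding L (restr N (A \<union> set y)) N g" "map g y = z"
    by (auto simp: same_type_def)
  then show ?thesis using embedding_into by fastforce
qed

lemma same_type_trans:
  assumes "same_type L N A x y" "same_type L N A y z" "finite_relational L" "set y \<subseteq> carrier N" "A \<subseteq> carrier N"
  shows "same_type L N A x z"
proof -
  obtain g h where g: "embedding L (restr N (A \<union> set x)) N g" "\<forall>a\<in>A. g a = a" "map g x = y"
    and h: "embedding L (restr N (A \<union> set y)) N h" "\<forall>a\<in>A. h a = a" "map h y = z"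
    using assms by (auto simp: same_type_def)
  have "g ` (A \<union> set x) \<subseteq> A \<union> set y" using g by auto
  then have "embedding L (restr N (A \<union> set x)) (restr N (A \<union> set y)) g"
    using g(1) by (auto simp: embedding_def)
  from embedding_comp[OF this h(1)] show ?thesis
    unfolding same_type_def using g h by (intro exI[of _ "h \<circ> g"]) auto
qed

lemma same_type_append:
  assumes "same_type L N (A \<union> set z) [w] [w']"
  shows "same_type L N A (z @ [w]) (z @ [w'])"
proof -
  obtain g where g: "embedding L (restr N (A \<union> set z \<union> set [w])) N g" "\<forall>a\<in>A \<union> set z. g a = a"
    "map g [w] = [w']" using assms by (auto simp: same_type_def)
  have "A \<union> set (z @ [w]) = A \<union> set z \<union> set [w]" by auto
  then show ?thesis
    unfolding same_type_def using g by (intro exI[of _ g]) (auto intro!: map_idI)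
qed

text \<open>
  \<open>Z\<close> contains a realization of every type of \<open>m\<close>-tuples over \<open>A\<close>, so \<open>card Z\<close> bounds the number of
  these types.
\<close>

definition covers :: "('f, 'r) language \<Rightarrow> ('a, 'f, 'r) struc \<Rightarrow> 'a set \<Rightarrow> nat \<Rightarrow> 'a list set \<Rightarrow> bool" where
  "covers L N A m Z \<longleftrightarrow> finite Z \<and> (\<forall>z\<in>Z. tuple N m z) \<and>
    (\<forall>y. tuple N m y \<longrightarrow> (\<exists>z\<in>Z. same_type L N A y z))"

text \<open>
  If there are polynomially many types of single elements over a finite set, then there are
  polynomially many types of \<open>m\<close>-tuples. Realize the type of the first \<open>m\<close> entries by a tuple \<open>z\<close> in the
  list of representatives. By homogeneity the last entry can be moved along, and then it is compared to the
  representatives of single elements over \<open>A\<close> and \<open>z\<close>.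
\<close>

lemma covers_tuples:
  assumes L: "finite_relational L" and N: "rich L K N"
    and one: "\<And>A. finite A \<Longrightarrow> A \<subseteq> carrier N \<Longrightarrow> A \<noteq> {} \<Longrightarrow>
      \<exists>Z. covers L N A 1 Z \<and> card Z \<le> (card A + 2) ^ E"
    and A: "finite A" "A \<subseteq> carrier N" "A \<noteq> {}"
  shows "\<exists>Z. covers L N A m Z \<and> card Z \<le> (card A + m + 2) ^ (E * m)"
proof (induction m)
  case 0
  have "same_type L N A [] []"
    unfolding same_type_def using embedding_restr_id[OF A(2)] by (intro exI[of _ id]) simp
  then have "covers L N A 0 {[]}" by (auto simp: covers_def tuple_def)
  then show ?case by (intro exI[of _ "{[]}"]) simp
next
  case (Suc m)
  then obtain Z where Z: "covers L N A m Z" "card Z \<le> (card A + m + 2) ^ (E * m)" by blast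
  have "\<exists>W. covers L N (A \<union> set z) 1 W \<and> card W \<le> (card A + m + 2) ^ E" if z: "z \<in> Z" for z
  proof -
    have zt: "tuple N m z" using Z(1) z by (simp add: covers_def)
    then obtain W where W: "covers L N (A \<union> set z) 1 W" "card W \<le> (card (A \<union> set z) + 2) ^ E"
      using one[of "A \<union> set z"] A by (auto simp: tuple_def)
    have "card (set z) \<le> m" using zt card_length[of z] by (simp add: tuple_def)
    then have "card (A \<union> set z) + 2 \<le> card A + m + 2"
      using card_Un_le[of A "set z"] by linarith
    then have "(card (A \<union> set z) + 2) ^ E \<le> (card A + m + 2) ^ E" by (rule power_mono) simp
    then show ?thesis using W by (intro exI[of _ W]) simp
  qed
  then have "\<forall>z\<in>Z. \<exists>W. covers L N (A \<union> set z) 1 W \<and> card W \<le> (card A + m + 2) ^ E" by blast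
  from bchoice[OF this] obtain W where W: "\<And>z. z \<in> Z \<Longrightarrow> covers L N (A \<union> set z) 1 (W z)"
    "\<And>z. z \<in> Z \<Longrightarrow> card (W z) \<le> (card A + m + 2) ^ E" by blast
  define Z' where "Z' = (\<Union>z\<in>Z. (\<lambda>w. z @ w) ` W z)"
  have finZ: "finite Z" using Z(1) by (simp add: covers_def)
  have finW: "finite (W z)" if "z \<in> Z" for z using W(1)[OF that] by (simp add: covers_def)
  have "card Z' \<le> (\<Sum>z\<in>Z. card ((\<lambda>w. z @ w) ` W z))"
    unfolding Z'_def by (rule card_UN_le[OF finZ])
  also have "\<dots> \<le> (\<Sum>z\<in>Z. (card A + m + 2) ^ E)"
    by (intro sum_mono) (rule order_trans[OF card_image_le[OF finW] W(2)])
  also have "\<dots> = card Z * (card A + m + 2) ^ E" by simp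
  also have "\<dots> \<le> (card A + m + 2) ^ (E * m) * (card A + m + 2) ^ E" using Z(2) by (rule mult_le_mono1)
  also have "\<dots> = (card A + m + 2) ^ (E * Suc m)" by (simp add: power_add[symmetric] add.commute)
  also have "\<dots> \<le> (card A + Suc m + 2) ^ (E * Suc m)" by (rule power_mono) auto
  finally have "card Z' \<le> (card A + Suc m + 2) ^ (E * Suc m)" .
  moreover have "covers L N A (Suc m) Z'"
    unfolding covers_def
  proof (intro conjI ballI allI impI)
    show "finite Z'" using finZ finW by (auto simp: Z'_def)
    fix z' assume "z' \<in> Z'"
    then obtain z w where "z \<in> Z" "w \<in> W z" "z' = z @ w" by (auto simp: Z'_def)
    then show "tuple N (Suc m) z'" using Z(1) W(1)[of z] by (auto simp: covers_def tuple_def)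
  next
    fix y assume y: "tuple N (Suc m) y"
    then have "y \<noteq> []" by (auto simp: tuple_def)
    then obtain y0 w where y0: "y = y0 @ [w]" by (metis rev_exhaust)
    then have t: "tuple N m y0" "w \<in> carrier N" using y by (auto simp: tuple_def)
    then obtain z where z: "z \<in> Z" "same_type L N A y0 z" using Z(1) by (auto simp: covers_def)
    have y0N: "set y0 \<subseteq> carrier N" using t by (simp add: tuple_def)
    obtain w' where w': "w' \<in> carrier N" "same_type L N A (y0 @ [w]) (z @ [w'])"
      using same_type_extend[OF L N A y0N z(2) t(2)] by blast
    have "tuple N 1 [w']" using w'(1) by (simp add: tuple_def)
    then obtain u where u: "u \<in> W z" "same_type L N (A \<union> set z) [w'] u"
      using W(1)[OF z(1)] by (auto simp: covers_def)
    obtain w'' where w'': "u = [w'']" using same_type_length[OF u(2)] by (auto simp: length_Suc_conv)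
    have "same_type L N A (z @ [w']) (z @ u)" using same_type_append u(2) w'' by metis
    then have "same_type L N A y (z @ u)"
      using same_type_trans[OF w'(2) _ L _ A(2)] same_type_in[OF w'(2)] y0 by blast
    then show "\<exists>z\<in>Z'. same_type L N A y z" using z(1) u(1) by (auto simp: Z'_def)
  qed
  ultimately show ?case by blast
qed

lemma length_substitute [simp]: "length (substitute J w t) = length t"
  by (simp add: substitute_def)

text \<open>
  Every atomic condition on \<open>w\<close> and elements of \<open>A\<close> says that a tuple of elements of \<open>A\<close> is related to
  \<open>w\<close>, where \<open>w\<close> is written into some set \<open>J\<close> of positions.
\<close>

lemma same_type_if_traces:
  assumes L: "finite_relational L" and A: "A \<subseteq> carrier N" "A \<noteq> {}"
    and w: "w \<in> carrier N - A" "w' \<in> carrier N - A"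
    and tr: "\<And>R J. R \<in> rel_syms L \<Longrightarrow> J \<subseteq> {..<rel_ar L R} \<Longrightarrow>
      trace N R J {t. set t \<subseteq> A \<and> length t = rel_ar L R} w =
      trace N R J {t. set t \<subseteq> A \<and> length t = rel_ar L R} w'"
  shows "same_type L N A [w] [w']"
proof -
  define g where "g x = (if x = w then w' else x)" for x
  obtain a0 where a0: "a0 \<in> A" using A(2) by auto
  have "embedding L (restr N (A \<union> set [w])) N g"
    unfolding embedding_def
  proof (intro conjI ballI allI impI)
    show "g ` carrier (restr N (A \<union> set [w])) \<subseteq> carrier N" using A w by (auto simp: g_def)
    show "inj_on g (carrier (restr N (A \<union> set [w])))" using w by (auto simp: g_def inj_on_def)
  next
    fix f as assume "f \<in> fun_syms L"
    then show "g (fun_int (restr N (A \<union> set [w])) f as) = fun_int N f (map g as)"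
      using L by (simp add: finite_relational_def)
  next
    fix R as assume R: "R \<in> rel_syms L" and as: "tuple (restr N (A \<union> set [w])) (rel_ar L R) as"
    have len: "length as = rel_ar L R" and as_in: "set as \<subseteq> insert w A" using as by (auto simp: tuple_def)
    define J where "J = {i. i < rel_ar L R \<and> as ! i = w}"
    define t where "t = map (\<lambda>x. if x = w then a0 else x) as"
    have J: "J \<subseteq> {..<rel_ar L R}" by (auto simp: J_def)
    have t: "t \<in> {t. set t \<subseteq> A \<and> length t = rel_ar L R}" using as_in a0 len by (auto simp: t_def)
    have "substitute J w t = as"
      by (rule nth_equalityI) (auto simp: substitute_def J_def t_def len)
    moreover have "substitute J w' t = map g as"
      by (rule nth_equalityI) (auto simp: substitute_def J_def t_def len g_def)
    moreover have "rel_int N R (substitute J w t) \<longleftrightarrow> rel_int N R (substitute J w' t)"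
      using tr[OF R J] t unfolding trace_def by blast
    ultimately show "rel_int (restr N (A \<union> set [w])) R as \<longleftrightarrow> rel_int N R (map g as)" by simp
  qed
  moreover have "\<forall>a\<in>A. g a = a" using w(1) by (auto simp: g_def)
  ultimately show ?thesis unfolding same_type_def by (intro exI[of _ g]) (simp add: g_def)
qed

text \<open>
  The type of \<open>w\<close> over \<open>A\<close> is determined by finitely many traces on sets of size polynomial in \<open>card A\<close>.
  If no atomic formula with a single variable has the independence property, the Sauer-Shelah lemma
  leaves polynomially many possibilities for each trace.
\<close>

lemma covers_singletons:
  fixes d :: "'r \<times> nat set \<Rightarrow> nat"
  defines "Idx \<equiv> \<lambda>L :: ('f, 'r) language. SIGMA R:rel_syms L. Pow {..<rel_ar L R}"
  assumes L: "finite_relational L" and A: "finite A" "A \<subseteq> carrier N" "A \<noteq> {}"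
    and d: "\<And>R J. R \<in> rel_syms L \<Longrightarrow> J \<subseteq> {..<rel_ar L R} \<Longrightarrow> \<not> atom_shatters L N R J (d (R, J))"
  shows "\<exists>Z. covers L N A 1 Z \<and>
    card Z \<le> (card A + 2) ^ Suc (\<Sum>x\<in>Idx L. (rel_ar L (fst x) + 1) * d x)"
proof -
  define V where "V R = {t. set t \<subseteq> A \<and> length t = rel_ar L R}" for R
  define F where "F = (\<lambda>(R, J). trace N R J (V R) ` carrier N)"
  define s where "s = (\<Sum>x\<in>Idx L. (rel_ar L (fst x) + 1) * d x)"
  have finI: "finite (Idx L)"
    using L by (auto simp: Idx_def finite_relational_def)
  have finV: "finite (V R)" for R unfolding V_def by (rule finite_lists_length_eq[OF A(1)])
  have cardV: "card (V R) = card A ^ rel_ar L R" for R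
    unfolding V_def by (rule card_lists_length_eq[OF A(1)])
  have F_sub: "F (R, J) \<subseteq> Pow (V R)" for R J by (auto simp: F_def trace_def)
  have cardF: "card (F x) \<le> (card A + 2) ^ ((rel_ar L (fst x) + 1) * d x)" if x: "x \<in> Idx L" for x
  proof -
    obtain R J where RJ: "x = (R, J)" "R \<in> rel_syms L" "J \<subseteq> {..<rel_ar L R}"
      using x by (auto simp: Idx_def)
    have "\<not> shatters (F (R, J)) S" if S: "S \<subseteq> V R" "card S = d (R, J)" for S
    proof
      assume sh: "shatters (F (R, J)) S"
      have "shatters (trace N R J S ` carrier N) S"
      proof (rule shattersI)
        fix T assume "T \<subseteq> S"
        from shattersD[OF sh this] obtain w where w: "w \<in> carrier N" "trace N R J (V R) w \<inter> S = T"
          by (auto simp: F_def)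
        moreover have "trace N R J S w \<inter> S = trace N R J (V R) w \<inter> S" using S(1) by (auto simp: trace_def)
        ultimately show "\<exists>A\<in>trace N R J S ` carrier N. A \<inter> S = T" by blast
      qed
      moreover have "finite S" using S(1) finV finite_subset by blast
      moreover have "\<forall>t\<in>S. tuple N (rel_ar L R) t" using S(1) A(2) by (auto simp: V_def tuple_def)
      ultimately have "atom_shatters L N R J (d (R, J))" using S(2) unfolding atom_shatters_def by blast
      then show False using d RJ by blast
    qed
    then have "card (F (R, J)) \<le> (card (V R) + 1) ^ d (R, J)"
      by (rule sauer_shelah[OF finV F_sub])
    also have "card (V R) + 1 \<le> (card A + 2) ^ (rel_ar L R + 1)"
    proof -
      have "card A ^ rel_ar L R \<le> (card A + 2) ^ rel_ar L R" by (rule power_mono) auto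
      moreover have "1 \<le> (card A + 2) ^ rel_ar L R" by simp
      ultimately have "card (V R) + 1 \<le> 2 * (card A + 2) ^ rel_ar L R" unfolding cardV by linarith
      also have "\<dots> \<le> (card A + 2) * (card A + 2) ^ rel_ar L R" by (rule mult_le_mono1) simp
      finally show ?thesis by simp
    qed
    then have "(card (V R) + 1) ^ d (R, J) \<le> ((card A + 2) ^ (rel_ar L R + 1)) ^ d (R, J)"
      by (rule power_mono) simp
    finally show ?thesis unfolding RJ(1) fst_conv power_mult .
  qed
  define profile where "profile w = restrict (\<lambda>(R, J). trace N R J (V R) w) (Idx L)" for w
  have profile_in: "profile ` carrier N \<subseteq> PiE (Idx L) F"
    by (auto simp: profile_def F_def)
  have finF: "finite (F x)" for x
    using F_sub[of "fst x" "snd x"] finV[of "fst x"] by (metis finite_Pow_iff finite_subset prod.collapse)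
  have finP: "finite (PiE (Idx L) F)" by (rule finite_PiE[OF finI finF])
  have "card (profile ` (carrier N - A)) \<le> card (PiE (Idx L) F)"
    by (rule card_mono[OF finP]) (use profile_in in auto)
  also have "\<dots> = (\<Prod>x\<in>Idx L. card (F x))" by (rule card_PiE[OF finI])
  also have "\<dots> \<le> (\<Prod>x\<in>Idx L. (card A + 2) ^ ((rel_ar L (fst x) + 1) * d x))"
    by (rule prod_mono, intro conjI zero_le cardF)
  also have "\<dots> = (card A + 2) ^ s" by (simp add: s_def power_sum)
  finally have card_profile: "card (profile ` (carrier N - A)) \<le> (card A + 2) ^ s" .
  \<comment> \<open>Elements of \<open>A\<close> represent their own types; the other elements are sorted by their traces.\<close>
  define rep where "rep \<pi> = (SOME w. w \<in> carrier N - A \<and> profile w = \<pi>)" for \<pi>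
  have rep: "rep \<pi> \<in> carrier N - A \<and> profile (rep \<pi>) = \<pi>" if "\<pi> \<in> profile ` (carrier N - A)" for \<pi>
    unfolding rep_def by (rule someI_ex) (use that in auto)
  define Z where "Z = (\<lambda>a. [a]) ` A \<union> (\<lambda>\<pi>. [rep \<pi>]) ` profile ` (carrier N - A)"
  have finZ1: "finite (profile ` (carrier N - A))"
    using finP profile_in by (meson Diff_subset finite_subset image_mono order_trans)
  have "card Z \<le> card A + (card A + 2) ^ s"
    unfolding Z_def using card_Un_le card_image_le[OF A(1), of "\<lambda>a. [a]"]
      card_image_le[OF finZ1, of "\<lambda>\<pi>. [rep \<pi>]"] card_profile
    by (meson add_mono order_trans)
  also have "\<dots> \<le> (card A + 1) * (card A + 2) ^ s + (card A + 2) ^ s"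
  proof -
    have "(1 :: nat) \<le> (card A + 2) ^ s" by simp
    then have "card A * 1 \<le> (card A + 1) * (card A + 2) ^ s" by (intro mult_le_mono) auto
    then show ?thesis by simp
  qed
  also have "\<dots> = (card A + 2) ^ Suc s" by (simp add: algebra_simps)
  finally have cardZ: "card Z \<le> (card A + 2) ^ Suc s" .
  have "covers L N A 1 Z"
    unfolding covers_def
  proof (intro conjI ballI allI impI)
    show "finite Z" using A(1) finZ1 by (simp add: Z_def)
    show "tuple N 1 z" if "z \<in> Z" for z
      using that rep A(2) by (auto simp: Z_def tuple_def)
    fix y assume "tuple N 1 y"
    then obtain w where w: "y = [w]" "w \<in> carrier N" by (auto simp: tuple_def length_Suc_conv)
    show "\<exists>z\<in>Z. same_type L N A y z"
    proof (cases "w \<in> A")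
      case True
      have "A \<union> set [w] \<subseteq> carrier N" using w A(2) by auto
      from embedding_restr_id[OF this] have "same_type L N A [w] [w]"
        unfolding same_type_def by (intro exI[of _ id]) simp
      moreover have "[w] \<in> Z" using True by (auto simp: Z_def)
      ultimately show ?thesis using w(1) by blast
    next
      case False
      define w' where "w' = rep (profile w)"
      have \<pi>: "profile w \<in> profile ` (carrier N - A)" using w(2) False by auto
      have w': "w' \<in> carrier N - A" "profile w' = profile w" using rep[OF \<pi>] by (auto simp: w'_def)
      have "same_type L N A [w] [w']"
      proof (rule same_type_if_traces[OF L A(2,3) _ w'(1)])
        fix R J assume "R \<in> rel_syms L" "J \<subseteq> {..<rel_ar L R}"
        then have "(R, J) \<in> Idx L" by (simp add: Idx_def)
        then have "profile w (R, J) = trace N R J (V R) w" "profile w' (R, J) = trace N R J (V R) w'"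
          by (simp_all add: profile_def)
        then show "trace N R J {t. set t \<subseteq> A \<and> length t = rel_ar L R} w =
          trace N R J {t. set t \<subseteq> A \<and> length t = rel_ar L R} w'"
          unfolding V_def[symmetric] using w'(2) by simp
      qed (use w(2) False in simp)
      moreover have "[w'] \<in> Z" using \<pi> by (auto simp: Z_def w'_def)
      ultimately show ?thesis using w(1) by blast
    qed
  qed
  then show ?thesis using cardZ unfolding s_def by blast
qed

text \<open>
  The independence property of a formula with tuples of variables produces \<open>2 ^ k\<close> types of
  \<open>m\<close>-tuples over a set of at most \<open>n * k + 1\<close> elements. So the number of types cannot be polynomial,
  and some atomic formula has the independence property with a single variable.
\<close>

theorem IP_atom:
  fixes N :: "('b, 'f, 'r) struc"
  assumes L: "finite_relational L" and N: "rich L K N" and IP: "has_IP_in L N n {}"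
  shows "\<exists>R\<in>rel_syms L. \<exists>J. J \<subseteq> {..<rel_ar L R} \<and> (\<forall>d. atom_shatters L N R J d)"
proof -
  show ?thesis
  proof (rule ccontr)
    assume neg: "\<not> ?thesis"
    define d where "d x = (SOME d. \<not> atom_shatters L N (fst x) (snd x) d)" for x
    have d: "\<not> atom_shatters L N R J (d (R, J))" if "R \<in> rel_syms L" "J \<subseteq> {..<rel_ar L R}" for R J
    proof -
      have "\<exists>d. \<not> atom_shatters L N R J d" using neg that by blast
      from someI_ex[OF this] show ?thesis by (simp add: d_def)
    qed
    define E where "E = Suc (\<Sum>x\<in>(SIGMA R:rel_syms L. Pow {..<rel_ar L R}). (rel_ar L (fst x) + 1) * d x)"
    have one: "\<exists>Z. covers L N A 1 Z \<and> card Z \<le> (card A + 2) ^ E"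
      if "finite A" "A \<subseteq> carrier N" "A \<noteq> {}" for A
      unfolding E_def by (rule covers_singletons[OF L that d])
    define shattered where "shattered \<phi> m a \<longleftrightarrow>
      (\<forall>s. consistent N m ({(\<phi>, a i) | i. i \<in> s} \<union> {(Neg \<phi>, a i) | i. i \<notin> s}))"
      for \<phi> m and a :: "nat \<Rightarrow> 'b list"
    have "\<exists>\<phi> m a. wf_fm L \<phi> \<and> fv \<phi> \<subseteq> {..<m + n} \<and> (\<forall>i. realizes N n {} (a i)) \<and> shattered \<phi> m a"
      using IP unfolding has_IP_in_def shattered_def .
    then obtain \<phi> m a where \<phi>: "wf_fm L \<phi>" "fv \<phi> \<subseteq> {..<m + n}"
      and a: "\<And>i. realizes N n {} (a i)" and sh: "shattered \<phi> m a" by blast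
    have cons: "consistent N m ({(\<phi>, a i) | i. i \<in> s} \<union> {(Neg \<phi>, a i) | i. i \<notin> s})" for s
      using sh unfolding shattered_def by simp
    have at: "length (a i) = n" "set (a i) \<subseteq> carrier N" for i
      using a[of i] by (auto simp: realizes_def tuple_def)
    obtain a0 where a0: "a0 \<in> carrier N" using N by (auto simp: rich_def is_structure_def)
    have "2 ^ k \<le> (n * k + (m + 3)) ^ (E * m)" for k :: nat
    proof -
      define A where "A = insert a0 (\<Union>i<k. set (a i))"
      have A: "finite A" "A \<subseteq> carrier N" "A \<noteq> {}" using a0 at by (auto simp: A_def)
      have cardA: "card A \<le> n * k + 1"
      proof -
        have "card (\<Union>i<k. set (a i)) \<le> (\<Sum>i<k. card (set (a i)))" by (rule card_UN_le) simp
        also have "\<dots> \<le> (\<Sum>i<k. n)" using at(1) by (intro sum_mono) (metis card_length)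
        also have "\<dots> = n * k" by simp
        finally show ?thesis unfolding A_def using card_insert_le_m1 by (simp add: card_insert_if)
      qed
      obtain Z where Z: "covers L N A m Z" "card Z \<le> (card A + m + 2) ^ (E * m)"
        using covers_tuples[OF L N one A] by blast
      have "Pow {..<k} \<subseteq> (\<lambda>z. {i. i < k \<and> sat_at N (z @ a i) \<phi>}) ` Z"
      proof
        fix S assume "S \<in> Pow {..<k}"
        then have S: "S \<subseteq> {..<k}" by simp
        define \<pi> where "\<pi> = (\<lambda>i. (\<phi>, a i)) ` S \<union> (\<lambda>i. (Neg \<phi>, a i)) ` ({..<k} - S)"
        have "\<pi> \<subseteq> {(\<phi>, a i) | i. i \<in> S} \<union> {(Neg \<phi>, a i) | i. i \<notin> S}" by (auto simp: \<pi>_def)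
        moreover have "finite \<pi>" using S finite_subset by (auto simp: \<pi>_def)
        ultimately obtain y where y: "realizes N m \<pi> y" using cons[of S] unfolding consistent_def by blast
        have yS: "sat_at N (y @ a i) \<phi> \<longleftrightarrow> i \<in> S" if "i < k" for i
        proof (cases "i \<in> S")
          case True
          then have "(\<phi>, a i) \<in> \<pi>" by (simp add: \<pi>_def)
          then show ?thesis using y True by (auto simp: realizes_def)
        next
          case False
          then have "(Neg \<phi>, a i) \<in> \<pi>" using that by (simp add: \<pi>_def)
          then show ?thesis using y False by (auto simp: realizes_def sat_at_def)
        qed
        have yt: "length y = m" "set y \<subseteq> carrier N" using y by (auto simp: realizes_def tuple_def)
        then obtain z where z: "z \<in> Z" "same_type L N A y z" using Z(1) by (auto simp: covers_def tuple_def)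
        have "sat_at N (z @ a i) \<phi> \<longleftrightarrow> i \<in> S" if i: "i < k" for i
          using same_type_sat[OF L N A(2,3) yt(2) z(2) \<phi>(1), of "a i"] \<phi>(2) yt(1) at(1) yS[OF i] i
          by (auto simp: A_def)
        then have "S = {i. i < k \<and> sat_at N (z @ a i) \<phi>}" using S by auto
        then show "S \<in> (\<lambda>z. {i. i < k \<and> sat_at N (z @ a i) \<phi>}) ` Z" using z(1) by blast
      qed
      moreover have finZ: "finite Z" using Z(1) by (simp add: covers_def)
      ultimately have "card (Pow {..<k}) \<le> card Z"
        by (meson card_image_le card_mono finite_imageI order_trans)
      then have "2 ^ k \<le> card Z" by (simp add: card_Pow)
      also have "\<dots> \<le> (card A + m + 2) ^ (E * m)" by (rule Z(2))
      also have "\<dots> \<le> (n * k + (m + 3)) ^ (E * m)" by (rule power_mono) (use cardA in auto)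
      finally show ?thesis .
    qed
    then show False using poly_less_exp[of n "m + 3" "E * m"] by (metis not_less)
  qed
qed

text \<open>
  Passing to the dual costs an exponential: index \<open>2 ^ h\<close> shattered tuples by the subsets of
  \<open>{..<h}\<close>, and let \<open>w i\<close> be related to those tuples whose index contains \<open>i\<close>.
\<close>

lemma atom_shatters_pattern:
  assumes "atom_shatters L N R J (2 ^ h)"
  obtains w \<tau> where "\<And>i. i < h \<Longrightarrow> w i \<in> carrier N" "\<And>S. S \<subseteq> {..<h} \<Longrightarrow> tuple N (rel_ar L R) (\<tau> S)"
    "\<And>i S. i < h \<Longrightarrow> S \<subseteq> {..<h} \<Longrightarrow> rel_int N R (substitute J (w i) (\<tau> S)) \<longleftrightarrow> i \<in> S"
proof -
  from assms obtain T where T: "finite T" "card T = 2 ^ h" "\<And>t. t \<in> T \<Longrightarrow> tuple N (rel_ar L R) t"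
    "shatters (trace N R J T ` carrier N) T" unfolding atom_shatters_def by blast
  have "card (Pow {..<h}) = card T" using T(2) by (simp add: card_Pow)
  then obtain \<tau> where \<tau>: "bij_betw \<tau> (Pow {..<h}) T"
    using finite_same_card_bij[of "Pow {..<h}" T] T(1) by auto
  have \<tau>T: "\<tau> S \<in> T" if "S \<subseteq> {..<h}" for S using \<tau> that by (auto simp: bij_betw_def)
  have \<tau>_eq: "\<tau> S = \<tau> S' \<longleftrightarrow> S = S'" if "S \<subseteq> {..<h}" "S' \<subseteq> {..<h}" for S S'
    using inj_on_eq_iff[OF bij_betw_imp_inj_on[OF \<tau>]] that by simp
  have "\<exists>w. w \<in> carrier N \<and> (\<forall>S. S \<subseteq> {..<h} \<longrightarrow> (rel_int N R (substitute J w (\<tau> S)) \<longleftrightarrow> i \<in> S))" for i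
  proof -
    \<comment> \<open>The tuples to which \<open>w i\<close> has to be related.\<close>
    define Ti where "Ti = \<tau> ` {S. S \<subseteq> {..<h} \<and> i \<in> S}"
    have "Ti \<subseteq> T" using \<tau>T by (auto simp: Ti_def)
    from shattersD[OF T(4) this] obtain w where w: "w \<in> carrier N" "trace N R J T w \<inter> T = Ti" by auto
    have "rel_int N R (substitute J w (\<tau> S)) \<longleftrightarrow> i \<in> S" if S: "S \<subseteq> {..<h}" for S
    proof -
      have "rel_int N R (substitute J w (\<tau> S)) \<longleftrightarrow> \<tau> S \<in> trace N R J T w \<inter> T"
        using \<tau>T[OF S] by (auto simp: trace_def)
      also have "\<dots> \<longleftrightarrow> i \<in> S" unfolding w(2) using \<tau>_eq[OF S] S by (auto simp: Ti_def)
      finally show ?thesis .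
    qed
    then show ?thesis using w(1) by blast
  qed
  then have "\<exists>w. \<forall>i. w i \<in> carrier N \<and> (\<forall>S. S \<subseteq> {..<h} \<longrightarrow> (rel_int N R (substitute J (w i) (\<tau> S)) \<longleftrightarrow> i \<in> S))"
    by (intro choice allI)
  then obtain w where "\<forall>i. w i \<in> carrier N \<and>
    (\<forall>S. S \<subseteq> {..<h} \<longrightarrow> (rel_int N R (substitute J (w i) (\<tau> S)) \<longleftrightarrow> i \<in> S))" by blast
  then show thesis using that[of w \<tau>] T(3) \<tau>T by blast
qed

context branch_type
begin

text \<open>
  Realize, in a cone above \<open>B\<close>, points \<open>w i\<close> for all \<open>i\<close> together with parameter tuples for all finite
  patterns. The latter are indexed by \<open>k\<close> and by lists \<open>s\<close> that stand for subsets of \<open>{..<k}\<close>, as the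
  variables must be countable in number. The formula has \<open>c\<close> among its object variables.
\<close>

theorem IP_in_cone:
  fixes N0 :: "('w, 'f, 'r) struc"
  assumes inf: "infinite (UNIV :: 'u set)" and fits: "set_fits (carrier M) TYPE('u)"
    and N0: "rich L (finite_models L U) N0" "\<And>\<psi>. \<psi> \<in> U \<Longrightarrow> holds N0 \<psi>"
    and IP: "has_IP_in L N0 n {}"
  shows "has_IP TYPE('u) (star_lang L) M 1 q"
proof -
  obtain R J where R: "R \<in> rel_syms L" and J: "J \<subseteq> {..<rel_ar L R}"
    and sh: "\<And>d. atom_shatters L N0 R J d" 
    using IP_atom[OF L N0(1) IP] by blast
  define r where "r = rel_ar L R"
  define \<psi> :: "('f, 'r) fm" where "\<psi> = Rel R (map Var [0..<r])"
  define v where "v k i s p = (if p \<in> J then Inl i else Inr (k, s, p))"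
    for k i p :: nat and s :: "nat list"
  define D where "D = {(k :: nat, i, s). i < k \<and> set s \<subseteq> {..<k}}"
  define lit where "lit = (\<lambda>(k :: nat, i, s). (if i \<in> set s then \<psi> else Neg \<psi>, v k i s))"
  have wf: "wf_fm L \<psi>" "quantifier_free \<psi>" using R by (simp_all add: \<psi>_def r_def)
  have ne: "carrier N0 \<noteq> {}" using N0(1) by (simp add: rich_def is_structure_def)
  obtain z :: "nat \<Rightarrow> 'u" where z: "inj z" by (rule infinite_nat_embedding[OF inf])
  define ix :: "nat + nat \<times> nat list \<times> nat \<Rightarrow> 'u" where "ix = z \<circ> to_nat"
  have ix: "inj ix" unfolding ix_def by (rule inj_compose[OF z inj_to_nat])
  have finsat: "\<exists>\<theta>. range \<theta> \<subseteq> carrier N0 \<and> (\<forall>(\<psi>, v)\<in>\<Delta>0. sat N0 (\<theta> \<circ> v) \<psi>)"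
    if \<Delta>0: "finite \<Delta>0" "\<Delta>0 \<subseteq> lit ` D" for \<Delta>0
  proof -
    obtain D0 where D0: "D0 \<subseteq> D" "finite D0" "\<Delta>0 = lit ` D0"
      using finite_subset_image[OF \<Delta>0] by blast
    have "finite (fst ` D0)" using D0(2) by simp
    then obtain h where h: "\<forall>k\<in>fst ` D0. k < h" unfolding finite_nat_set_iff_bounded by blast
    obtain w \<tau> where w: "\<And>i. i < h \<Longrightarrow> w i \<in> carrier N0"
      and \<tau>: "\<And>S. S \<subseteq> {..<h} \<Longrightarrow> tuple N0 (rel_ar L R) (\<tau> S)"
      and w\<tau>: "\<And>i S. i < h \<Longrightarrow> S \<subseteq> {..<h} \<Longrightarrow> rel_int N0 R (substitute J (w i) (\<tau> S)) \<longleftrightarrow> i \<in> S"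
      using atom_shatters_pattern[OF sh[of "2 ^ h"]] by metis
    obtain a0 where a0: "a0 \<in> carrier N0" using ne by auto
    define \<theta> where "\<theta> x = (case x of Inl i \<Rightarrow> if i < h then w i else a0
      | Inr (k, s, p) \<Rightarrow> if set s \<subseteq> {..<h} \<and> p < r then \<tau> (set s) ! p else a0)"
      for x :: "nat + nat \<times> nat list \<times> nat"
    have "\<theta> x \<in> carrier N0" for x
    proof (cases x)
      case (Inl i)
      then show ?thesis using w a0 by (simp add: \<theta>_def)
    next
      case (Inr y)
      obtain k s p where y: "y = (k, s, p)" by (cases y)
      have "\<tau> (set s) ! p \<in> carrier N0" if "set s \<subseteq> {..<h}" "p < r"
        using \<tau>[OF that(1)] that(2) nth_mem[of p "\<tau> (set s)"] by (auto simp: tuple_def r_def)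
      then show ?thesis using Inr y a0 by (simp add: \<theta>_def)
    qed
    moreover have "sat N0 (\<theta> \<circ> v k i s) (if i \<in> set s then \<psi> else Neg \<psi>)" if kis: "(k, i, s) \<in> D0" for k i s
    proof -
      have kh: "k < h" using h kis by force
      have "i < k" "set s \<subseteq> {..<k}" using D0(1) kis by (auto simp: D_def)
      then have i: "i < h" and s: "set s \<subseteq> {..<h}" using kh by (auto simp: subset_iff intro: less_trans)
      have "map (\<lambda>p. \<theta> (v k i s p)) [0..<r] = substitute J (w i) (\<tau> (set s))"
        using \<tau>[OF s] i s by (intro nth_equalityI) (auto simp: \<theta>_def v_def substitute_def tuple_def r_def)
      then have "sat N0 (\<theta> \<circ> v k i s) \<psi> \<longleftrightarrow> rel_int N0 R (substitute J (w i) (\<tau> (set s)))"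
        by (simp add: \<psi>_def comp_def)
      then show ?thesis using w\<tau>[OF i s] by simp
    qed
    ultimately show ?thesis
      by (intro exI[of _ \<theta>]) (auto simp: D0(3) lit_def)
  qed
  obtain N :: "('u, tree_fun, 'r tree_rel) struc" and e :: "'m \<Rightarrow> 'u" and c :: 'u and Y
    where N: "is_structure (star_lang L) N" "elementary_embedding (star_lang L) M N e"
    "c \<in> carrier N" "range Y \<subseteq> carrier N" "\<And>b. b \<in> B \<Longrightarrow> below N (e b) c" "\<And>x. below N c (Y x)"
    "\<And>\<psi> v. (\<psi>, v) \<in> lit ` D \<Longrightarrow> sat N (case_nat c (Y \<circ> v)) (star_fm \<psi>)"
  proof (rule cone_realization[where \<Delta> = "lit ` D", OF ne N0(2) B inf fits ix], goal_cases)
    case (1 \<psi>)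
    then show ?case by simp
  next
    case (2 \<psi>' v')
    then show ?case using wf by (auto simp: lit_def)
  next
    case (3 \<Delta>0)
    then show ?case using finsat by simp
  next
    case (4 N e c Y)
    show ?case by (rule 4(1)[OF 4(2-5)]) (use 4 in auto)
  qed
  have N_model: "star_model L N U" by (rule elementary_extension_star_model[OF N(1,2)])
  interpret N: star_model L N U by fact
  have YN: "Y x \<in> carrier N" for x using N(4) by auto
  obtain A0 where A0: "A0 \<in> finite_models L U" using finite_models_nonempty[OF ne N0(2)] by auto
  have real: "realizes N 1 (push e q) [Y x]" for x
  proof (rule realizes_above_branch[OF A0 B q N_model N(2) YN])
    fix b assume b: "b \<in> B"
    then have "e b \<in> carrier N"
      using branch_subset[OF B] N(2) by (auto simp: elementary_embedding_def)
    then show "below N (e b) (Y x)" using N.less_leq_trans[OF _ N(3) YN N(5)[OF b]] N(6)[of x] by simp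
  qed
  have sat_star: "star N R c (map (\<lambda>p. Y (v k i s p)) [0..<r]) \<longleftrightarrow> i \<in> set s"
    if "i < k" "set s \<subseteq> {..<k}" for k i s
  proof -
    have "(k, i, s) \<in> D" using that by (simp add: D_def)
    then have "lit (k, i, s) \<in> lit ` D" by blast
    then have "(if i \<in> set s then \<psi> else Neg \<psi>, v k i s) \<in> lit ` D" by (simp add: lit_def)
    from N(7)[OF this] show ?thesis by (auto simp: \<psi>_def comp_def split: if_splits)
  qed
  define \<chi> :: "(tree_fun, 'r tree_rel) fm"
    where "\<chi> = Rel (Star R) (Var 0 # map (\<lambda>p. if p \<in> J then Var (Suc r) else Var (Suc p)) [0..<r])"
  define a where "a i = [Y (Inl i)]" for i
  define tup where "tup k s = c # map (\<lambda>p. Y (Inr (k, s, p))) [0..<r]" for k s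
  have tup: "tuple N (Suc r) (tup k s)" for k s using N(3) YN by (auto simp: tup_def tuple_def)
  have sat_\<chi>: "sat_at N (tup k s @ a i) \<chi> \<longleftrightarrow> i \<in> set s" if "i < k" "set s \<subseteq> {..<k}" for k i s
  proof -
    have m: "map (\<lambda>p. tm_val N ((!) (tup k s @ a i)) (if p \<in> J then Var (Suc r) else Var (Suc p))) [0..<r] =
      map (\<lambda>p. Y (v k i s p)) [0..<r]"
      by (rule nth_equalityI) (auto simp: tup_def a_def v_def nth_append)
    have "sat_at N (tup k s @ a i) \<chi> \<longleftrightarrow> star N R c (map (\<lambda>p. Y (v k i s p)) [0..<r])"
      unfolding m[symmetric] by (simp add: \<chi>_def sat_at_def comp_def tup_def)
    then show ?thesis using sat_star[OF that] by simp
  qed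
  have "has_IP_in (star_lang L) N 1 (push e q)"
    unfolding has_IP_in_def
  proof (intro exI conjI allI)
    show "wf_fm (star_lang L) \<chi>" using R by (auto simp: \<chi>_def r_def)
    show "fv \<chi> \<subseteq> {..<Suc r + 1}" by (auto simp: \<chi>_def split: if_splits)
    show "realizes N 1 (push e q) (a i)" for i unfolding a_def by (rule real)
    show "consistent N (Suc r) ({(\<chi>, a i) |i. i \<in> s} \<union> {(Neg \<chi>, a i) |i. i \<notin> s})" for s
      unfolding consistent_def
    proof (intro allI impI)
      fix \<pi> assume \<pi>: "\<pi> \<subseteq> {(\<chi>, a i) |i. i \<in> s} \<union> {(Neg \<chi>, a i) |i. i \<notin> s}" "finite \<pi>"
      have "\<forall>x\<in>\<pi>. \<exists>i. x = (if i \<in> s then (\<chi>, a i) else (Neg \<chi>, a i))"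
      proof
        fix x assume "x \<in> \<pi>"
        then consider i where "x = (\<chi>, a i)" "i \<in> s" | i where "x = (Neg \<chi>, a i)" "i \<notin> s" using \<pi>(1) by blast
        then show "\<exists>i. x = (if i \<in> s then (\<chi>, a i) else (Neg \<chi>, a i))" by cases auto
      qed
      from bchoice[OF this] obtain f
        where f: "\<forall>x\<in>\<pi>. x = (if f x \<in> s then (\<chi>, a (f x)) else (Neg \<chi>, a (f x)))" by blast
      have "finite (f ` \<pi>)" using \<pi>(2) by simp
      then obtain k where k: "\<forall>i\<in>f ` \<pi>. i < k" unfolding finite_nat_set_iff_bounded by blast
      obtain l where l: "set l = s \<inter> {..<k}" using finite_list[of "s \<inter> {..<k}"] by auto
      have "realizes N (Suc r) \<pi> (tup k l)"
        unfolding realizes_def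
      proof (intro conjI tup ballI, clarify)
        fix \<phi> p assume x: "(\<phi>, p) \<in> \<pi>"
        define i where "i = f (\<phi>, p)"
        have i: "i < k" using k x by (auto simp: i_def)
        have *: "(\<phi>, p) = (if i \<in> s then (\<chi>, a i) else (Neg \<chi>, a i))" using f x unfolding i_def by blast
        have "sat_at N (tup k l @ a i) \<chi> \<longleftrightarrow> i \<in> s" using sat_\<chi>[OF i, of l] l i by auto
        then show "sat_at N (tup k l @ p) \<phi>" using * by (cases "i \<in> s") (auto simp: sat_at_def)
      qed
      then show "\<exists>a. realizes N (Suc r) \<pi> a" by blast
    qed
  qed
  then show ?thesis unfolding has_IP_def using N(1,2) by blast
qed

end

theorem proposition4p19:
  fixes L :: "('f, 'r) language"
    and T_forall :: "('f, 'r) fm set"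
    and F :: "('c, 'f, 'r) struc"
    and F_star :: "('d, tree_fun, 'r tree_rel) struc"
    and T :: "('f, 'r) fm set"
    and T_star :: "(tree_fun, 'r tree_rel) fm set"
    and M :: "('m, tree_fun, 'r tree_rel) struc"
    and B :: "'m set"
    and q_T :: "((tree_fun, 'r tree_rel) fm \<times> 'm list) set"
  assumes "finite_relational L"
    and "universal_theory L T_forall"
    and "fraisse_class L (finite_models L T_forall)"
    and "SAP L (finite_models L T_forall)"
    and "fraisse_limit L (finite_models L T_forall) F"
    and "T = Th L F"
    and "fraisse_limit (star_lang L)
          (finite_models (star_lang L) (star_theory L T_forall)) F_star"
    and "T_star = Th (star_lang L) F_star"
    and "models (star_lang L) M T_star"
    and "branch M B"
    and "complete_type (star_lang L) M 1 (carrier M) q_T"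
    and "above_branch B \<subseteq> q_T"
    and "infinite (UNIV :: 'u set)"
    and "set_fits (carrier M) TYPE('u)"
  shows "(\<forall>\<kappa> :: 'k rel. Card_order \<kappa> \<and> card_fits \<kappa> TYPE('u) \<longrightarrow>
            dpr_less TYPE('u) (star_lang L) M (carrier M) 1 q_T \<kappa> \<longrightarrow>
            theory_dpr_less TYPE('v) L T \<kappa>)
       \<and> (theory_has_IP TYPE('w) L T \<longrightarrow> has_IP TYPE('u) (star_lang L) M 1 q_T)"
proof -
  interpret branch_type L T_forall F_star M B q_T
    using assms by (intro branch_type.intro) simp_all
  note model = relational_model_rich[OF assms(1,2,5)]
  show ?thesis
  proof (intro conjI allI impI, elim conjE)
    fix \<kappa> :: "'k rel"
    assume \<kappa>: "Card_order \<kappa>" "card_fits \<kappa> TYPE('u)"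
      and less: "dpr_less TYPE('u) (star_lang L) M (carrier M) 1 q_T \<kappa>"
    show "theory_dpr_less TYPE('v) L T \<kappa>"
      unfolding theory_dpr_less_def assms(6)
    proof (intro allI impI)
      fix N0 :: "('v, 'f, 'r) struc" assume N0: "models L N0 (Th L F)"
      show "dpr_less_in L N0 {} 1 {(Eq (Var 0) (Var 0), [])} \<kappa>"
        by (rule dpr_less_in_cone[OF assms(13,14) model(1)[OF N0] model(2)[OF N0] \<kappa> less])
    qed
  next
    assume "theory_has_IP TYPE('w) L T"
    then obtain N0 :: "('w, 'f, 'r) struc" and n where N0: "models L N0 (Th L F)" "has_IP_in L N0 n {}"
      unfolding theory_has_IP_def assms(6) by blast
    show "has_IP TYPE('u) (star_lang L) M 1 q_T"
      by (rule IP_in_cone[OF assms(13,14) model(1)[OF N0(1)] model(2)[OF N0(1)] N0(2)])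
  qed
qed

end
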